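(* Consider the fully discrete conservative DLRA–DG algorithm for the Vlasov–Poisson equation described in the context (rank-adaptive unconventional integrator with fixed velocity functions $U_1,\dots,U_m$, explicit Euler time stepping with step size $\tau>0$), run with central fluxes ($\alpha=1$). Assume $m\ge 1$ and that the constant function $1$ belongs to $\mathrm{span}\{U_1,\dots,U_m\}$. Let $f^n$ ($n=0,1,2,\dots$) be the computed approximations and let $$\rho^n=\int_{\Omega^{(v)}} f^n\,\mathrm d\bm v,\qquad \bm j^n=(j^n_1,\dots,j^n_d),\quad j^n_s=\int_{\Omega^{(v)}} v_s f^n\,\mathrm d\bm v .$$ Then (in exact arithmetic) for all $n=0,1,2,\dots$ and all $\psi\in\mathcal V^{(x)}_{h,p}$, $$\frac1\tau\int_{\Omega^{(x)}}(\rho^{n+1}-\rho^n)\,\psi\,\mathrm d\bm x-\sum_{T\in\mathcal T_h^{(x)}}\int_T \bm j^n\cdot\nabla\psi\,\mathrm d\bm x+\sum_{e\in\mathcal F_h^{(x)}}\int_e\big(\bm n^{(e)}\cdot\{\bm j^n\}_e\big)\,[\psi]_e\,\mathrm dS=0,$$ which is the DG discretization with central fluxes and explicit Euler time stepping of the continuity equation $\partial_t\rho+\nabla_x\cdot\bm j=0$. Hence the total mass is conserved: $\int_{\Omega^{(x)}}\rho^{n+1}\,\mathrm d\bm x=\int_{\Omega^{(x)}}\rho^n\,\mathrm d\bm x$ for all $n$.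
   Context: **Equation.** Vlasov–Poisson: $\partial_t f+\bm v\cdot\nabla_{\bm x}f-\bm E\cdot\nabla_{\bm v}f=0$, $\bm E=-\nabla_{\bm x}\Phi$, $-\Delta\Phi=1-\int f\,\mathrm d\bm v$. **Domains and DG spaces.** $\Omega^{(x)},\Omega^{(v)}\subset\mathbb R^d$ are bounded boxes regarded as periodic domains. For $y\in\{x,v\}$, $\mathcal T_h^{(y)}$ is a (not necessarily conforming) finite periodic triangulation of $\Omega^{(y)}$, and $\mathcal V^{(y)}_{h,k}=\{U\in L_2(\Omega^{(y)}):U|_T \text{ is a polynomial of degree}\le k\text{ for all }T\in\mathcal T_h^{(y)}\}$. The spaces $\mathcal V^{(x)}_{h,p}$ and $\mathcal V^{(v)}_{h,q}$ (degrees $p,q$) are used. $\mathcal F^{(y)}_h$ is the set of $(d-1)$-dimensional faces (interfaces between neighbouring elements; by periodicity all faces are interior, those on the boundary of the box being identified with the opposite ones). Each $e\in\mathcal F_h^{(y)}$ carries a fixed unit normal $\bm n^{(e)}$, and $U^\pm_e(\bm y)=\lim_{\epsilon\to0^+}U(\bm y\pm\epsilon\bm n^{(e)})$, $\{U\}_e=\frac12(U_e^++U_e^-)$, $[U]_e=U_e^--U_e^+$ (componentwise for vectors). **Inner products.** $(\cdot,\cdot)_x,(\cdot,\cdot)_v,(\cdot,\cdot)_{xv}$ are the $L_2$ inner products on $\Omega^{(x)},\Omega^{(v)},\Omega^{(x)}\times\Omega^{(v)}$ (for vector functions, summed over components); $(V,W)_{v,\omega}=\int_{\Omega^{(v)}}VW\omega\,\mathrm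 d\bm v$ with $\omega(\bm v)=\exp(-\|\bm v\|^2/2)$. **Discrete derivative.** For piecewise smooth $U$ and $V$ on $\mathcal T_h^{(y)}$, $(\hat{\mathrm d}_{y_s}U,V)_y:=\sum_T\int_T\partial_{y_s}U\,V\,\mathrm d\bm y-\sum_e\int_e n^{(e)}_s[U]_e\{V\}_e\,\mathrm dS$. **Numerical flux.** For symmetric matrices $\mathsf A^{(1)},\dots,\mathsf A^{(d)}$ put $\mathsf A_e=\sum_s n_s^{(e)}\mathsf A^{(s)}$ and $\bm F_e^*(\bm U_e^-,\bm U_e^+)=\mathsf A_e\{\bm U\}_e+\frac{1-\alpha}2|\mathsf A_e|[\bm U]_e$, with $|\mathsf A_e|$ the matrix absolute value; $\alpha=1$ is the central flux. **State at step $n$.** $f^n=\omega\sum_{i,j=1}^rS^n_{ij}X^n_i\otimes V^n_j$, with $X_i^n\in\mathcal V^{(x)}_{h,p}$ orthonormal in $(\cdot,\cdot)_x$, $V_j^n\in\mathcal V^{(v)}_{h,q}$ orthonormal in $(\cdot,\cdot)_{v,\omega}$, $V^n_a=U_a$ for $a=1,\dots,m$ with fixed functions $U_a\in\mathcal V_{h,q}^{(v)}$ independent of $n$, and $S^n_{a\mu}=0$ for $a\le m<\mu$ (always achievable by a change of the basis $X^n$). The rank $r$ may depend on $n$. Set $K^n_j=\sum_iX_i^nS^n_{ij}$. $\bm E^n=-\nabla\Phi^n$ is the exact electric field of $\rho^n=(f^n,1)_v$, i.e. $\Phi^n$ is periodic and $-\Delta\Phi^n=1-\rho^n$; the initial data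 satisfy the compatibility condition $\int_{\Omega^{(x)}}\rho^0\,\mathrm d\bm x=|\Omega^{(x)}|$. **One time step.** (K-step) $\mathsf A^{(x,s)}_{ij}=(v_sV_j^n,V_i^n)_{v,\omega}$, $\mathsf B^{(x,s)}_{h,ij}=(\hat{\mathrm d}_{v_s}(\omega V_j^n),V_i^n)_v$. Find $\bm K^{n+1}\in(\mathcal V_{h,p}^{(x)})^r$ with $$\tfrac1\tau(\bm K^{n+1}-\bm K^n,\bm\psi)_x+\sum_T\sum_s\int_T\big[-(\mathsf A^{(x,s)}\bm K^n)\cdot\partial_{x_s}\bm\psi-E^n_s(\mathsf B_h^{(x,s)}\bm K^n)\cdot\bm\psi\big]\mathrm d\bm x+\sum_{e\in\mathcal F_h^{(x)}}\int_e\bm F^*_e((\bm K^n)_e^-,(\bm K^n)_e^+)\cdot[\bm\psi]_e\,\mathrm dS=0$$ for all $\bm\psi\in(\mathcal V^{(x)}_{h,p})^r$ (flux built from $\mathsf A^{(x,s)}$). (L-step) $\mathsf A^{(v,s)}_{ij}=(-E^n_sX_j^n,X_i^n)_x$, $\mathsf B^{(v,s)}_{h,ij}=(\hat{\mathrm d}_{x_s}X_j^n,X_i^n)_x$; $\widehat{\mathsf A}^{(v,s)},\widehat{\mathsf B}_h^{(v,s)}$ are the submatrices with both indices in $\{m+1,\dots,r\}$, and $\bar{\mathsf A}^{(v,s)},\bar{\mathsf B}_h^{(v,s)}$ those with row index in $\{m+1,\dots,r\}$ and all columns; $\bar S=[S^n_{ia}]_{i\le r,a\le m}$, $\bm U=[U_a]_a$.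 $\mathcal P_\omega:\mathcal V_{h,q}^{(v)}\to\mathcal V_{h,q}^{(v)}$ is the invertible map with $(\mathcal P_\omega L,\psi)_v=(\omega L,\psi)_v$ for all $\psi\in\mathcal V_{h,q}^{(v)}$. With $\widehat L^n_\mu=\mathcal P_\omega(\sum_{\nu>m}S^n_{\mu\nu}V^n_\nu)$, $\mu=m+1,\dots,r$, find $\widehat{\bm L}^{n+1}\in(\mathcal V_{h,q}^{(v)})^{r-m}$ with $(U_a,\widehat L^{n+1}_\mu)_v=0$ and $$\tfrac1\tau(\widehat{\bm L}^{n+1}-\widehat{\bm L}^n,\bm\psi)_v+\sum_T\sum_s\int_T\big[-(\widehat{\mathsf A}^{(v,s)}\widehat{\bm L}^n)\cdot\partial_{v_s}\bm\psi+v_s(\widehat{\mathsf B}_h^{(v,s)}\widehat{\bm L}^n)\cdot\bm\psi\big]\mathrm d\bm v+\sum_{e\in\mathcal F_h^{(v)}}\int_e\bm F_e^*((\widehat{\bm L}^n)^-_e,(\widehat{\bm L}^n)^+_e)\cdot[\bm\psi]_e\,\mathrm dS=-\sum_s\big(\bar{\mathsf A}^{(v,s)}\bar S\,\partial_{v_s}(\omega\bm U)+v_s\bar{\mathsf B}_h^{(v,s)}\bar S\,\omega\bm U,\bm\psi\big)_v$$ for all $\bm\psi\in(\mathcal V_{h,q}^{(v)})^{r-m}$ with $(U_a,\psi_\mu)_{v,\omega}=0$ (derivatives elementwise, flux built from $\widehat{\mathsf A}^{(v,s)}$). Set $L^{n+1}_\mu=\mathcal P_\omega^{-1}\widehat L_\mu^{n+1}$.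 (Augmentation) $\{\tilde X_k^{n+1}\}_k\subset\mathcal V^{(x)}_{h,p}$ is a $(\cdot,\cdot)_x$-orthonormal basis of $\mathrm{span}\{X_i^n,K_i^{n+1}\}_{i\le r}$ (generically $2r$ functions), and $\{\tilde V_\ell^{n+1}\}_\ell\subset\mathcal V^{(v)}_{h,q}$ is a $(\cdot,\cdot)_{v,\omega}$-orthonormal basis of $\mathrm{span}(\{V_j^n\}_{j\le r}\cup\{L_\mu^{n+1}\}_{\mu>m})$ (generically $2r-m$ functions) with $\tilde V_a^{n+1}=U_a$ for $a\le m$. Put $\tilde S^n_{k\ell}=\sum_{ij}(\tilde X_k^{n+1},X_i^n)_xS^n_{ij}(\tilde V_\ell^{n+1},V_j^n)_{v,\omega}$. (S-step) $\tilde S^{n+1}_{k\ell}=\tilde S^n_{k\ell}-\tau\sum_{i,j,s}\big[(\hat{\mathrm d}_{x_s}X_i^n,\tilde X_k^{n+1})_xS_{ij}^n(\tilde V_\ell^{n+1},v_sV_j^n)_{v,\omega}+(\tilde X_k^{n+1},-E_s^nX_i^n)_xS^n_{ij}(\hat{\mathrm d}_{v_s}(\omega V_j^n),\tilde V_\ell^{n+1})_v\big]$. (Truncation) Write $\omega\sum_{k\ell}\tilde S^{n+1}_{k\ell}\tilde X_k^{n+1}\otimes\tilde V_\ell^{n+1}=\omega\sum_{a\le m}\tilde K_a\otimes U_a+\omega\sum_{\ell>m}\tilde K_\ell\otimes\tilde V_\ell^{n+1}$. The first sum is kept; in the second, $\sum_{\ell>m}\tilde K_\ell\otimes\tilde V^{n+1}_\ell$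 is replaced by a truncated singular value decomposition, whose velocity functions lie in $\mathrm{span}\{\tilde V_\ell^{n+1}\}_{\ell>m}$ and hence are $(\cdot,\cdot)_{v,\omega}$-orthogonal to all $U_a$. The result is $f^{n+1}$, rewritten in the format of the state at step $n+1$. *)

theory Defs
  imports "HOL-Analysis.Analysis"
begin

section \<open>Periodic meshes and discontinuous Galerkin spaces\<close>

text \<open>A mesh of the box with corners \<open>mlo\<close> and \<open>mhi\<close>. Opposite sides of the box are identified,
  so \<open>mfaces\<close> holds one representative for each interface of the periodic domain.\<close>

record 'd mesh =
  mlo :: "real ^ 'd"
  mhi :: "real ^ 'd"
  melems :: "(real ^ 'd) set set"
  mfaces :: "(real ^ 'd) set set"
  mnormal :: "(real ^ 'd) set \<Rightarrow> real ^ 'd"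

definition mdom :: "'d::finite mesh \<Rightarrow> (real ^ 'd) set" where
  "mdom M = cbox (mlo M) (mhi M)"

definition periods :: "'d::finite mesh \<Rightarrow> (real ^ 'd) set" where
  "periods M = {z. \<forall>i. \<exists>k::int. z $ i = of_int k * (mhi M $ i - mlo M $ i)}"

definition wrap :: "'d::finite mesh \<Rightarrow> real ^ 'd \<Rightarrow> real ^ 'd" where
  "wrap M y = (\<chi> i. y $ i -
     of_int \<lfloor>(y $ i - mlo M $ i) / (mhi M $ i - mlo M $ i)\<rfloor> * (mhi M $ i - mlo M $ i))"

text \<open>An interface is a \<open>(d-1)\<close>-dimensional intersection of an element with a periodic copy of an
  element. Hanging nodes are allowed, and the traces of the mesh on two opposite sides of the box
  need not match.\<close>

definition interface :: "'d::finite mesh \<Rightarrow> (real ^ 'd) set \<Rightarrow> bool" where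
  "interface M e \<longleftrightarrow>
     (\<exists>T\<in>melems M. \<exists>T'\<in>melems M. \<exists>z\<in>periods M. e = T \<inter> (+) z ` T') \<and>
     aff_dim e = int CARD('d) - 1"

text \<open>Elements may be arbitrary convex polytopes, which covers simplices and Cartesian cells.\<close>

definition periodic_mesh :: "'d::finite mesh \<Rightarrow> bool" where
  "periodic_mesh M \<longleftrightarrow>
     (\<forall>i. mlo M $ i < mhi M $ i) \<and>
     finite (melems M) \<and>
     (\<forall>T\<in>melems M. polytope T \<and> interior T \<noteq> {}) \<and>
     \<Union> (melems M) = mdom M \<and>
     pairwise (\<lambda>T T'. interior T \<inter> interior T' = {}) (melems M) \<and>
     (\<forall>e\<in>mfaces M. interface M e) \<and>
     (\<forall>e. interface M e \<longrightarrow> (\<exists>!e'. e' \<in> mfaces M \<and> (\<exists>z\<in>periods M. e' = (+) z ` e))) \<and>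
     (\<forall>e\<in>mfaces M. norm (mnormal M e) = 1 \<and>
        (\<forall>x\<in>e. \<forall>y\<in>e. mnormal M e \<bullet> (x - y) = 0))"

definition poly_deg_le :: "nat \<Rightarrow> (real ^ 'd::finite \<Rightarrow> real) \<Rightarrow> bool" where
  "poly_deg_le k P \<longleftrightarrow>
     (\<exists>c. P = (\<lambda>y. \<Sum>\<alpha> | (\<Sum>i\<in>UNIV. \<alpha> i) \<le> k. c \<alpha> * (\<Prod>i\<in>UNIV. y $ i ^ \<alpha> i)))"

text \<open>Elements of \<open>dg_space\<close> are representatives of \<open>L2\<close> classes: the values on the element boundaries
  (a null set) and outside the box are immaterial, as no integral below depends on them. Spans,
  singular value decompositions and equality of low-rank functions are understood almost everywhere.\<close>

definition dg_space :: "'d::finite mesh \<Rightarrow> nat \<Rightarrow> (real ^ 'd \<Rightarrow> real) set" where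
  "dg_space M k =
     {U. \<forall>T\<in>melems M. \<exists>P. poly_deg_le k P \<and> (\<forall>y\<in>interior T. U y = P y)}"

definition in_span :: "(real ^ 'd::finite) set \<Rightarrow> (real ^ 'd \<Rightarrow> real) set \<Rightarrow> (real ^ 'd \<Rightarrow> real) \<Rightarrow> bool"
  where "in_span \<Omega> B g \<longleftrightarrow> (\<exists>c. AE y in lebesgue_on \<Omega>. g y = (\<Sum>b\<in>B. c b * b y))"

section \<open>Inner products, traces and the discrete derivative\<close>

definition weight :: "real ^ 'd::finite \<Rightarrow> real" where
  "weight v = exp (- (norm v)\<^sup>2 / 2)"

definition ip :: "'d::finite mesh \<Rightarrow> (real ^ 'd \<Rightarrow> real) \<Rightarrow> (real ^ 'd \<Rightarrow> real) \<Rightarrow> real" where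
  "ip M f g = (LINT y:mdom M|lebesgue. f y * g y)"

definition ipw :: "'d::finite mesh \<Rightarrow> (real ^ 'd \<Rightarrow> real) \<Rightarrow> (real ^ 'd \<Rightarrow> real) \<Rightarrow> real" where
  "ipw M f g = (LINT y:mdom M|lebesgue. f y * g y * weight y)"

definition pdiff :: "'d::finite \<Rightarrow> (real ^ 'd \<Rightarrow> real) \<Rightarrow> real ^ 'd \<Rightarrow> real" where
  "pdiff s U y = frechet_derivative U (at y) (axis s 1)"

definition grad :: "(real ^ 'd::finite \<Rightarrow> real) \<Rightarrow> real ^ 'd \<Rightarrow> real ^ 'd" where
  "grad U y = (\<chi> s. pdiff s U y)"

definition trace_plus ::
    "'d::finite mesh \<Rightarrow> (real ^ 'd) set \<Rightarrow> (real ^ 'd \<Rightarrow> 'b::real_normed_vector) \<Rightarrow> real ^ 'd \<Rightarrow> 'b" where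
  "trace_plus M e U y = Lim (at_right 0) (\<lambda>\<epsilon>. U (wrap M (y + \<epsilon> *\<^sub>R mnormal M e)))"

definition trace_minus ::
    "'d::finite mesh \<Rightarrow> (real ^ 'd) set \<Rightarrow> (real ^ 'd \<Rightarrow> 'b::real_normed_vector) \<Rightarrow> real ^ 'd \<Rightarrow> 'b" where
  "trace_minus M e U y = Lim (at_right 0) (\<lambda>\<epsilon>. U (wrap M (y - \<epsilon> *\<^sub>R mnormal M e)))"

definition avg ::
    "'d::finite mesh \<Rightarrow> (real ^ 'd) set \<Rightarrow> (real ^ 'd \<Rightarrow> 'b::real_normed_vector) \<Rightarrow> real ^ 'd \<Rightarrow> 'b" where
  "avg M e U y = (1 / 2) *\<^sub>R (trace_plus M e U y + trace_minus M e U y)"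

definition jump ::
    "'d::finite mesh \<Rightarrow> (real ^ 'd) set \<Rightarrow> (real ^ 'd \<Rightarrow> 'b::real_normed_vector) \<Rightarrow> real ^ 'd \<Rightarrow> 'b" where
  "jump M e U y = trace_minus M e U y - trace_plus M e U y"

text \<open>Surface integral over a flat set \<open>e\<close> with unit normal \<open>n\<close>: by Fubini's theorem in a rotated
  coordinate system, integrating over the prism of height 1 above \<open>e\<close> the function that is constant
  along \<open>n\<close> gives the integral with respect to \<open>(d-1)\<close>-dimensional Lebesgue measure on the hyperplane
  containing \<open>e\<close>. The argument of \<open>g\<close> is the orthogonal projection onto that hyperplane.\<close>

definition flat_integral :: "real ^ 'd::finite \<Rightarrow> (real ^ 'd) set \<Rightarrow> (real ^ 'd \<Rightarrow> real) \<Rightarrow> real" where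
  "flat_integral n e g =
     (LINT z:{y + t *\<^sub>R n | y t. y \<in> e \<and> 0 \<le> t \<and> t \<le> 1}|lebesgue.
        g (z - ((z - (SOME y. y \<in> e)) \<bullet> n) *\<^sub>R n))"

definition face_integral :: "'d::finite mesh \<Rightarrow> (real ^ 'd) set \<Rightarrow> (real ^ 'd \<Rightarrow> real) \<Rightarrow> real" where
  "face_integral M e g = flat_integral (mnormal M e) e g"

definition dhat ::
    "'d::finite mesh \<Rightarrow> 'd \<Rightarrow> (real ^ 'd \<Rightarrow> real) \<Rightarrow> (real ^ 'd \<Rightarrow> real) \<Rightarrow> real" where
  "dhat M s U W =
     (\<Sum>T\<in>melems M. LINT y:T|lebesgue. pdiff s U y * W y) -
     (\<Sum>e\<in>mfaces M. face_integral M e (\<lambda>y. mnormal M e $ s * jump M e U y * avg M e W y))"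

section \<open>Numerical flux\<close>

text \<open>Matrices are functions of two indices ranging over a finite set \<open>I\<close>. For symmetric \<open>A\<close> the
  absolute value is the positive semidefinite square root of \<open>A\<^sup>2\<close>.\<close>

definition mat_abs :: "nat set \<Rightarrow> (nat \<Rightarrow> nat \<Rightarrow> real) \<Rightarrow> nat \<Rightarrow> nat \<Rightarrow> real" where
  "mat_abs I A = (THE B.
     (\<forall>i j. i \<notin> I \<or> j \<notin> I \<longrightarrow> B i j = 0) \<and>
     (\<forall>i\<in>I. \<forall>j\<in>I. B i j = B j i) \<and>
     (\<forall>x. 0 \<le> (\<Sum>i\<in>I. \<Sum>j\<in>I. x i * B i j * x j)) \<and>
     (\<forall>i\<in>I. \<forall>j\<in>I. (\<Sum>k\<in>I. B i k * B k j) = (\<Sum>k\<in>I. A i k * A k j)))"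

definition face_mat ::
    "'d::finite mesh \<Rightarrow> (real ^ 'd) set \<Rightarrow> ('d \<Rightarrow> nat \<Rightarrow> nat \<Rightarrow> real) \<Rightarrow> nat \<Rightarrow> nat \<Rightarrow> real" where
  "face_mat M e A i j = (\<Sum>s\<in>UNIV. mnormal M e $ s * A s i j)"

definition num_flux ::
    "real \<Rightarrow> 'd::finite mesh \<Rightarrow> nat set \<Rightarrow> ('d \<Rightarrow> nat \<Rightarrow> nat \<Rightarrow> real) \<Rightarrow> (nat \<Rightarrow> real ^ 'd \<Rightarrow> real) \<Rightarrow>
     (real ^ 'd) set \<Rightarrow> nat \<Rightarrow> real ^ 'd \<Rightarrow> real" where
  "num_flux \<alpha> M I A U e i y =
     (\<Sum>j\<in>I. face_mat M e A i j * avg M e (U j) y) +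
     (1 - \<alpha>) / 2 * (\<Sum>j\<in>I. mat_abs I (face_mat M e A) i j * jump M e (U j) y)"

section \<open>Electric field\<close>

definition periodic :: "'d::finite mesh \<Rightarrow> (real ^ 'd \<Rightarrow> real) \<Rightarrow> bool" where
  "periodic M u \<longleftrightarrow> (\<forall>z\<in>periods M. \<forall>y. u (y + z) = u y)"

text \<open>\<open>E = - grad \<Phi>\<close> for a periodic \<open>\<Phi>\<close> with \<open>- Laplace \<Phi> = 1 - \<rho>\<close>. As \<open>\<rho>\<close> is only piecewise
  polynomial, the equation is meant in the weak sense; by elliptic regularity \<open>\<Phi>\<close> is continuously
  differentiable because \<open>\<rho>\<close> is bounded.\<close>

definition electric_field ::
    "'d::finite mesh \<Rightarrow> (real ^ 'd \<Rightarrow> real) \<Rightarrow> (real ^ 'd \<Rightarrow> real ^ 'd) \<Rightarrow> bool" where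
  "electric_field M \<rho> E \<longleftrightarrow>
     (\<exists>\<Phi>. periodic M \<Phi> \<and> continuous_on UNIV E \<and>
        (\<forall>x. (\<Phi> has_derivative (\<lambda>h. - (E x \<bullet> h))) (at x)) \<and>
        (\<forall>u G. periodic M u \<and> continuous_on UNIV G \<and>
               (\<forall>x. (u has_derivative (\<lambda>h. G x \<bullet> h)) (at x)) \<longrightarrow>
           (LINT x:mdom M|lebesgue. - (E x \<bullet> G x)) = (LINT x:mdom M|lebesgue. (1 - \<rho> x) * u x)))"

section \<open>Low-rank states\<close>

text \<open>All indices are one-based: \<open>i, j \<in> {1..srank}\<close>, \<open>a \<in> {1..m}\<close>, \<open>\<mu> \<in> {m+1..srank}\<close>.\<close>

record 'd lr_state =
  srank :: nat
  scoef :: "nat \<Rightarrow> nat \<Rightarrow> real"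
  sX :: "nat \<Rightarrow> real ^ 'd \<Rightarrow> real"
  sV :: "nat \<Rightarrow> real ^ 'd \<Rightarrow> real"

definition lr_fun :: "'d::finite lr_state \<Rightarrow> (real ^ 'd) \<times> (real ^ 'd) \<Rightarrow> real" where
  "lr_fun st = (\<lambda>(x, v). weight v *
     (\<Sum>i=1..srank st. \<Sum>j=1..srank st. scoef st i j * sX st i x * sV st j v))"

definition orthonormal_x :: "'d::finite mesh \<Rightarrow> nat set \<Rightarrow> (nat \<Rightarrow> real ^ 'd \<Rightarrow> real) \<Rightarrow> bool" where
  "orthonormal_x M I X \<longleftrightarrow> (\<forall>i\<in>I. \<forall>j\<in>I. ip M (X i) (X j) = (if i = j then 1 else 0))"

definition orthonormal_v :: "'d::finite mesh \<Rightarrow> nat set \<Rightarrow> (nat \<Rightarrow> real ^ 'd \<Rightarrow> real) \<Rightarrow> bool" where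
  "orthonormal_v M I V \<longleftrightarrow> (\<forall>i\<in>I. \<forall>j\<in>I. ipw M (V i) (V j) = (if i = j then 1 else 0))"

definition is_state ::
    "'d::finite mesh \<Rightarrow> 'd mesh \<Rightarrow> nat \<Rightarrow> nat \<Rightarrow> nat \<Rightarrow> (nat \<Rightarrow> real ^ 'd \<Rightarrow> real) \<Rightarrow> 'd lr_state \<Rightarrow> bool" where
  "is_state Mx Mv p q m U st \<longleftrightarrow>
     m \<le> srank st \<and>
     (\<forall>i\<in>{1..srank st}. sX st i \<in> dg_space Mx p \<and> sV st i \<in> dg_space Mv q) \<and>
     orthonormal_x Mx {1..srank st} (sX st) \<and>
     orthonormal_v Mv {1..srank st} (sV st) \<and>
     (\<forall>a\<in>{1..m}. sV st a = U a) \<and>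
     (\<forall>a\<in>{1..m}. \<forall>\<mu>\<in>{m+1..srank st}. scoef st a \<mu> = 0)"

definition Kfun :: "'d::finite lr_state \<Rightarrow> nat \<Rightarrow> real ^ 'd \<Rightarrow> real" where
  "Kfun st j x = (\<Sum>i=1..srank st. sX st i x * scoef st i j)"

definition charge ::
    "'d::finite mesh \<Rightarrow> ((real ^ 'd) \<times> (real ^ 'd) \<Rightarrow> real) \<Rightarrow> real ^ 'd \<Rightarrow> real" where
  "charge Mv f x = (LINT v:mdom Mv|lebesgue. f (x, v))"

definition current ::
    "'d::finite mesh \<Rightarrow> ((real ^ 'd) \<times> (real ^ 'd) \<Rightarrow> real) \<Rightarrow> real ^ 'd \<Rightarrow> real ^ 'd" where
  "current Mv f x = (\<chi> s. LINT v:mdom Mv|lebesgue. v $ s * f (x, v))"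

section \<open>The substeps of one time step\<close>

definition matAx :: "'d::finite mesh \<Rightarrow> (nat \<Rightarrow> real ^ 'd \<Rightarrow> real) \<Rightarrow> 'd \<Rightarrow> nat \<Rightarrow> nat \<Rightarrow> real" where
  "matAx Mv V s i j = ipw Mv (\<lambda>v. v $ s * V j v) (V i)"

definition matBx :: "'d::finite mesh \<Rightarrow> (nat \<Rightarrow> real ^ 'd \<Rightarrow> real) \<Rightarrow> 'd \<Rightarrow> nat \<Rightarrow> nat \<Rightarrow> real" where
  "matBx Mv V s i j = dhat Mv s (\<lambda>v. weight v * V j v) (V i)"

definition matAv ::
    "'d::finite mesh \<Rightarrow> (real ^ 'd \<Rightarrow> real ^ 'd) \<Rightarrow> (nat \<Rightarrow> real ^ 'd \<Rightarrow> real) \<Rightarrow>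
     'd \<Rightarrow> nat \<Rightarrow> nat \<Rightarrow> real" where
  "matAv Mx E X s i j = ip Mx (\<lambda>x. - (E x $ s) * X j x) (X i)"

definition matBv :: "'d::finite mesh \<Rightarrow> (nat \<Rightarrow> real ^ 'd \<Rightarrow> real) \<Rightarrow> 'd \<Rightarrow> nat \<Rightarrow> nat \<Rightarrow> real" where
  "matBv Mx X s i j = dhat Mx s (X j) (X i)"

definition K_step ::
    "'d::finite mesh \<Rightarrow> 'd mesh \<Rightarrow> nat \<Rightarrow> real \<Rightarrow> real \<Rightarrow> (real ^ 'd \<Rightarrow> real ^ 'd) \<Rightarrow> 'd lr_state \<Rightarrow>
     (nat \<Rightarrow> real ^ 'd \<Rightarrow> real) \<Rightarrow> bool" where
  "K_step Mx Mv p \<tau> \<alpha> E st K' \<longleftrightarrow>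
     (let I = {1..srank st}; K = Kfun st; A = matAx Mv (sV st); B = matBx Mv (sV st) in
      (\<forall>i\<in>I. K' i \<in> dg_space Mx p) \<and>
      (\<forall>\<psi>. (\<forall>i\<in>I. \<psi> i \<in> dg_space Mx p) \<longrightarrow>
        1 / \<tau> * (\<Sum>i\<in>I. ip Mx (\<lambda>x. K' i x - K i x) (\<psi> i)) +
        (\<Sum>T\<in>melems Mx. \<Sum>s\<in>UNIV. LINT x:T|lebesgue.
           (\<Sum>i\<in>I. - (\<Sum>j\<in>I. A s i j * K j x) * pdiff s (\<psi> i) x
                   - E x $ s * (\<Sum>j\<in>I. B s i j * K j x) * \<psi> i x)) +
        (\<Sum>e\<in>mfaces Mx. face_integral Mx e
           (\<lambda>x. \<Sum>i\<in>I. num_flux \<alpha> Mx I A K e i x * jump Mx e (\<psi> i) x)) = 0))"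

text \<open>\<open>P_omega Mv q L Lh\<close> is the graph of the invertible map taking \<open>L\<close> to \<open>Lh\<close>.\<close>

definition P_omega ::
    "'d::finite mesh \<Rightarrow> nat \<Rightarrow> (real ^ 'd \<Rightarrow> real) \<Rightarrow> (real ^ 'd \<Rightarrow> real) \<Rightarrow> bool" where
  "P_omega Mv q L Lh \<longleftrightarrow> L \<in> dg_space Mv q \<and> Lh \<in> dg_space Mv q \<and>
     (\<forall>\<psi>\<in>dg_space Mv q. ip Mv Lh \<psi> = ip Mv (\<lambda>v. weight v * L v) \<psi>)"

text \<open>\<open>Lh\<close> and \<open>Lh'\<close> are the transformed unknowns before and after the step.\<close>

definition L_step ::
    "'d::finite mesh \<Rightarrow> 'd mesh \<Rightarrow> nat \<Rightarrow> nat \<Rightarrow> (nat \<Rightarrow> real ^ 'd \<Rightarrow> real) \<Rightarrow> real \<Rightarrow> real \<Rightarrow>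
     (real ^ 'd \<Rightarrow> real ^ 'd) \<Rightarrow> 'd lr_state \<Rightarrow> (nat \<Rightarrow> real ^ 'd \<Rightarrow> real) \<Rightarrow> bool" where
  "L_step Mx Mv q m U \<tau> \<alpha> E st L' \<longleftrightarrow>
     (let r = srank st; S = scoef st; J = {m+1..r};
          A = matAv Mx E (sX st); B = matBv Mx (sX st) in
      \<exists>Lh Lh'.
       (\<forall>\<mu>\<in>J. P_omega Mv q (\<lambda>v. \<Sum>\<nu>\<in>J. S \<mu> \<nu> * sV st \<nu> v) (Lh \<mu>)) \<and>
       (\<forall>\<mu>\<in>J. Lh' \<mu> \<in> dg_space Mv q) \<and>
       (\<forall>\<mu>\<in>J. \<forall>a\<in>{1..m}. ip Mv (U a) (Lh' \<mu>) = 0) \<and>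
       (\<forall>\<psi>. (\<forall>\<mu>\<in>J. \<psi> \<mu> \<in> dg_space Mv q \<and> (\<forall>a\<in>{1..m}. ipw Mv (U a) (\<psi> \<mu>) = 0)) \<longrightarrow>
         1 / \<tau> * (\<Sum>\<mu>\<in>J. ip Mv (\<lambda>v. Lh' \<mu> v - Lh \<mu> v) (\<psi> \<mu>)) +
         (\<Sum>T\<in>melems Mv. \<Sum>s\<in>UNIV. LINT v:T|lebesgue.
            (\<Sum>\<mu>\<in>J. - (\<Sum>\<nu>\<in>J. A s \<mu> \<nu> * Lh \<nu> v) * pdiff s (\<psi> \<mu>) v
                    + v $ s * (\<Sum>\<nu>\<in>J. B s \<mu> \<nu> * Lh \<nu> v) * \<psi> \<mu> v)) +
         (\<Sum>e\<in>mfaces Mv. face_integral Mv e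
            (\<lambda>v. \<Sum>\<mu>\<in>J. num_flux \<alpha> Mv J A Lh e \<mu> v * jump Mv e (\<psi> \<mu>) v))
         = - (\<Sum>s\<in>UNIV. \<Sum>\<mu>\<in>J. ip Mv
               (\<lambda>v. (\<Sum>i=1..r. A s \<mu> i * (\<Sum>a=1..m. S i a * pdiff s (\<lambda>w. weight w * U a w) v)) +
                    v $ s * (\<Sum>i=1..r. B s \<mu> i * (\<Sum>a=1..m. S i a * (weight v * U a v))))
               (\<psi> \<mu>))) \<and>
       (\<forall>\<mu>\<in>J. P_omega Mv q (L' \<mu>) (Lh' \<mu>)))"

text \<open>Here \<open>r1\<close> and \<open>r2\<close> are the numbers of augmented basis functions.\<close>

definition augmentation ::
    "'d::finite mesh \<Rightarrow> 'd mesh \<Rightarrow> nat \<Rightarrow> nat \<Rightarrow> nat \<Rightarrow> (nat \<Rightarrow> real ^ 'd \<Rightarrow> real) \<Rightarrow> 'd lr_state \<Rightarrow>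
     (nat \<Rightarrow> real ^ 'd \<Rightarrow> real) \<Rightarrow> (nat \<Rightarrow> real ^ 'd \<Rightarrow> real) \<Rightarrow>
     nat \<Rightarrow> (nat \<Rightarrow> real ^ 'd \<Rightarrow> real) \<Rightarrow> nat \<Rightarrow> (nat \<Rightarrow> real ^ 'd \<Rightarrow> real) \<Rightarrow> bool" where
  "augmentation Mx Mv p q m U st K' L' r1 Xt r2 Vt \<longleftrightarrow>
     (let GX = sX st ` {1..srank st} \<union> K' ` {1..srank st};
          GV = sV st ` {1..srank st} \<union> L' ` {m+1..srank st} in
      (\<forall>k\<in>{1..r1}. Xt k \<in> dg_space Mx p \<and> in_span (mdom Mx) GX (Xt k)) \<and>
      orthonormal_x Mx {1..r1} Xt \<and>
      (\<forall>g\<in>GX. in_span (mdom Mx) (Xt ` {1..r1}) g) \<and>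
      (\<forall>l\<in>{1..r2}. Vt l \<in> dg_space Mv q \<and> in_span (mdom Mv) GV (Vt l)) \<and>
      orthonormal_v Mv {1..r2} Vt \<and>
      (\<forall>g\<in>GV. in_span (mdom Mv) (Vt ` {1..r2}) g) \<and>
      m \<le> r2 \<and> (\<forall>a\<in>{1..m}. Vt a = U a))"

definition S_aug ::
    "'d::finite mesh \<Rightarrow> 'd mesh \<Rightarrow> 'd lr_state \<Rightarrow> (nat \<Rightarrow> real ^ 'd \<Rightarrow> real) \<Rightarrow>
     (nat \<Rightarrow> real ^ 'd \<Rightarrow> real) \<Rightarrow> nat \<Rightarrow> nat \<Rightarrow> real" where
  "S_aug Mx Mv st Xt Vt k l =
     (\<Sum>i=1..srank st. \<Sum>j=1..srank st.
        ip Mx (Xt k) (sX st i) * scoef st i j * ipw Mv (Vt l) (sV st j))"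

definition S_step ::
    "'d::finite mesh \<Rightarrow> 'd mesh \<Rightarrow> real \<Rightarrow> (real ^ 'd \<Rightarrow> real ^ 'd) \<Rightarrow> 'd lr_state \<Rightarrow>
     (nat \<Rightarrow> real ^ 'd \<Rightarrow> real) \<Rightarrow> (nat \<Rightarrow> real ^ 'd \<Rightarrow> real) \<Rightarrow> nat \<Rightarrow> nat \<Rightarrow> real" where
  "S_step Mx Mv \<tau> E st Xt Vt k l =
     S_aug Mx Mv st Xt Vt k l -
     \<tau> * (\<Sum>i=1..srank st. \<Sum>j=1..srank st. \<Sum>s\<in>UNIV.
        dhat Mx s (sX st i) (Xt k) * scoef st i j * ipw Mv (Vt l) (\<lambda>v. v $ s * sV st j v) +
        ip Mx (Xt k) (\<lambda>x. - (E x $ s) * sX st i x) * scoef st i j *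
          dhat Mv s (\<lambda>v. weight v * sV st j v) (Vt l))"

text \<open>\<open>R\<close> is the number of singular triplets \<open>(\<sigma>, Y, W)\<close>, of which the leading \<open>R' \<le> R\<close> are kept; the
  criterion by which \<open>R'\<close> is chosen is left open.\<close>

definition truncation ::
    "'d::finite mesh \<Rightarrow> 'd mesh \<Rightarrow> nat \<Rightarrow> nat \<Rightarrow> nat \<Rightarrow> (nat \<Rightarrow> real ^ 'd \<Rightarrow> real) \<Rightarrow>
     nat \<Rightarrow> (nat \<Rightarrow> real ^ 'd \<Rightarrow> real) \<Rightarrow> nat \<Rightarrow> (nat \<Rightarrow> real ^ 'd \<Rightarrow> real) \<Rightarrow>
     (nat \<Rightarrow> nat \<Rightarrow> real) \<Rightarrow> ((real ^ 'd) \<times> (real ^ 'd) \<Rightarrow> real) \<Rightarrow> bool" where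
  "truncation Mx Mv p q m U r1 Xt r2 Vt St f' \<longleftrightarrow>
     (let Kt = (\<lambda>l x. \<Sum>k=1..r1. St k l * Xt k x) in
      \<exists>R R' \<sigma> Y W. R' \<le> R \<and>
        (\<forall>k\<in>{1..R}. 0 \<le> \<sigma> k \<and> Y k \<in> dg_space Mx p \<and> W k \<in> dg_space Mv q \<and>
           in_span (mdom Mv) (Vt ` {m+1..r2}) (W k)) \<and>
        (\<forall>k\<in>{1..<R}. \<sigma> (Suc k) \<le> \<sigma> k) \<and>
        orthonormal_x Mx {1..R} Y \<and>
        orthonormal_v Mv {1..R} W \<and>
        (AE (x, v) in lebesgue_on (mdom Mx \<times> mdom Mv).
           (\<Sum>l=m+1..r2. Kt l x * Vt l v) = (\<Sum>k=1..R. \<sigma> k * Y k x * W k v)) \<and>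
        (AE (x, v) in lebesgue_on (mdom Mx \<times> mdom Mv).
           f' (x, v) = weight v * (\<Sum>a=1..m. Kt a x * U a v) +
                       weight v * (\<Sum>k=1..R'. \<sigma> k * Y k x * W k v)))"

definition time_step ::
    "'d::finite mesh \<Rightarrow> 'd mesh \<Rightarrow> nat \<Rightarrow> nat \<Rightarrow> nat \<Rightarrow> (nat \<Rightarrow> real ^ 'd \<Rightarrow> real) \<Rightarrow> real \<Rightarrow> real \<Rightarrow>
     (real ^ 'd \<Rightarrow> real ^ 'd) \<Rightarrow> 'd lr_state \<Rightarrow> 'd lr_state \<Rightarrow> bool" where
  "time_step Mx Mv p q m U \<tau> \<alpha> E st st' \<longleftrightarrow>
     (\<exists>K' L' r1 Xt r2 Vt.
        K_step Mx Mv p \<tau> \<alpha> E st K' \<and>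
        L_step Mx Mv q m U \<tau> \<alpha> E st L' \<and>
        augmentation Mx Mv p q m U st K' L' r1 Xt r2 Vt \<and>
        truncation Mx Mv p q m U r1 Xt r2 Vt (S_step Mx Mv \<tau> E st Xt Vt) (lr_fun st'))"

text \<open>The Poisson problem on a periodic domain is solvable only for densities of total mass
  \<open>|\<Omega>|\<close>. If \<open>E n\<close> were required to solve it unconditionally for every \<open>n\<close>, conservation of mass would be
  assumed rather than proved. It is therefore required only under the compatibility condition.\<close>

definition compatible :: "'d::finite mesh \<Rightarrow> (real ^ 'd \<Rightarrow> real) \<Rightarrow> bool" where
  "compatible Mx \<rho> \<longleftrightarrow> (LINT x:mdom Mx|lebesgue. \<rho> x) = measure lebesgue (mdom Mx)"

definition dlra_run ::
    "'d::finite mesh \<Rightarrow> 'd mesh \<Rightarrow> nat \<Rightarrow> nat \<Rightarrow> nat \<Rightarrow> (nat \<Rightarrow> real ^ 'd \<Rightarrow> real) \<Rightarrow> real \<Rightarrow> real \<Rightarrow>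
     (nat \<Rightarrow> real ^ 'd \<Rightarrow> real ^ 'd) \<Rightarrow> (nat \<Rightarrow> 'd lr_state) \<Rightarrow> bool" where
  "dlra_run Mx Mv p q m U \<tau> \<alpha> E st \<longleftrightarrow>
     (\<forall>n. is_state Mx Mv p q m U (st n) \<and>
          (compatible Mx (charge Mv (lr_fun (st n))) \<longrightarrow>
             electric_field Mx (charge Mv (lr_fun (st n))) (E n)) \<and>
          time_step Mx Mv p q m U \<tau> \<alpha> (E n) (st n) (st (Suc n)))"

end

theory Submission
  imports Defs
begin

text \<open>Testing the K-step with \<open>\<psi>\<close> in component \<open>a \<le> m\<close> and comparing with the S-step shows that the
  S-step coefficients of \<open>U a\<close> are the coefficients of \<open>K' a\<close> in the augmented basis, and the truncation
  does not touch them. If \<open>1 = (\<Sum>a. u a * U a)\<close>, then the densities are \<open>\<Sum>a. u a * K a\<close> and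
  \<open>\<Sum>a. u a * K' a\<close>, and the same combination of the K-equations is the discrete continuity equation,
  because the field terms add up to the discrete derivative of \<open>weight * V j\<close> tested with \<open>1\<close>, which vanishes.
  Both this and the passage between the strong form of the S-step and the weak form of the K-step rest on
  \<open>(\<Sum>T. \<integral>\<^sub>T \<partial>\<^sub>s G) = (\<Sum>e. \<integral>\<^sub>e n\<^sub>s [G])\<close> for piecewise smooth \<open>G\<close>
  on a periodic polytopal mesh with hanging nodes.\<close>

section \<open>Oblique prisms\<close>

text \<open>Surface integrals are defined by prisms of height 1 along the face normal, so the
  divergence theorem is proved for such prism integrals directly. Segments in a fixed direction
  \<open>a\<close> that cross a face with normal \<open>n\<close> sweep out an oblique prism, and a
  shear compares it with the upright one at the price of the factor
  \<open>\<bar>n \<bullet> a\<bar>\<close>. Hanging nodes and element edges lie in sets of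
  codimension two, which only a null set of segments meets. The central flux is what makes the
  substeps fit: the rule \<open>[FG] = [F]{G} + {F}[G]\<close> turns the form with averaged test
  function into the form with averaged unknown, whereas upwinding would add a dissipation term to
  the K-step that the S-step lacks. The field \<open>E n\<close> is known to solve the Poisson
  problem, and hence to be continuous, only if \<open>\<rho> n\<close> has the right mass.
  Conservation of mass is therefore first an implication for one step, compatibility follows by
  induction, and then the continuity equation holds for all steps.\<close>

lemma nn_integral_lborel_translate:
  fixes f :: "'a::euclidean_space \<Rightarrow> ennreal"
  assumes [measurable]: "f \<in> borel_measurable borel"
  shows "(\<integral>\<^sup>+z. f (c + z) \<partial>lborel) = (\<integral>\<^sup>+z. f z \<partial>lborel)"
proof -
  have "(\<integral>\<^sup>+z. f z \<partial>lborel) = (\<integral>\<^sup>+z. f z \<partial>distr lborel borel ((+) c))"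
    by (simp add: lborel_distr_plus)
  also have "\<dots> = (\<integral>\<^sup>+z. f (c + z) \<partial>lborel)"
    by (subst nn_integral_distr) auto
  finally show ?thesis by simp
qed

lemma nn_integral_unit_window:
  fixes x :: real
  shows "(\<integral>\<^sup>+\<theta>. indicator {0..1} (x - \<theta>) \<partial>lborel) = 1"
proof -
  have "(\<integral>\<^sup>+\<theta>. indicator {0..1} (x - \<theta>) \<partial>lborel) = (\<integral>\<^sup>+\<theta>. indicator {x-1..x} \<theta> \<partial>lborel)"
    by (intro nn_integral_cong) (auto simp: indicator_def)
  then show ?thesis by simp
qed

text \<open>Weighting by the window \<open>0 \<le> \<eta> z - \<theta> \<le> 1\<close> and translating by \<open>\<theta> u\<close> amounts to Fubini in the
  direction \<open>u\<close> without any choice of coordinates.\<close>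

lemma nn_integral_lborel_window:
  fixes f :: "'a::euclidean_space \<Rightarrow> ennreal" and \<eta> :: "'a \<Rightarrow> real"
  assumes [measurable]: "f \<in> borel_measurable borel" "\<eta> \<in> borel_measurable borel"
    and \<eta>: "\<And>z \<theta>. \<eta> (\<theta> *\<^sub>R u + z) = \<eta> z + \<theta>"
  shows "(\<integral>\<^sup>+z. f z \<partial>lborel)
    = (\<integral>\<^sup>+z. indicator {0..1} (\<eta> z) * (\<integral>\<^sup>+\<theta>. f (\<theta> *\<^sub>R u + z) \<partial>lborel) \<partial>lborel)"
proof -
  have "(\<integral>\<^sup>+z. f z \<partial>lborel)
      = (\<integral>\<^sup>+z. f z * (\<integral>\<^sup>+\<theta>. indicator {0..1} (\<eta> z - \<theta>) \<partial>lborel) \<partial>lborel)"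
    by (simp add: nn_integral_unit_window)
  also have "\<dots> = (\<integral>\<^sup>+z. (\<integral>\<^sup>+\<theta>. f z * indicator {0..1} (\<eta> z - \<theta>) \<partial>lborel) \<partial>lborel)"
    by (intro nn_integral_cong nn_integral_cmult[symmetric]) simp
  also have "\<dots> = (\<integral>\<^sup>+\<theta>. (\<integral>\<^sup>+z. f z * indicator {0..1} (\<eta> z - \<theta>) \<partial>lborel) \<partial>lborel)"
    by (rule lborel_pair.Fubini') simp
  also have "\<dots> = (\<integral>\<^sup>+\<theta>. (\<integral>\<^sup>+z. f (\<theta> *\<^sub>R u + z) * indicator {0..1} (\<eta> z) \<partial>lborel) \<partial>lborel)"
  proof (rule nn_integral_cong)
    fix \<theta> :: real
    show "(\<integral>\<^sup>+z. f z * indicator {0..1} (\<eta> z - \<theta>) \<partial>lborel)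
        = (\<integral>\<^sup>+z. f (\<theta> *\<^sub>R u + z) * indicator {0..1} (\<eta> z) \<partial>lborel)"
      by (subst nn_integral_lborel_translate[of _ "\<theta> *\<^sub>R u", symmetric]) (simp_all add: \<eta>)
  qed
  also have "\<dots> = (\<integral>\<^sup>+z. (\<integral>\<^sup>+\<theta>. f (\<theta> *\<^sub>R u + z) * indicator {0..1} (\<eta> z) \<partial>lborel) \<partial>lborel)"
    by (rule lborel_pair.Fubini'[symmetric]) simp
  also have "\<dots> = (\<integral>\<^sup>+z. indicator {0..1} (\<eta> z) * (\<integral>\<^sup>+\<theta>. f (\<theta> *\<^sub>R u + z) \<partial>lborel) \<partial>lborel)"
    by (intro nn_integral_cong, subst nn_integral_multc, measurable) (simp only: mult.commute)
  finally show ?thesis .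
qed

text \<open>Along each line in direction \<open>u\<close> the coefficient \<open>l\<close> is
  constant, so the shear acts there as a translation; the windowed form of the integral reduces the
  claim to these lines.\<close>

lemma nn_integral_lborel_shear:
  fixes f :: "'a::euclidean_space \<Rightarrow> ennreal" and l :: "'a \<Rightarrow> real"
  assumes [measurable]: "f \<in> borel_measurable borel" "l \<in> borel_measurable borel"
    and l: "\<And>z \<theta>. l (\<theta> *\<^sub>R u + z) = l z"
  shows "(\<integral>\<^sup>+z. f (z + l z *\<^sub>R u) \<partial>lborel) = (\<integral>\<^sup>+z. f z \<partial>lborel)"
proof (cases "u = 0")
  case False
  \<comment> \<open>Normalised so that moving by \<open>\<theta> *\<^sub>R u\<close> raises
    \<open>\<eta>\<close> by \<open>\<theta>\<close>.\<close>
  define \<eta> where "\<eta> z = (z \<bullet> u) / (u \<bullet> u)" for z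
  have [measurable]: "\<eta> \<in> borel_measurable borel" unfolding \<eta>_def by measurable
  have \<eta>: "\<eta> (\<theta> *\<^sub>R u + z) = \<eta> z + \<theta>" for z \<theta>
    using False by (simp add: \<eta>_def inner_add_left add_divide_distrib)
  have "(\<integral>\<^sup>+\<theta>. f (\<theta> *\<^sub>R u + z + l (\<theta> *\<^sub>R u + z) *\<^sub>R u) \<partial>lborel) = (\<integral>\<^sup>+\<theta>. f (\<theta> *\<^sub>R u + z) \<partial>lborel)" for z
  proof -
    have "(\<integral>\<^sup>+\<theta>. f (\<theta> *\<^sub>R u + z + l (\<theta> *\<^sub>R u + z) *\<^sub>R u) \<partial>lborel)
        = (\<integral>\<^sup>+\<theta>. (\<lambda>\<theta>. f (\<theta> *\<^sub>R u + z)) (l z + \<theta>) \<partial>lborel)"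
      by (intro nn_integral_cong) (subst l, simp only: scaleR_add_left add_ac)
    also have "\<dots> = (\<integral>\<^sup>+\<theta>. f (\<theta> *\<^sub>R u + z) \<partial>lborel)"
      by (rule nn_integral_lborel_translate) simp
    finally show ?thesis .
  qed
  then show ?thesis
    by (subst (1 2) nn_integral_lborel_window[where \<eta> = \<eta> and u = u]) (simp_all add: \<eta>)
qed simp

text \<open>Both sides evaluate \<open>G\<close> after a projection to the hyperplane
  \<open>n \<bullet> z = b\<close>, along \<open>w\<close> on the left and along \<open>n\<close> on
  the right. The prism with edge \<open>w\<close> has thickness
  \<open>\<bar>n \<bullet> w\<bar>\<close> across the hyperplane, which is the factor.\<close>

lemma nn_integral_oblique_prism:
  fixes n w :: "'a::euclidean_space" and G :: "'a \<Rightarrow> ennreal" and b :: real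
  assumes n: "norm n = 1" and w: "n \<bullet> w \<noteq> 0" and [measurable]: "G \<in> borel_measurable borel"
  defines "t \<equiv> \<lambda>z. n \<bullet> z - b"
  shows "(\<integral>\<^sup>+z. indicator {0..1} (t z / (n \<bullet> w)) * G (z - (t z / (n \<bullet> w)) *\<^sub>R w) \<partial>lborel)
    = ennreal \<bar>n \<bullet> w\<bar> * (\<integral>\<^sup>+z. indicator {0..1} (t z) * G (z - t z *\<^sub>R n) \<partial>lborel)"
proof -
  define k where "k = n \<bullet> w"
  let ?g = "\<lambda>z. G (z - (t z / k) *\<^sub>R w)" and ?h = "\<lambda>z. indicator {0..1} (t z) * G (z - t z *\<^sub>R n)"
    and ?i = "\<lambda>z \<theta>. indicator {0..1} ((t z + \<theta>) / k)"
  have k: "k \<noteq> 0" using w by (simp add: k_def)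
  have nn: "n \<bullet> n = 1" using n by (simp add: dot_square_norm)
  have [measurable]: "t \<in> borel_measurable borel" unfolding t_def by measurable
  have tt: "t (\<theta> *\<^sub>R (w /\<^sub>R k) + z) = t z + \<theta>" for z \<theta>
    using k by (simp add: t_def inner_add_right k_def[symmetric])
  have proj: "\<theta> *\<^sub>R (w /\<^sub>R k) + z - ((t z + \<theta>) / k) *\<^sub>R w = z - (t z / k) *\<^sub>R w" for z \<theta>
    by (simp add: divide_inverse algebra_simps)
  \<comment> \<open>The condition on \<open>\<theta>\<close> cuts out an interval of length
    \<open>\<bar>k\<bar>\<close>; \<open>min\<close> and \<open>max\<close> treat both signs of
    \<open>k\<close> at once.\<close>
  have window: "(\<integral>\<^sup>+\<theta>. indicator {0..1} ((x + \<theta>) / k) \<partial>lborel) = ennreal \<bar>k\<bar>" for x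
  proof -
    have "indicator {0..1} ((x + \<theta>) / k) = (indicator {min 0 k - x .. max 0 k - x} \<theta> :: ennreal)" for \<theta>
      using k by (cases "k > 0") (auto simp: indicator_def zero_le_divide_iff divide_le_eq)
    then have "(\<integral>\<^sup>+\<theta>. indicator {0..1} ((x + \<theta>) / k) \<partial>lborel)
        = (\<integral>\<^sup>+\<theta>. indicator {min 0 k - x .. max 0 k - x} \<theta> \<partial>lborel)"
      by simp
    also have "\<dots> = ennreal \<bar>k\<bar>"
      by (auto simp: min_def max_def)
    finally show ?thesis .
  qed
  have "(\<integral>\<^sup>+z. indicator {0..1} (t z / k) * ?g z \<partial>lborel)
      = (\<integral>\<^sup>+z. indicator {0..1} (t z) * (\<integral>\<^sup>+\<theta>. ?i z \<theta> * ?g z \<partial>lborel) \<partial>lborel)"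
  proof -
    define f where "f z = indicator {0..1} (t z / k) * ?g z" for z
    have "f \<in> borel_measurable borel" unfolding f_def by measurable
    from nn_integral_lborel_window[OF this, of t "w /\<^sub>R k"] tt
    have "(\<integral>\<^sup>+z. f z \<partial>lborel) = (\<integral>\<^sup>+z. indicator {0..1} (t z) * (\<integral>\<^sup>+\<theta>. f (\<theta> *\<^sub>R (w /\<^sub>R k) + z) \<partial>lborel) \<partial>lborel)"
      by simp
    moreover have "f (\<theta> *\<^sub>R (w /\<^sub>R k) + z) = ?i z \<theta> * ?g z" for \<theta> z
      unfolding f_def tt proj ..
    ultimately show ?thesis by (simp add: f_def)
  qed
  also have "\<dots> = (\<integral>\<^sup>+z. ennreal \<bar>k\<bar> * (indicator {0..1} (t z) * ?g z) \<partial>lborel)"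
  proof (intro nn_integral_cong)
    fix z
    have "(\<integral>\<^sup>+\<theta>. ?i z \<theta> * ?g z \<partial>lborel)
        = (\<integral>\<^sup>+\<theta>. ?i z \<theta> \<partial>lborel) * ?g z"
      by (intro nn_integral_multc) measurable
    then show "indicator {0..1} (t z) * (\<integral>\<^sup>+\<theta>. ?i z \<theta> * ?g z \<partial>lborel)
        = ennreal \<bar>k\<bar> * (indicator {0..1} (t z) * ?g z)"
      unfolding window by (simp only: mult.left_commute)
  qed
  also have "\<dots> = ennreal \<bar>k\<bar> * (\<integral>\<^sup>+z. indicator {0..1} (t z) * ?g z \<partial>lborel)"
    by (intro nn_integral_cmult) simp
  \<comment> \<open>The vector \<open>n - w /\<^sub>R k\<close> is parallel to the hyperplane, so
    this shear keeps the height \<open>t\<close> and exchanges the projection along \<open>w\<close>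
    for the one along \<open>n\<close>.\<close>
  also have "(\<integral>\<^sup>+z. indicator {0..1} (t z) * ?g z \<partial>lborel)
      = (\<integral>\<^sup>+z. ?h (z + t z *\<^sub>R (n - w /\<^sub>R k)) \<partial>lborel)"
  proof (intro nn_integral_cong)
    fix z
    have "n \<bullet> (n - w /\<^sub>R k) = 0" using k nn by (simp add: inner_diff_right k_def[symmetric])
    then have "t (z + t z *\<^sub>R (n - w /\<^sub>R k)) = t z" by (simp add: t_def inner_add_right)
    then show "indicator {0..1} (t z) * ?g z
        = ?h (z + t z *\<^sub>R (n - w /\<^sub>R k))"
      by (simp add: scaleR_diff_right divide_inverse mult.commute)
  qed
  also have "\<dots> = (\<integral>\<^sup>+z. ?h z \<partial>lborel)"
  proof (rule nn_integral_lborel_shear)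
    fix z \<theta>
    have "n \<bullet> (n - w /\<^sub>R k) = 0" using k nn by (simp add: inner_diff_right k_def[symmetric])
    then show "t (\<theta> *\<^sub>R (n - w /\<^sub>R k) + z) = t z" by (simp add: t_def inner_add_right)
  qed measurable
  finally show ?thesis unfolding k_def .
qed

text \<open>Comparing two pushforward measures, instead of the positive and negative parts of
  \<open>G\<close>, carries the formula over to real functions without any integrability
  assumption.\<close>

lemma integral_oblique_prism:
  fixes n w :: "'a::euclidean_space" and G :: "'a \<Rightarrow> real" and b :: real
  assumes n: "norm n = 1" and w: "n \<bullet> w \<noteq> 0" and G[measurable]: "G \<in> borel_measurable borel"
  defines "t \<equiv> \<lambda>z. n \<bullet> z - b"
  shows "(LINT z|lborel. indicator {0..1} (t z / (n \<bullet> w)) * G (z - (t z / (n \<bullet> w)) *\<^sub>R w))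
    = \<bar>n \<bullet> w\<bar> * (LINT z|lborel. indicator {0..1} (t z) * G (z - t z *\<^sub>R n))"
proof -
  have [measurable]: "t \<in> borel_measurable borel" unfolding t_def by measurable
  define p q where "p z = z - (t z / (n \<bullet> w)) *\<^sub>R w" and "q z = z - t z *\<^sub>R n" for z
  have [measurable]: "p \<in> borel_measurable borel" "q \<in> borel_measurable borel"
    unfolding p_def q_def by measurable
  define P where "P = distr (density lborel (\<lambda>z. indicator {0..1} (t z / (n \<bullet> w)))) borel p"
  define Q where "Q = distr (density lborel (\<lambda>z. indicator {0..1} (t z))) borel q"
  have "P = density Q (\<lambda>_. ennreal \<bar>n \<bullet> w\<bar>)"
  proof (rule measure_eqI)
    show "sets P = sets (density Q (\<lambda>_. ennreal \<bar>n \<bullet> w\<bar>))" by (simp add: P_def Q_def)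
    fix A assume "A \<in> sets P"
    then have [measurable]: "A \<in> sets borel" by (simp add: P_def)
    have "emeasure P A = (\<integral>\<^sup>+z. indicator A z \<partial>P)" using \<open>A \<in> sets P\<close> by simp
    also have "\<dots> = (\<integral>\<^sup>+z. indicator {0..1} (t z / (n \<bullet> w)) * indicator A (p z) \<partial>lborel)"
      by (simp add: P_def nn_integral_distr nn_integral_density del: nn_integral_indicator)
    also have "\<dots> = ennreal \<bar>n \<bullet> w\<bar> * (\<integral>\<^sup>+z. indicator {0..1} (t z) * indicator A (q z) \<partial>lborel)"
      unfolding t_def p_def q_def using n w by (intro nn_integral_oblique_prism) auto
    also have "(\<integral>\<^sup>+z. indicator {0..1} (t z) * indicator A (q z) \<partial>lborel) = (\<integral>\<^sup>+z. indicator A z \<partial>Q)"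
      by (simp add: Q_def nn_integral_distr nn_integral_density del: nn_integral_indicator)
    also have "ennreal \<bar>n \<bullet> w\<bar> * \<dots> = emeasure (density Q (\<lambda>_. ennreal \<bar>n \<bullet> w\<bar>)) A"
      by (simp add: Q_def emeasure_density nn_integral_cmult)
    finally show "emeasure P A = emeasure (density Q (\<lambda>_. ennreal \<bar>n \<bullet> w\<bar>)) A" .
  qed
  then have "integral\<^sup>L P G = integral\<^sup>L (density Q (\<lambda>_. ennreal \<bar>n \<bullet> w\<bar>)) G" by simp
  also have "\<dots> = \<bar>n \<bullet> w\<bar> * integral\<^sup>L Q G"
    by (subst integral_density) (auto simp: Q_def)
  also have "integral\<^sup>L Q G = (LINT z|lborel. indicator {0..1} (t z) * G (q z))"
    unfolding Q_def
    by (subst integral_distr, simp, simp, subst ennreal_indicator[symmetric], subst integral_density) auto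
  also have "integral\<^sup>L P G = (LINT z|lborel. indicator {0..1} (t z / (n \<bullet> w)) * G (p z))"
    unfolding P_def
    by (subst integral_distr, simp, simp, subst ennreal_indicator[symmetric], subst integral_density) auto
  finally show ?thesis by (simp add: p_def q_def)
qed

section \<open>The divergence theorem for convex bodies with flat faces\<close>

text \<open>A ray from \<open>w0\<close> through a point \<open>w\<close> on the inner side and
  close to \<open>y\<close> reaches the hyperplane inside \<open>e\<close>; hence \<open>w\<close>
  lies strictly between an interior point and a point of the convex set \<open>A\<close>.\<close>

lemma eventually_interior_beside_flat_face:
  fixes A e :: "'a::euclidean_space set"
  assumes "convex A" "e \<subseteq> A" and e: "e \<subseteq> {x. n \<bullet> x = b}" "aff_dim e = int DIM('a) - 1"
    and "n \<noteq> 0" and w0: "w0 \<in> interior A" "n \<bullet> w0 < b" and y: "y \<in> rel_interior e"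
  shows "\<forall>\<^sub>F w in nhds y. n \<bullet> w < b \<longrightarrow> w \<in> interior A"
proof -
  \<comment> \<open>Having the full dimension of the hyperplane, \<open>e\<close> contains a ball of
    the hyperplane around its relative interior point \<open>y\<close>.\<close>
  have "affine hull e = {x. n \<bullet> x = b}"
  proof (rule affine_dim_equal)
    show "affine hull e \<noteq> {}" using y rel_interior_subset by fastforce
    show "affine hull e \<subseteq> {x. n \<bullet> x = b}" by (intro hull_minimal e affine_hyperplane)
  qed (use e \<open>n \<noteq> 0\<close> in \<open>auto simp: affine_hyperplane aff_dim_affine_hull\<close>)
  then obtain r where r: "r > 0" "ball y r \<inter> {x. n \<bullet> x = b} \<subseteq> e"
    using y by (auto simp: mem_rel_interior_ball)
  have ny: "n \<bullet> y = b" using y e rel_interior_subset by blast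
  define D where "D = b - n \<bullet> w0"
  have D: "D > 0" using w0 by (simp add: D_def)
  \<comment> \<open>For \<open>s w < 1\<close> these solve
    \<open>w = (1 - s w) *\<^sub>R \<phi> w + s w *\<^sub>R w0\<close> with
    \<open>n \<bullet> \<phi> w = b\<close>, so \<open>\<phi> w\<close> is where the ray from
    \<open>w0\<close> meets the hyperplane.\<close>
  define s where "s w = (b - n \<bullet> w) / D" for w
  define \<phi> where "\<phi> w = w + (s w / (1 - s w)) *\<^sub>R (w - w0)" for w
  have ts: "(s \<longlongrightarrow> 0) (nhds y)"
  proof -
    have "(s \<longlongrightarrow> (b - n \<bullet> y) / D) (nhds y)"
      unfolding s_def using D by (intro tendsto_intros filterlim_ident) auto
    then show ?thesis using ny by simp
  qed
  have "(\<phi> \<longlongrightarrow> y + (0 / (1 - 0)) *\<^sub>R (y - w0)) (nhds y)"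
    unfolding \<phi>_def by (intro tendsto_intros ts filterlim_ident) auto
  then have "\<forall>\<^sub>F w in nhds y. dist (\<phi> w) y < r"
    using r(1) by (simp add: tendsto_iff)
  moreover have "\<forall>\<^sub>F w in nhds y. s w < 1"
    using order_tendstoD(2)[OF ts, of 1] by simp
  ultimately show ?thesis
  proof eventually_elim
    fix w assume w: "dist (\<phi> w) y < r" "s w < 1"
    show "n \<bullet> w < b \<longrightarrow> w \<in> interior A"
    proof
      assume "n \<bullet> w < b"
      then have s0: "s w > 0" using D by (simp add: s_def)
      have nw: "n \<bullet> w = b - s w * D" using D by (simp add: s_def)
      have "n \<bullet> \<phi> w = n \<bullet> w + (s w / (1 - s w)) * (n \<bullet> w - n \<bullet> w0)"
        by (simp add: \<phi>_def inner_add_right inner_diff_right)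
      also have "n \<bullet> w - n \<bullet> w0 = (1 - s w) * D" using nw by (simp add: D_def algebra_simps)
      finally have "n \<bullet> \<phi> w = b" using w(2) nw by simp
      then have "\<phi> w \<in> A" using r w(1) \<open>e \<subseteq> A\<close> by (auto simp: dist_commute)
      then have "\<phi> w - s w *\<^sub>R (\<phi> w - w0) \<in> interior A"
        using \<open>convex A\<close> w0 s0 w(2) by (intro mem_interior_convex_shrink) auto
      also have "\<phi> w - s w *\<^sub>R (\<phi> w - w0) = w"
      proof -
        have "\<phi> w - s w *\<^sub>R (\<phi> w - w0) = (1 - s w) *\<^sub>R \<phi> w + s w *\<^sub>R w0" by (simp add: algebra_simps)
        also have "(1 - s w) *\<^sub>R \<phi> w = (1 - s w) *\<^sub>R w + s w *\<^sub>R (w - w0)"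
          using w(2) by (simp add: \<phi>_def scaleR_add_right)
        finally show ?thesis by (simp add: algebra_simps)
      qed
      finally show "w \<in> interior A" .
    qed
  qed
qed

text \<open>A segment in direction \<open>a\<close> meets \<open>S\<close> only if its end points
  lie in this union of lines. A set with null shadow can therefore be ignored when segments are
  averaged over all positions.\<close>

definition shadow :: "'a::real_vector \<Rightarrow> 'a set \<Rightarrow> 'a set" where
  "shadow a S = {y + t *\<^sub>R a | y t. y \<in> S}"

lemma shadow_mono: "S \<subseteq> S' \<Longrightarrow> shadow a S \<subseteq> shadow a S'"
  by (auto simp: shadow_def)

lemma shadow_UN: "shadow a (\<Union>i\<in>I. S i) = (\<Union>i\<in>I. shadow a (S i))"
  by (auto simp: shadow_def)

lemma shadow_uminus: "shadow (- a) S = shadow a S"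
proof -
  have "shadow (- a) S \<subseteq> shadow a S" for a :: 'a
  proof
    fix x assume "x \<in> shadow (- a) S"
    then obtain y t where "y \<in> S" "x = y + (- t) *\<^sub>R a" by (auto simp: shadow_def)
    then show "x \<in> shadow a S" unfolding shadow_def by blast
  qed
  from this[of a] this[of "- a"] show ?thesis by auto
qed

lemma shadowI: "y - t *\<^sub>R a \<in> S \<Longrightarrow> y \<in> shadow a S"
  unfolding shadow_def by (rule CollectI, rule exI[of _ "y - t *\<^sub>R a"], rule exI[of _ t]) simp

text \<open>Adding one direction to an affine set of codimension two still leaves codimension at
  least one.\<close>

lemma negligible_shadow_codim2:
  fixes S :: "'a::euclidean_space set"
  assumes "aff_dim S \<le> int DIM('a) - 2"
  shows "negligible (shadow a S)"
proof (cases "S = {}")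
  case False
  then obtain y0 where y0: "y0 \<in> S" by blast
  let ?W = "(\<lambda>x. - y0 + x) ` S"
  have "aff_dim S = int (dim ?W)"
    using y0 by (intro aff_dim_eq_dim hull_inc)
  then have "dim (insert a ?W) < DIM('a)"
    using assms by (auto simp: dim_insert)
  then have "negligible (span (insert a ?W))"
    by (intro negligible_lowdim) simp
  then have "negligible ((+) y0 ` span (insert a ?W))"
    by (rule negligible_translation)
  moreover have "shadow a S \<subseteq> (+) y0 ` span (insert a ?W)"
  proof
    fix x assume "x \<in> shadow a S"
    then obtain y t where x: "y \<in> S" "x = y + t *\<^sub>R a" by (auto simp: shadow_def)
    have "- y0 + y \<in> insert a ?W" using x(1) by blast
    then have "(- y0 + y) + t *\<^sub>R a \<in> span (insert a ?W)"
      by (rule span_add[OF span_base span_scale[OF span_base]]) blast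
    moreover have "x = y0 + ((- y0 + y) + t *\<^sub>R a)" using x by simp
    ultimately show "x \<in> (+) y0 ` span (insert a ?W)" by blast
  qed
  ultimately show ?thesis by (rule negligible_subset)
qed (simp add: shadow_def)

text \<open>Lines in direction \<open>a\<close> never leave the hyperplane, so a face parallel to
  \<open>a\<close> is met by almost no segment.\<close>

lemma negligible_shadow_parallel:
  fixes S :: "'a::euclidean_space set"
  assumes "S \<subseteq> {x. n \<bullet> x = b}" "n \<noteq> 0" "n \<bullet> a = 0"
  shows "negligible (shadow a S)"
proof (rule negligible_subset)
  show "negligible {x. n \<bullet> x = b}" using assms by (intro negligible_hyperplane) auto
  show "shadow a S \<subseteq> {x. n \<bullet> x = b}" using assms by (auto simp: shadow_def inner_add_right)
qed

section \<open>Convex bodies whose boundary is composed of flat pieces\<close>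

lemma integral_lborel_translate:
  fixes f :: "'a::euclidean_space \<Rightarrow> real"
  assumes [measurable]: "f \<in> borel_measurable borel"
  shows "(LINT z|lborel. f (c + z)) = (LINT z|lborel. f z)"
proof -
  have "(LINT z|lborel. f z) = (LINT z|distr lborel borel ((+) c). f z)"
    by (simp add: lborel_distr_plus)
  also have "\<dots> = (LINT z|lborel. f (c + z))"
    by (subst integral_distr) auto
  finally show ?thesis by simp
qed

text \<open>A version of \<open>flat_integral\<close> in which the hyperplane is given by its offset
  \<open>b\<close> instead of a chosen point of \<open>e\<close>, and with Borel measure, for which
  Fubini and translations are direct.\<close>

definition plane_integral :: "'a::euclidean_space \<Rightarrow> real \<Rightarrow> 'a set \<Rightarrow> ('a \<Rightarrow> real) \<Rightarrow> real" where
  "plane_integral n b e h = (LINT z|lborel. indicator {0..1} (n \<bullet> z - b) *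
     (indicator e (z - (n \<bullet> z - b) *\<^sub>R n) * h (z - (n \<bullet> z - b) *\<^sub>R n)))"

text \<open>A facet of \<open>T\<close> may be divided into several pieces \<open>F i\<close>, which
  is how hanging nodes enter. The pieces have to exhaust the boundary only up to points that almost
  no segment in direction \<open>a\<close> meets.\<close>

locale flat_boundary =
  fixes T :: "'a::euclidean_space set" and I :: "'i set" and F :: "'i \<Rightarrow> 'a set"
    and \<nu> :: "'i \<Rightarrow> 'a" and b :: "'i \<Rightarrow> real" and a :: 'a
  assumes T: "compact T" "convex T" "interior T \<noteq> {}" and I: "finite I"
    and F: "\<And>i. i \<in> I \<Longrightarrow> compact (F i)" "\<And>i. i \<in> I \<Longrightarrow> F i \<subseteq> T"
      "\<And>i. i \<in> I \<Longrightarrow> F i \<subseteq> {x. \<nu> i \<bullet> x = b i}" "\<And>i. i \<in> I \<Longrightarrow> aff_dim (F i) = int DIM('a) - 1"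
    and \<nu>: "\<And>i. i \<in> I \<Longrightarrow> norm (\<nu> i) = 1" "\<And>i x. i \<in> I \<Longrightarrow> x \<in> T \<Longrightarrow> \<nu> i \<bullet> x \<le> b i"
    and disj: "\<And>i j. i \<in> I \<Longrightarrow> j \<in> I \<Longrightarrow> i \<noteq> j \<Longrightarrow> rel_interior (F i) \<inter> F j = {}"
    and cover: "negligible (shadow a (frontier T - (\<Union>i\<in>I. rel_interior (F i))))"
begin

text \<open>The backward segment from \<open>z\<close> to \<open>z - a\<close> meets the hyperplane of \<open>F i\<close> at parameter
  \<open>cross i z\<close>. Integrating the fundamental theorem of calculus on such segments over all \<open>z\<close> gives the
  divergence theorem: the end point terms cancel by translation invariance.\<close>

definition cross :: "'i \<Rightarrow> 'a \<Rightarrow> real" where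
  "cross i z = (\<nu> i \<bullet> z - b i) / (\<nu> i \<bullet> a)"

definition hit :: "('a \<Rightarrow> real) \<Rightarrow> 'i \<Rightarrow> 'a \<Rightarrow> real" where
  "hit g i z = indicator {0..1} (cross i z) * (indicator (F i) (z - cross i z *\<^sub>R a) * g (z - cross i z *\<^sub>R a))"

definition seg :: "('a \<Rightarrow> real) \<Rightarrow> 'a \<Rightarrow> real \<Rightarrow> real" where
  "seg D z t = indicator {0..1} t * (indicator T (z - t *\<^sub>R a) * D (z - t *\<^sub>R a))"

text \<open>The points where a crossing cannot be assigned to one piece with a definite sign of
  \<open>\<nu> i \<bullet> a\<close>.\<close>

definition bad :: "'a set" where
  "bad = frontier T - (\<Union>i\<in>I. rel_interior (F i)) \<union> (\<Union>i\<in>{i\<in>I. \<nu> i \<bullet> a = 0}. F i)"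

lemma negligible_shadow_bad: "negligible (shadow a bad)"
proof -
  have "shadow a bad = shadow a (frontier T - (\<Union>i\<in>I. rel_interior (F i)))
      \<union> (\<Union>i\<in>{i\<in>I. \<nu> i \<bullet> a = 0}. shadow a (F i))"
    unfolding bad_def by (auto simp: shadow_def)
  moreover have "negligible (shadow a (F i))" if "i \<in> I" "\<nu> i \<bullet> a = 0" for i
    using F(3)[OF that(1)] \<nu>(1)[OF that(1)] that(2) by (intro negligible_shadow_parallel) auto
  ultimately show ?thesis
    using cover I by (auto intro!: negligible_Union)
qed

lemma interior_less: "i \<in> I \<Longrightarrow> x \<in> interior T \<Longrightarrow> \<nu> i \<bullet> x < b i"
proof -
  assume i: "i \<in> I" and x: "x \<in> interior T"
  have "interior T \<subseteq> interior {x. \<nu> i \<bullet> x \<le> b i}"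
    using \<nu>(2)[OF i] by (intro interior_mono) auto
  also have "\<dots> = {x. \<nu> i \<bullet> x < b i}"
    using \<nu>(1)[OF i] by (intro interior_halfspace_le) auto
  finally show ?thesis using x by auto
qed

text \<open>Seen from \<open>z\<close> backwards, every hyperplane with
  \<open>\<nu> i \<bullet> a > 0\<close> is crossed no later than the first point of
  \<open>T\<close>, so such a piece can be hit only at this entry point, and off the bad set exactly
  one piece contains it. If \<open>z\<close> is already in \<open>T\<close>, a hit would put
  \<open>z\<close> on the frontier.\<close>

lemma sum_hit_upper:
  assumes z: "z \<notin> shadow a bad" "z \<notin> frontier T"
  defines "c \<equiv> Inf {t\<in>{0..1}. z - t *\<^sub>R a \<in> T}"
  shows "(\<Sum>i\<in>{i\<in>I. \<nu> i \<bullet> a > 0}. hit g i z)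
    = (if z \<notin> T \<and> (\<exists>t\<in>{0..1}. z - t *\<^sub>R a \<in> T) then g (z - c *\<^sub>R a) else 0)"
proof -
  have cl: "cross j z \<le> t" if "j \<in> I" "\<nu> j \<bullet> a > 0" "z - t *\<^sub>R a \<in> T" for j t
    using \<nu>(2)[OF that(1,3)] that(2) by (simp add: cross_def inner_diff_right divide_le_eq)
  have zero: "hit g j z = 0" if "cross j z \<notin> {0..1} \<or> z - cross j z *\<^sub>R a \<notin> F j" for j
    using that by (auto simp: hit_def)
  show ?thesis
  proof (cases "z \<notin> T \<and> (\<exists>t\<in>{0..1}. z - t *\<^sub>R a \<in> T)")
    case True
    let ?S = "{t\<in>{0..1}. z - t *\<^sub>R a \<in> T}"
    have "?S = {0..1} \<inter> (\<lambda>t. z - t *\<^sub>R a) -` T" by auto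
    moreover have "closed ((\<lambda>t. z - t *\<^sub>R a) -` T)"
      using T(1) by (intro closed_vimage compact_imp_closed continuous_intros)
    ultimately have "closed ?S" by auto
    moreover have "?S \<noteq> {}" and bb: "bdd_below ?S" using True by (auto intro!: bdd_belowI[of _ 0])
    ultimately have "c \<in> ?S" unfolding c_def by (intro closed_contains_Inf)
    then have c: "0 \<le> c" "c \<le> 1" "z - c *\<^sub>R a \<in> T" by auto
    have c0: "c > 0" using c True by (cases "c = 0") auto
    have cmin: "c \<le> t" if "0 \<le> t" "t \<le> 1" "z - t *\<^sub>R a \<in> T" for t
      unfolding c_def using that bb by (intro cInf_lower) auto
    let ?y = "z - c *\<^sub>R a"
    \<comment> \<open>Just before the parameter \<open>c\<close> the segment is still outside
      \<open>T\<close>, because \<open>c\<close> is minimal.\<close>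
    have out: "\<forall>\<^sub>F u in at_right 0. 0 < u \<and> ?y + u *\<^sub>R a \<notin> T"
      using eventually_at_right_real[OF c0]
    proof eventually_elim
      case (elim u)
      have eq: "z - (c - u) *\<^sub>R a = ?y + u *\<^sub>R a" by (simp add: algebra_simps)
      have "z - (c - u) *\<^sub>R a \<notin> T" using cmin[of "c - u"] elim c by auto
      then show ?case using elim unfolding eq by simp
    qed
    have "((\<lambda>u. ?y + u *\<^sub>R a) \<longlongrightarrow> ?y + 0 *\<^sub>R a) (at_right 0)"
      by (intro tendsto_intros)
    then have lim: "((\<lambda>u. ?y + u *\<^sub>R a) \<longlongrightarrow> ?y) (at_right 0)" by simp
    have "?y \<notin> interior T"
    proof
      assume "?y \<in> interior T"
      then have "\<forall>\<^sub>F u in at_right 0. ?y + u *\<^sub>R a \<in> interior T"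
        using topological_tendstoD[OF lim] by blast
      with out have "\<forall>\<^sub>F u in at_right (0::real). False"
        by eventually_elim (use interior_subset in blast)
      then show False by simp
    qed
    then have "?y \<in> frontier T"
      using c(3) closure_subset by (auto simp: frontier_def)
    moreover have "?y \<notin> bad" using z(1) shadowI by blast
    ultimately obtain i where i: "i \<in> I" "?y \<in> rel_interior (F i)" unfolding bad_def by blast
    then have yF: "?y \<in> F i" using rel_interior_subset by blast
    then have nz: "\<nu> i \<bullet> a \<noteq> 0" using \<open>?y \<notin> bad\<close> i(1) unfolding bad_def by blast
    \<comment> \<open>With the opposite sign the points just before the entry would be on the inner
      side of the piece, hence interior to \<open>T\<close>.\<close>
    have pos: "\<nu> i \<bullet> a > 0"
    proof (rule ccontr)
      assume "\<not> ?thesis"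
      with nz have neg: "\<nu> i \<bullet> a < 0" by simp
      obtain w0 where w0: "w0 \<in> interior T" using T(3) by blast
      have "\<forall>\<^sub>F w in nhds ?y. \<nu> i \<bullet> w < b i \<longrightarrow> w \<in> interior T"
        using T F(2,3,4)[OF i(1)] \<nu>(1)[OF i(1)] w0 interior_less[OF i(1) w0] i(2)
        by (intro eventually_interior_beside_flat_face[where e = "F i"]) auto
      then have "\<forall>\<^sub>F u in at_right 0. \<nu> i \<bullet> (?y + u *\<^sub>R a) < b i \<longrightarrow> ?y + u *\<^sub>R a \<in> interior T"
        by (rule eventually_compose_filterlim[OF _ lim])
      with out have "\<forall>\<^sub>F u in at_right (0::real). False"
      proof eventually_elim
        case (elim u)
        have "\<nu> i \<bullet> ?y = b i" using F(3)[OF i(1)] yF by auto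
        moreover have "u * (\<nu> i \<bullet> a) < 0" using elim neg by (simp add: mult_pos_neg)
        ultimately have "\<nu> i \<bullet> (?y + u *\<^sub>R a) < b i" by (simp add: inner_add_right)
        then show False using elim interior_subset by blast
      qed
      then show False by simp
    qed
    have ci: "cross i z = c"
    proof -
      have "\<nu> i \<bullet> ?y = b i" using F(3)[OF i(1)] yF by auto
      then show ?thesis using nz by (simp add: cross_def inner_diff_right field_simps)
    qed
    \<comment> \<open>A second hit would occur at the same parameter \<open>c\<close>, so the entry
      point would lie in two pieces, against \<open>disj\<close>.\<close>
    have "hit g j z = 0" if j: "j \<in> I" "\<nu> j \<bullet> a > 0" "j \<noteq> i" for j
    proof (rule ccontr)
      assume "hit g j z \<noteq> 0"
      then have h: "cross j z \<in> {0..1}" "z - cross j z *\<^sub>R a \<in> F j" using zero by blast+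
      then have "z - cross j z *\<^sub>R a \<in> T" using F(2)[OF j(1)] by blast
      then have "c \<le> cross j z" using h by (intro cmin) auto
      moreover have "cross j z \<le> c" using cl[OF j(1,2)] c by blast
      ultimately have "?y \<in> F j" using h by simp
      then show False using disj[OF i(1) j(1)] j(3) i(2) by blast
    qed
    then have "(\<Sum>j\<in>{i\<in>I. \<nu> i \<bullet> a > 0}. hit g j z) = hit g i z"
      using I i(1) pos by (subst sum.remove[of _ i]) (auto intro!: sum.neutral)
    also have "\<dots> = g ?y" using ci c yF by (simp add: hit_def)
    finally show ?thesis using True by simp
  next
    case False
    have "hit g j z = 0" if j: "j \<in> I" "\<nu> j \<bullet> a > 0" for j
    proof (rule ccontr)
      assume "hit g j z \<noteq> 0"
      then have h: "cross j z \<in> {0..1}" "z - cross j z *\<^sub>R a \<in> F j" using zero by blast+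
      then have "z - cross j z *\<^sub>R a \<in> T" using F(2)[OF j(1)] by blast
      then have "z \<in> T" using False h(1) by blast
      then have "cross j z \<le> 0" using cl[OF j, of 0] by simp
      then have "cross j z = 0" using h(1) by simp
      then have "z \<in> F j" using h(2) by simp
      then have "z \<notin> interior T" using F(3)[OF j(1)] interior_less[OF j(1)] by force
      then show False using z(2) \<open>z \<in> T\<close> closure_subset by (auto simp: frontier_def)
    qed
    then have "(\<Sum>i\<in>{i\<in>I. \<nu> i \<bullet> a > 0}. hit g i z) = 0" by (intro sum.neutral) auto
    then show ?thesis by (simp only: if_not_P[OF False])
  qed
qed

end

lemma (in flat_boundary) flat_boundary_uminus: "flat_boundary T I F \<nu> b (- a)"
  using T I F \<nu> disj cover by unfold_locales (auto simp: shadow_uminus)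

context flat_boundary
begin

text \<open>The exit point of a segment is the entry point of the reversed one, so
  \<open>sum_hit_upper\<close> is applied with direction \<open>- a\<close> and start
  \<open>z - a\<close>; the parameter \<open>t\<close> becomes \<open>1 - t\<close> and the infimum
  a supremum.\<close>

lemma sum_hit_lower:
  assumes z: "z \<notin> shadow a bad" "z - a \<notin> frontier T"
  defines "d \<equiv> Sup {t\<in>{0..1}. z - t *\<^sub>R a \<in> T}"
  shows "(\<Sum>i\<in>{i\<in>I. \<nu> i \<bullet> a < 0}. hit g i z)
    = (if z - a \<notin> T \<and> (\<exists>t\<in>{0..1}. z - t *\<^sub>R a \<in> T) then g (z - d *\<^sub>R a) else 0)"
proof -
  interpret m: flat_boundary T I F \<nu> b "- a" by (rule flat_boundary_uminus)
  have bad: "m.bad = bad" by (simp add: bad_def m.bad_def)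
  have za: "z - a \<notin> shadow (- a) m.bad"
  proof
    assume "z - a \<in> shadow (- a) m.bad"
    then obtain y t where "y \<in> bad" "z - a = y + t *\<^sub>R a" unfolding bad shadow_uminus by (auto simp: shadow_def)
    then have "z - (t + 1) *\<^sub>R a \<in> bad" by (simp add: algebra_simps)
    then show False using z(1) shadowI by blast
  qed
  have hit: "m.hit g i (z - a) = hit g i z" if "\<nu> i \<bullet> a < 0" for i
  proof -
    have "m.cross i (z - a) = 1 - cross i z"
      using that by (simp add: m.cross_def cross_def inner_diff_right field_simps)
    moreover have "z - a - (1 - cross i z) *\<^sub>R (- a) = z - cross i z *\<^sub>R a" by (simp add: algebra_simps)
    moreover have "indicator {0..1} (1 - cross i z) = (indicator {0..1} (cross i z) :: real)"
      by (auto simp: indicator_def)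
    ultimately show ?thesis unfolding m.hit_def hit_def by (simp only:)
  qed
  let ?S = "{t\<in>{0..1}. z - t *\<^sub>R a \<in> T}"
  have S: "{t\<in>{0..1}. z - a - t *\<^sub>R (- a) \<in> T} = (\<lambda>t. 1 - t) ` ?S"
  proof -
    have "t \<in> (\<lambda>t. 1 - t) ` ?S" if "t \<in> {0..1}" "z - a - t *\<^sub>R (- a) \<in> T" for t
      using that by (intro image_eqI[of _ _ "1 - t"]) (auto simp: algebra_simps)
    then show ?thesis by (auto simp: algebra_simps)
  qed
  have Inf: "Inf ((\<lambda>t. 1 - t) ` ?S) = 1 - d" if "?S \<noteq> {}"
  proof -
    have bd: "bdd_above ?S" by (auto intro!: bdd_aboveI[of _ 1])
    show ?thesis unfolding d_def
    proof (rule cInf_eq_non_empty)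
      show "(\<lambda>t. 1 - t) ` ?S \<noteq> {}" using that by blast
      show "1 - Sup ?S \<le> x" if "x \<in> (\<lambda>t. 1 - t) ` ?S" for x
        using that bd cSup_upper[OF _ bd] by fastforce
      show "y \<le> 1 - Sup ?S" if "\<And>x. x \<in> (\<lambda>t. 1 - t) ` ?S \<Longrightarrow> y \<le> x" for y
      proof -
        have "Sup ?S \<le> 1 - y"
          using that by (intro cSup_least \<open>?S \<noteq> {}\<close>) force
        then show ?thesis by simp
      qed
    qed
  qed
  have "(\<Sum>i\<in>{i\<in>I. \<nu> i \<bullet> a < 0}. hit g i z) = (\<Sum>i\<in>{i\<in>I. \<nu> i \<bullet> (- a) > 0}. m.hit g i (z - a))"
    by (intro sum.cong) (auto simp: hit)
  also have "\<dots> = (if z - a \<notin> T \<and> (\<exists>t\<in>{0..1}. z - a - t *\<^sub>R (- a) \<in> T)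
      then g (z - a - Inf {t\<in>{0..1}. z - a - t *\<^sub>R (- a) \<in> T} *\<^sub>R (- a)) else 0)"
    using za z(2) by (rule m.sum_hit_upper)
  also have "\<dots> = (if z - a \<notin> T \<and> (\<exists>t\<in>{0..1}. z - t *\<^sub>R a \<in> T) then g (z - d *\<^sub>R a) else 0)"
  proof (cases "?S = {}")
    case True
    then have "{t\<in>{0..1}. z - a - t *\<^sub>R (- a) \<in> T} = {}" unfolding S by simp
    then show ?thesis using True by auto
  next
    case False
    then have "{t\<in>{0..1}. z - a - t *\<^sub>R (- a) \<in> T} \<noteq> {}" unfolding S by simp
    then have "\<exists>t\<in>{0..1}. z - a - t *\<^sub>R (- a) \<in> T" "\<exists>t\<in>{0..1}. z - t *\<^sub>R a \<in> T"
      using False by blast+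
    moreover have "z - a - (1 - d) *\<^sub>R (- a) = z - d *\<^sub>R a" by (simp add: algebra_simps)
    ultimately show ?thesis unfolding S Inf[OF False] by (simp only: simp_thms)
  qed
  finally show ?thesis .
qed


text \<open>The function \<open>hit g i\<close> lives on the oblique prism with base
  \<open>F i\<close> and edge \<open>a\<close>, which is compact.\<close>

lemma integral_hit:
  assumes i: "i \<in> I" "\<nu> i \<bullet> a \<noteq> 0" and g: "continuous_on UNIV g"
  shows "integrable lborel (hit g i)"
    and "(LINT z|lborel. hit g i z) = \<bar>\<nu> i \<bullet> a\<bar> * plane_integral (\<nu> i) (b i) (F i) g"
proof -
  let ?K = "(\<lambda>(t, y). y + t *\<^sub>R a) ` ({0..1} \<times> F i)"
  have c: "continuous_on UNIV (cross i)"
    unfolding cross_def by (intro continuous_intros) (use i in auto)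
  have "compact ?K"
    using F(1)[OF i(1)] by (intro compact_continuous_image compact_Times) (auto simp: case_prod_unfold intro!: continuous_intros)
  moreover have "continuous_on ?K (\<lambda>z. g (z - cross i z *\<^sub>R a))"
    by (intro continuous_on_compose2[OF g] continuous_intros continuous_on_subset[OF c]) auto
  ultimately have "integrable lborel (\<lambda>z. indicator ?K z *\<^sub>R g (z - cross i z *\<^sub>R a))"
    by (rule borel_integrable_compact)
  moreover have "z \<in> ?K \<longleftrightarrow> cross i z \<in> {0..1} \<and> z - cross i z *\<^sub>R a \<in> F i" for z
  proof
    assume "z \<in> ?K"
    then obtain t y where ty: "t \<in> {0..1}" "y \<in> F i" "z = y + t *\<^sub>R a" by auto
    then have "\<nu> i \<bullet> y = b i" using F(3)[OF i(1)] by auto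
    then have "cross i z = t" using i ty by (simp add: cross_def inner_add_right)
    then show "cross i z \<in> {0..1} \<and> z - cross i z *\<^sub>R a \<in> F i" using ty by simp
  next
    assume "cross i z \<in> {0..1} \<and> z - cross i z *\<^sub>R a \<in> F i"
    then show "z \<in> ?K" by (intro image_eqI[of _ _ "(cross i z, z - cross i z *\<^sub>R a)"]) auto
  qed
  then have "indicator ?K z *\<^sub>R g (z - cross i z *\<^sub>R a) = hit g i z" for z
    by (auto simp: hit_def indicator_def)
  ultimately show "integrable lborel (hit g i)" by simp
  have "F i \<in> sets borel" using F(1)[OF i(1)] by (simp add: borel_compact)
  then have "(\<lambda>z. indicator (F i) z * g z) \<in> borel_measurable borel"
    using g by (intro borel_measurable_times borel_measurable_indicator borel_measurable_continuous_onI) auto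
  from integral_oblique_prism[OF \<nu>(1)[OF i(1)] i(2) this, of "b i"]
  show "(LINT z|lborel. hit g i z) = \<bar>\<nu> i \<bullet> a\<bar> * plane_integral (\<nu> i) (b i) (F i) g"
    unfolding hit_def cross_def plane_integral_def .
qed

text \<open>By convexity the part of the segment in \<open>T\<close> is one interval
  \<open>{c..d}\<close>, and the fundamental theorem gives the difference of \<open>g\<close> at its
  ends. Each end is either an end of the whole segment, where it cancels against the term with
  \<open>indicator T\<close>, or a crossing counted by one of the sums.\<close>

lemma segment_hit_balance:
  assumes z: "z \<notin> shadow a bad" "z \<notin> frontier T" "z - a \<notin> frontier T"
    and D: "continuous_on UNIV D"
    and deriv: "\<And>y t. ((\<lambda>t. g (y + t *\<^sub>R a)) has_real_derivative D (y + t *\<^sub>R a)) (at t)"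
  shows "(LINT t|lborel. seg D z t)
      + indicator T (z - a) * g (z - a) - indicator T z * g z
    = (\<Sum>i\<in>{i\<in>I. \<nu> i \<bullet> a > 0}. hit g i z) - (\<Sum>i\<in>{i\<in>I. \<nu> i \<bullet> a < 0}. hit g i z)"
proof -
  let ?S = "{t\<in>{0..1}. z - t *\<^sub>R a \<in> T}"
  have ind: "seg D z t = D (z - t *\<^sub>R a) * indicator ?S t" for t
    by (auto simp: seg_def indicator_def)
  show ?thesis
  proof (cases "?S = {}")
    case True
    then have no: "\<not> (\<exists>t\<in>{0..1}. z - t *\<^sub>R a \<in> T)" by blast
    then have "z - 0 *\<^sub>R a \<notin> T" "z - 1 *\<^sub>R a \<notin> T" using atLeastAtMost_iff zero_le_one by blast+
    then show ?thesis
      unfolding ind sum_hit_upper[OF z(1,2)] sum_hit_lower[OF z(1,3)] True using no by simp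
  next
    case False
    then have ex: "\<exists>t\<in>{0..1}. z - t *\<^sub>R a \<in> T" by blast
    define c d where "c = Inf ?S" and "d = Sup ?S"
    have S: "?S = {0..1} \<inter> (\<lambda>t. z - t *\<^sub>R a) -` T" by auto
    have "closed ((\<lambda>t. z - t *\<^sub>R a) -` T)"
      using T(1) by (intro closed_vimage compact_imp_closed continuous_intros)
    then have "closed ?S" unfolding S by auto
    have bb: "bdd_below ?S" "bdd_above ?S" by (auto intro!: bdd_belowI[of _ 0] bdd_aboveI[of _ 1])
    have cS: "c \<in> ?S"
      unfolding c_def using False bb(1) \<open>closed ?S\<close> by (intro closed_contains_Inf)
    have dS: "d \<in> ?S"
      unfolding d_def using False bb(2) \<open>closed ?S\<close> by (intro closed_contains_Sup)
    note cd = cS dS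
    have sub: "?S \<subseteq> {c..d}"
      unfolding c_def d_def using bb by (auto intro!: cInf_lower cSup_upper)
    have "{c..d} \<subseteq> ?S"
    proof
      fix t assume t: "t \<in> {c..d}"
      show "t \<in> ?S"
      proof (cases "c = d")
        case False
        then have "c < d" using t by auto
        define s where "s = (t - c) / (d - c)"
        have s: "0 \<le> s" "s \<le> 1" using t \<open>c < d\<close> by (auto simp: s_def)
        have ts: "t = c + s * (d - c)" using \<open>c < d\<close> by (simp add: s_def)
        have "z - t *\<^sub>R a = (1 - s) *\<^sub>R (z - c *\<^sub>R a) + s *\<^sub>R (z - d *\<^sub>R a)"
          unfolding ts by (simp add: algebra_simps)
        moreover have "(1 - s) *\<^sub>R (z - c *\<^sub>R a) + s *\<^sub>R (z - d *\<^sub>R a) \<in> T"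
          using cd s T(2) by (intro convexD) auto
        ultimately show ?thesis using t cd by auto
      qed (use t cd in auto)
    qed
    with sub have Scd: "?S = {c..d}" by blast
    have "c \<le> d" using cd sub by auto
    \<comment> \<open>The parameter runs against \<open>a\<close>, hence the antiderivative is
      \<open>- g\<close>.\<close>
    have "(LINT t|lborel. D (z - t *\<^sub>R a) * indicator {c..d} t) = - g (z - d *\<^sub>R a) - - g (z - c *\<^sub>R a)"
    proof (rule integral_FTC_Icc_real[OF \<open>c \<le> d\<close>])
      fix t
      have "((\<lambda>t. - g (z + (- t) *\<^sub>R a)) has_real_derivative - (D (z + (- t) *\<^sub>R a) * (- 1))) (at t)"
        by (intro DERIV_minus DERIV_chain2[OF deriv]) (auto intro!: derivative_eq_intros)
      then show "((\<lambda>t. - g (z - t *\<^sub>R a)) has_real_derivative D (z - t *\<^sub>R a)) (at t)" by simp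
      have "continuous_on UNIV (\<lambda>t. D (z - t *\<^sub>R a))"
        by (intro continuous_on_compose2[OF D] continuous_intros) auto
      then show "isCont (\<lambda>t. D (z - t *\<^sub>R a)) t" by (simp add: continuous_on_eq_continuous_at)
    qed
    moreover have "z \<in> T \<longleftrightarrow> c = 0"
    proof
      assume "z \<in> T"
      then have "0 \<in> ?S" by simp
      then show "c = 0" using sub cd(1) by fastforce
    qed (use cd in auto)
    moreover have "z - a \<in> T \<longleftrightarrow> d = 1"
    proof
      assume "z - a \<in> T"
      then have "1 \<in> ?S" by simp
      then show "d = 1" using sub cd(2) by fastforce
    qed (use cd in auto)
    ultimately show ?thesis
      unfolding ind sum_hit_upper[OF z(1,2)] sum_hit_lower[OF z(1,3)] c_def[symmetric] d_def[symmetric]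
      using ex Scd by (auto simp: indicator_def)
  qed
qed

text \<open>For fixed \<open>t\<close> the integral over \<open>z\<close> is that of a function
  translated by \<open>t *\<^sub>R a\<close>, so it does not depend on \<open>t\<close>, and
  \<open>t\<close> ranges over an interval of length one.\<close>

lemma integral_segment:
  fixes D :: "'a \<Rightarrow> real"
  assumes D: "continuous_on UNIV D"
  shows "integrable lborel (\<lambda>z. LINT t|lborel. seg D z t)"
    and "(LINT z|lborel. LINT t|lborel. seg D z t)
      = (LINT y|lborel. indicator T y * D y)"
proof -
  let ?k = "\<lambda>(t, z). seg D z t"
  let ?K = "(\<lambda>(t, y). (t, y + t *\<^sub>R a)) ` ({0..1::real} \<times> T)"
  have cK: "compact ?K"
    using T(1) by (intro compact_continuous_image compact_Times) (auto simp: case_prod_unfold intro!: continuous_intros)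
  have "continuous_on ?K (\<lambda>(t, z). D (z - t *\<^sub>R a))"
    unfolding case_prod_unfold by (intro continuous_on_compose2[OF D] continuous_intros) auto
  note borel_integrable_compact[OF cK this]
  moreover have "(t, z) \<in> ?K \<longleftrightarrow> t \<in> {0..1} \<and> z - t *\<^sub>R a \<in> T" for t z
  proof
    assume "t \<in> {0..1} \<and> z - t *\<^sub>R a \<in> T"
    then show "(t, z) \<in> ?K" by (intro image_eqI[of _ _ "(t, z - t *\<^sub>R a)"]) auto
  qed auto
  then have "indicator ?K p *\<^sub>R (case p of (t, z) \<Rightarrow> D (z - t *\<^sub>R a)) = ?k p" for p
    by (cases p) (auto simp: seg_def indicator_def simp del: image_iff split: if_splits)
  ultimately have int: "integrable (lborel \<Otimes>\<^sub>M lborel) ?k" by (simp add: lborel_prod)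
  show "integrable lborel (\<lambda>z. LINT t|lborel. seg D z t)"
    using lborel_pair.integrable_snd[OF int] .
  have [measurable]: "T \<in> sets borel" using T(1) by (simp add: borel_compact)
  have [measurable]: "D \<in> borel_measurable borel" using D by (rule borel_measurable_continuous_onI)
  have tr: "(LINT z|lborel. indicator T (z - t *\<^sub>R a) * D (z - t *\<^sub>R a)) = (LINT y|lborel. indicator T y * D y)" for t
    using integral_lborel_translate[of "\<lambda>y. indicator T y * D y" "- (t *\<^sub>R a)"] by simp
  have "(LINT z|lborel. LINT t|lborel. seg D z t)
      = (LINT t|lborel. LINT z|lborel. seg D z t)"
    using lborel_pair.Fubini_integral[OF int] .
  also have "\<dots> = (LINT t|(lborel::real measure). indicator {0..1} t * (LINT y|lborel. indicator T y * D y))"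
    by (simp only: seg_def integral_mult_right_zero tr)
  also have "\<dots> = (LINT y|lborel. indicator T y * D y)" by simp
  finally show "(LINT z|lborel. LINT t|lborel. seg D z t)
      = (LINT y|lborel. indicator T y * D y)" .
qed

theorem integral_directional_derivative:
  assumes g: "continuous_on UNIV g" and D: "continuous_on UNIV D"
    and deriv: "\<And>y t. ((\<lambda>t. g (y + t *\<^sub>R a)) has_real_derivative D (y + t *\<^sub>R a)) (at t)"
  shows "(LINT y|lborel. indicator T y * D y)
    = (\<Sum>i\<in>I. (\<nu> i \<bullet> a) * plane_integral (\<nu> i) (b i) (F i) g)"
    (is "_ = (\<Sum>i\<in>I. _ * ?J i)")
proof -
  let ?P = "{i\<in>I. \<nu> i \<bullet> a > 0}" and ?N = "{i\<in>I. \<nu> i \<bullet> a < 0}"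
  let ?H = "\<lambda>z. LINT t|lborel. seg D z t"
  have Tb[measurable]: "T \<in> sets borel" using T(1) by (simp add: borel_compact)
  have [measurable]: "g \<in> borel_measurable borel" using g by (rule borel_measurable_continuous_onI)
  have ig: "integrable lborel (\<lambda>z. indicator T z * g z)"
    using borel_integrable_compact[OF T(1) continuous_on_subset[OF g]] by simp
  have iga: "integrable lborel (\<lambda>z. indicator T (z - a) * g (z - a))"
  proof -
    have "integrable (distr lborel borel ((+) (- a))) (\<lambda>z. indicator T z * g z)"
      using ig by (simp add: lborel_distr_plus)
    then show ?thesis by (subst (asm) integrable_distr_eq) auto
  qed
  have ga: "(LINT z|lborel. indicator T (z - a) * g (z - a)) = (LINT z|lborel. indicator T z * g z)"
    using integral_lborel_translate[of "\<lambda>y. indicator T y * g y" "- a"] by simp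
  have ihit: "integrable lborel (hit g i)" if "i \<in> ?P \<union> ?N" for i
    using that g by (intro integral_hit) auto
  have fin: "finite ?P" "finite ?N" using I by auto
  \<comment> \<open>Excluded are the starts of segments whose line meets \<open>bad\<close> and of
    segments with an end point on the frontier.\<close>
  have "negligible (shadow a bad \<union> frontier T \<union> (+) a ` frontier T)"
    using T by (intro negligible_Un negligible_shadow_bad negligible_translation negligible_convex_frontier)
  then have "AE z in lebesgue. z \<notin> shadow a bad \<union> frontier T \<union> (+) a ` frontier T"
    by (intro AE_not_in) (simp add: negligible_iff_null_sets)
  then have ae: "AE z in lborel. z \<notin> shadow a bad \<union> frontier T \<union> (+) a ` frontier T"
    by (simp add: AE_completion_iff)
  have iH: "integrable lborel ?H" by (rule integral_segment[OF D])
  have "(LINT z|lborel. ?H z + indicator T (z - a) * g (z - a) - indicator T z * g z)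
      = (LINT z|lborel. (\<Sum>i\<in>?P. hit g i z) - (\<Sum>i\<in>?N. hit g i z))"
  proof (rule integral_cong_AE)
    show "(\<lambda>z. ?H z + indicator T (z - a) * g (z - a) - indicator T z * g z) \<in> borel_measurable lborel"
      using iH iga ig by (intro borel_measurable_integrable Bochner_Integration.integrable_diff Bochner_Integration.integrable_add)
    show "(\<lambda>z. (\<Sum>i\<in>?P. hit g i z) - (\<Sum>i\<in>?N. hit g i z)) \<in> borel_measurable lborel"
      using ihit by (intro borel_measurable_integrable Bochner_Integration.integrable_diff Bochner_Integration.integrable_sum) auto
    show "AE z in lborel. ?H z + indicator T (z - a) * g (z - a) - indicator T z * g z
        = (\<Sum>i\<in>?P. hit g i z) - (\<Sum>i\<in>?N. hit g i z)"
      using ae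
    proof eventually_elim
      case (elim z)
      have "z - a \<notin> frontier T"
      proof
        assume "z - a \<in> frontier T"
        then have "a + (z - a) \<in> (+) a ` frontier T" by (rule imageI)
        then show False using elim by simp
      qed
      with elim show ?case by (intro segment_hit_balance[OF _ _ _ D deriv]) auto
    qed
  qed
  also have "(LINT z|lborel. ?H z + indicator T (z - a) * g (z - a) - indicator T z * g z) = (LINT z|lborel. ?H z)"
    using iH iga ig ga by simp
  also have "\<dots> = (LINT y|lborel. indicator T y * D y)" by (rule integral_segment[OF D])
  also have "(LINT z|lborel. (\<Sum>i\<in>?P. hit g i z) - (\<Sum>i\<in>?N. hit g i z))
      = (\<Sum>i\<in>?P. LINT z|lborel. hit g i z) - (\<Sum>i\<in>?N. LINT z|lborel. hit g i z)"
    using ihit by (subst Bochner_Integration.integral_diff)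
      (auto intro!: Bochner_Integration.integrable_sum simp: Bochner_Integration.integral_sum)
  also have "(\<Sum>i\<in>?P. LINT z|lborel. hit g i z) = (\<Sum>i\<in>?P. (\<nu> i \<bullet> a) * ?J i)"
    using g by (intro sum.cong) (auto simp: integral_hit)
  \<comment> \<open>Here \<open>\<bar>\<nu> i \<bullet> a\<bar>\<close> is
    \<open>- (\<nu> i \<bullet> a)\<close>, so subtracting this sum gives it the same form as the
    first; pieces parallel to \<open>a\<close> then enter with factor 0.\<close>
  also have "(\<Sum>i\<in>?N. LINT z|lborel. hit g i z) = (\<Sum>i\<in>?N. - ((\<nu> i \<bullet> a) * ?J i))"
    using g by (intro sum.cong) (auto simp: integral_hit)
  also have "(\<Sum>i\<in>?P. (\<nu> i \<bullet> a) * ?J i) - (\<Sum>i\<in>?N. - ((\<nu> i \<bullet> a) * ?J i)) = (\<Sum>i\<in>?P \<union> ?N. (\<nu> i \<bullet> a) * ?J i)"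
    using fin by (subst sum.union_disjoint) (auto simp: sum_negf)
  also have "\<dots> = (\<Sum>i\<in>I. (\<nu> i \<bullet> a) * ?J i)"
    using I by (intro sum.mono_neutral_left) auto
  finally show ?thesis .
qed

end

section \<open>Tiles, faces and traces of a periodic mesh\<close>

lemma set_integral_spike:
  fixes f g :: "'a::euclidean_space \<Rightarrow> real"
  assumes "set_integrable lebesgue S f" "negligible N" "\<And>x. x \<in> S - N \<Longrightarrow> g x = f x"
  shows "set_integrable lebesgue S g" "(LINT x:S|lebesgue. g x) = (LINT x:S|lebesgue. f x)"
proof -
  show g: "set_integrable lebesgue S g" using assms by (rule absolutely_integrable_spike)
  have "integral S g = integral S f"
    using assms(2) by (rule integral_spike) (use assms(3) in auto)
  then show "(LINT x:S|lebesgue. g x) = (LINT x:S|lebesgue. f x)"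
    using assms(1) g by (simp add: set_lebesgue_integral_eq_integral)
qed

locale pmesh =
  fixes M :: "'d::finite mesh"
  assumes mesh: "periodic_mesh M"
begin

abbreviation tile :: "real ^ 'd \<Rightarrow> (real ^ 'd) set \<Rightarrow> (real ^ 'd) set" where
  "tile z T \<equiv> (+) z ` T"

section \<open>Periods and the periodic tiling of space\<close>

definition len :: "'d \<Rightarrow> real" where "len i = mhi M $ i - mlo M $ i"

lemma len_pos: "len i > 0"
  using mesh by (simp add: periodic_mesh_def len_def)

lemma finite_melems: "finite (melems M)"
  using mesh by (simp add: periodic_mesh_def)

lemma Union_melems: "\<Union> (melems M) = mdom M"
  using mesh by (simp add: periodic_mesh_def)

lemma melems:
  assumes "T \<in> melems M"
  shows "polytope T" "interior T \<noteq> {}" "compact T" "convex T" "closed T" "T \<subseteq> mdom M"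
proof -
  show p: "polytope T" "interior T \<noteq> {}"
    using mesh assms by (simp_all add: periodic_mesh_def)
  show "T \<subseteq> mdom M" using assms Union_melems by blast
  show "compact T" using p(1) by (rule polytope_imp_compact)
  show "convex T" using p(1) by (rule polytope_imp_convex)
  show "closed T" using p(1) by (rule polytope_imp_closed)
qed

lemma interior_melems_disjoint:
  "T \<in> melems M \<Longrightarrow> T' \<in> melems M \<Longrightarrow> x \<in> interior T \<Longrightarrow> x \<in> interior T' \<Longrightarrow> T = T'"
proof (rule ccontr)
  assume T: "T \<in> melems M" "T' \<in> melems M" "x \<in> interior T" "x \<in> interior T'" "T \<noteq> T'"
  have "pairwise (\<lambda>T T'. interior T \<inter> interior T' = {}) (melems M)"
    using mesh by (simp add: periodic_mesh_def)
  then have "interior T \<inter> interior T' = {}" using T by (auto dest: pairwiseD)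
  then show False using T by blast
qed

lemma mem_periods: "z \<in> periods M \<longleftrightarrow> (\<forall>i. \<exists>k::int. z $ i = of_int k * len i)"
  by (simp add: periods_def len_def)

lemma zero_periods: "0 \<in> periods M"
  unfolding mem_periods by (auto intro!: exI[of _ 0])

lemma periods_add: "z \<in> periods M \<Longrightarrow> w \<in> periods M \<Longrightarrow> z + w \<in> periods M"
  unfolding mem_periods
proof
  fix i assume "\<forall>i. \<exists>k::int. z $ i = of_int k * len i" "\<forall>i. \<exists>k::int. w $ i = of_int k * len i"
  then obtain k k' :: int where "z $ i = of_int k * len i" "w $ i = of_int k' * len i" by meson
  then show "\<exists>k::int. (z + w) $ i = of_int k * len i"
    by (intro exI[of _ "k + k'"]) (simp add: distrib_right)
qed

lemma periods_uminus: "z \<in> periods M \<Longrightarrow> - z \<in> periods M"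
  unfolding mem_periods
proof
  fix i assume "\<forall>i. \<exists>k::int. z $ i = of_int k * len i"
  then obtain k :: int where "z $ i = of_int k * len i" by meson
  then show "\<exists>k::int. (- z) $ i = of_int k * len i" by (intro exI[of _ "- k"]) simp
qed

lemma periods_diff: "z \<in> periods M \<Longrightarrow> w \<in> periods M \<Longrightarrow> z - w \<in> periods M"
  using periods_add[of z "- w"] periods_uminus[of w] by simp

lemma mem_mdom: "x \<in> mdom M \<longleftrightarrow> (\<forall>i. mlo M $ i \<le> x $ i \<and> x $ i \<le> mhi M $ i)"
  by (simp add: mdom_def mem_box_cart)

lemma interior_melem_box:
  assumes "T \<in> melems M" "x \<in> interior T"
  shows "mlo M $ i < x $ i" "x $ i < mhi M $ i"
proof -
  have "x \<in> interior (mdom M)" using interior_mono[OF melems(6)[OF assms(1)]] assms(2) by blast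
  then show "mlo M $ i < x $ i" "x $ i < mhi M $ i"
    by (auto simp: mdom_def interior_cbox mem_box_cart)
qed

text \<open>Interior points lie strictly below the upper corner in every coordinate, so the floor
  returns exactly the multiple of the period. On the upper sides of the box \<open>wrap\<close>
  would jump to the lower ones.\<close>

lemma wrap_interior:
  assumes "T \<in> melems M" "x \<in> interior T" "z \<in> periods M"
  shows "wrap M (z + x) = x"
proof -
  have "of_int \<lfloor>((z + x) $ i - mlo M $ i) / len i\<rfloor> * len i = z $ i" for i
  proof -
    obtain k :: int where k: "z $ i = of_int k * len i" using assms(3) mem_periods by blast
    have "((z + x) $ i - mlo M $ i) / len i = of_int k + (x $ i - mlo M $ i) / len i"
      using k len_pos[of i] by (simp add: field_simps)
    moreover have "0 \<le> (x $ i - mlo M $ i) / len i" "(x $ i - mlo M $ i) / len i < 1"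
      using interior_melem_box[OF assms(1,2), of i] len_pos[of i] by (auto simp: field_simps len_def)
    ultimately have "\<lfloor>((z + x) $ i - mlo M $ i) / len i\<rfloor> = k" by linarith
    then show ?thesis using k by simp
  qed
  then show ?thesis by (simp add: wrap_def vec_eq_iff len_def)
qed

lemma tiles_cover:
  obtains z T where "z \<in> periods M" "T \<in> melems M" "x \<in> tile z T"
proof -
  define k where "k i = \<lfloor>(x $ i - mlo M $ i) / len i\<rfloor>" for i
  define z where "z = (\<chi> i. of_int (k i) * len i)"
  have "z \<in> periods M" by (auto simp: mem_periods z_def)
  moreover have "x - z \<in> mdom M"
    unfolding mem_mdom
  proof (intro allI)
    fix i
    have "of_int (k i) \<le> (x $ i - mlo M $ i) / len i" "(x $ i - mlo M $ i) / len i \<le> of_int (k i) + 1"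
      unfolding k_def by linarith+
    then show "mlo M $ i \<le> (x - z) $ i \<and> (x - z) $ i \<le> mhi M $ i"
      using len_pos[of i] by (simp add: z_def field_simps) (simp add: len_def algebra_simps)
  qed
  then obtain T where "T \<in> melems M" "x - z \<in> T" using Union_melems by blast
  moreover have "x = z + (x - z)" by simp
  ultimately show thesis using that by blast
qed

text \<open>Wrapping \<open>x\<close> recovers its position inside either element, so the two
  positions agree, and distinct elements have disjoint interiors.\<close>

lemma tile_eqI:
  assumes "z \<in> periods M" "z' \<in> periods M" "T \<in> melems M" "T' \<in> melems M"
    and "x \<in> interior (tile z T)" "x \<in> interior (tile z' T')"
  shows "z = z' \<and> T = T'"
proof -
  obtain u u' where u: "u \<in> interior T" "x = z + u" "u' \<in> interior T'" "x = z' + u'"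
    using assms(5,6) by (auto simp: interior_translation)
  have "wrap M (z + u) = u" using assms u by (intro wrap_interior[of T]) auto
  moreover have "wrap M (z' + u') = u'" using assms u by (intro wrap_interior[of T']) auto
  ultimately have "u = u'" using u by simp
  then show ?thesis using u assms interior_melems_disjoint by auto
qed

lemma finite_periods_bounded: "finite {z \<in> periods M. \<forall>i. \<bar>z $ i\<bar> \<le> c * len i}"
proof -
  let ?K = "{- \<lceil>c\<rceil>..\<lceil>c\<rceil>}"
  have "{z \<in> periods M. \<forall>i. \<bar>z $ i\<bar> \<le> c * len i} \<subseteq> (\<lambda>k. \<chi> i. of_int (k i) * len i) ` (PiE UNIV (\<lambda>_. ?K))"
  proof
    fix z assume z: "z \<in> {z \<in> periods M. \<forall>i. \<bar>z $ i\<bar> \<le> c * len i}"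
    then obtain k :: "'d \<Rightarrow> int" where k: "\<And>i. z $ i = of_int (k i) * len i"
      unfolding mem_Collect_eq mem_periods by metis
    have "\<bar>of_int (k i)\<bar> \<le> c" for i
    proof -
      have "\<bar>of_int (k i)\<bar> * len i \<le> c * len i" using z len_pos[of i] by (simp add: k abs_mult abs_of_pos[OF len_pos])
      then show ?thesis using len_pos[of i] by simp
    qed
    then have "k i \<in> ?K" for i
    proof -
      assume *: "\<And>i. \<bar>of_int (k i)\<bar> \<le> c"
      show ?thesis using *[of i] by simp linarith
    qed
    then show "z \<in> (\<lambda>k. \<chi> i. of_int (k i) * len i) ` (PiE UNIV (\<lambda>_. ?K))"
      by (intro image_eqI[of _ _ k]) (auto simp: vec_eq_iff k)
  qed
  then show ?thesis by (rule finite_subset) (auto intro!: finite_PiE)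
qed

text \<open>One period length accounts for the difference of two points of the box and one for the
  displacement \<open>h\<close>; hence the factor 2.\<close>

lemma period_bound_of_meet:
  assumes "x \<in> mdom M" "x + h \<in> tile z T" "T \<in> melems M" "\<And>i. \<bar>h $ i\<bar> \<le> len i"
  shows "\<bar>z $ i\<bar> \<le> 2 * len i"
proof -
  obtain u where "u \<in> mdom M" "x + h = z + u" using assms melems(6) by blast
  then have "z $ i = x $ i + h $ i - u $ i"
    by (metis add_diff_cancel_right' vector_add_component)
  then show ?thesis
    using assms(1) \<open>u \<in> mdom M\<close> assms(4)[of i] unfolding mem_mdom
    by (smt (verit, best) len_def)
qed

section \<open>Faces and the two tiles beside them\<close>

lemma face_interface: "e \<in> mfaces M \<Longrightarrow> interface M e"
  using mesh by (simp add: periodic_mesh_def)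

text \<open>An interface is determined by two elements and a period, and a tile that touches the box
  has a bounded period.\<close>

lemma finite_mfaces: "finite (mfaces M)"
proof -
  let ?Z = "{z \<in> periods M. \<forall>i. \<bar>z $ i\<bar> \<le> 2 * len i}"
  have "mfaces M \<subseteq> (\<lambda>(T, T', z). T \<inter> tile z T') ` (melems M \<times> melems M \<times> ?Z)"
  proof
    fix e assume "e \<in> mfaces M"
    then have "interface M e" by (rule face_interface)
    then obtain T T' z where e: "T \<in> melems M" "T' \<in> melems M" "z \<in> periods M" "e = T \<inter> tile z T'"
        "aff_dim e = int CARD('d) - 1"
      unfolding interface_def by meson
    have "e \<noteq> {}" using e(5) by auto
    then obtain x where x: "x \<in> T" "x + 0 \<in> tile z T'" using e(4) by auto
    then have "x \<in> mdom M" using melems(6) e(1) by blast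
    then have "\<bar>z $ i\<bar> \<le> 2 * len i" for i
      by (rule period_bound_of_meet[OF _ x(2) e(2)]) (simp add: len_pos less_imp_le)
    then show "e \<in> (\<lambda>(T, T', z). T \<inter> tile z T') ` (melems M \<times> melems M \<times> ?Z)"
      using e by (intro image_eqI[of _ _ "(T, T', z)"]) auto
  qed
  then show ?thesis
    using finite_melems finite_periods_bounded by (auto intro: finite_subset)
qed

lemma norm_mnormal: "e \<in> mfaces M \<Longrightarrow> norm (mnormal M e) = 1"
  using mesh by (simp add: periodic_mesh_def)

lemma tile_facts:
  assumes "T \<in> melems M"
  shows "polytope (tile z T)" "convex (tile z T)" "closed (tile z T)" "interior (tile z T) \<noteq> {}"
    "tile z T = closure (interior (tile z T))"
proof -
  show p: "polytope (tile z T)" using melems(1)[OF assms] by (simp add: polytope_translation_eq)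
  show c: "convex (tile z T)" "closed (tile z T)"
    using polytope_imp_convex[OF p] polytope_imp_closed[OF p] .
  show i: "interior (tile z T) \<noteq> {}" using melems(2)[OF assms] by (simp add: interior_translation)
  show "tile z T = closure (interior (tile z T))"
    using c i by (simp add: convex_closure_interior closure_closed)
qed

text \<open>An intersection of full dimension would have an interior point common to both
  tiles.\<close>

lemma aff_dim_tiles_le:
  assumes "z \<in> periods M" "z' \<in> periods M" "T \<in> melems M" "T' \<in> melems M" "(z, T) \<noteq> (z', T')"
  shows "aff_dim (tile z T \<inter> tile z' T') \<le> int CARD('d) - 1"
proof (rule ccontr)
  let ?F = "tile z T \<inter> tile z' T'"
  assume "\<not> ?thesis"
  then have d: "aff_dim ?F = int DIM(real ^ 'd)" using aff_dim_le_DIM[of ?F] by simp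
  then have "interior ?F = rel_interior ?F" by (simp add: interior_rel_interior)
  moreover have "convex ?F" using assms tile_facts(2) by (intro convex_Int) auto
  moreover have "?F \<noteq> {}" using d by auto
  ultimately have "interior ?F \<noteq> {}" by (simp add: rel_interior_eq_empty)
  then show False using tile_eqI[OF assms(1-4)] assms(5) by (auto simp: interior_Int)
qed

text \<open>In \<open>interface\<close> one of the two tiles is untranslated, but it is the normal
  that decides which tile is on the minus side; so both tiles carry a period here.\<close>

definition sides :: "(real ^ 'd) set \<Rightarrow> real ^ 'd \<Rightarrow> (real ^ 'd) set \<Rightarrow> real ^ 'd \<Rightarrow> (real ^ 'd) set \<Rightarrow> real \<Rightarrow> bool" where
  "sides e zm Tm zp Tp b \<longleftrightarrow> zm \<in> periods M \<and> zp \<in> periods M \<and> Tm \<in> melems M \<and> Tp \<in> melems M \<and>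
     (zm, Tm) \<noteq> (zp, Tp) \<and> e = tile zm Tm \<inter> tile zp Tp \<and>
     (\<forall>x\<in>tile zm Tm. mnormal M e \<bullet> x \<le> b) \<and> (\<forall>x\<in>tile zp Tp. mnormal M e \<bullet> x \<ge> b)"

lemma aff_dim_face: "e \<in> mfaces M \<Longrightarrow> aff_dim e = int CARD('d) - 1"
  using face_interface[of e] by (simp add: interface_def)

text \<open>The two tiles of an interface are separated by a hyperplane, which contains
  \<open>e\<close>. As \<open>e\<close> spans a hyperplane, the separating normal is a multiple
  \<open>\<kappa>\<close> of the prescribed one, and the sign of \<open>\<kappa>\<close> tells which
  tile is behind.\<close>

lemma exists_sides:
  assumes e: "e \<in> mfaces M"
  obtains zm Tm zp Tp b where "sides e zm Tm zp Tp b"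
proof -
  let ?n = "mnormal M e"
  obtain T T' z where T: "T \<in> melems M" "T' \<in> melems M" and z: "z \<in> periods M" and eq: "e = tile 0 T \<inter> tile z T'"
    using face_interface[OF e] unfolding interface_def by auto
  \<comment> \<open>An element meets itself without a shift in full dimension, which is too large
    for a face.\<close>
  have ne: "(0, T) \<noteq> (z, T')"
  proof
    assume "(0, T) = (z, T')"
    then have "e = T" using eq by simp
    then have "aff_dim e = int CARD('d)" using melems(2)[OF T(1)] by (simp add: aff_dim_nonempty_interior)
    then show False using aff_dim_face[OF e] by simp
  qed
  let ?A = "tile 0 T" and ?B = "tile z T'"
  have "interior ?A \<inter> interior ?B = {}"
    using tile_eqI[OF zero_periods z T] ne by blast
  moreover have "convex (interior ?A)" "convex (interior ?B)"
    using tile_facts(2) T by (auto simp del: image_add_0 intro!: convex_interior)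
  moreover have "interior ?A \<noteq> {}" "interior ?B \<noteq> {}" using tile_facts(4) T by blast+
  ultimately obtain a c where a: "a \<noteq> 0" "\<forall>x\<in>interior ?A. a \<bullet> x \<le> c" "\<forall>x\<in>interior ?B. a \<bullet> x \<ge> c"
    using separating_hyperplane_sets by metis
  have closed_side: "v \<bullet> x \<le> k" if "\<forall>x\<in>interior (tile w S). v \<bullet> x \<le> k" "S \<in> melems M" "x \<in> tile w S" for v x k w S
  proof -
    have "closure (interior (tile w S)) \<subseteq> {x. v \<bullet> x \<le> k}"
      using that(1) by (intro closure_minimal closed_halfspace_le) auto
    then show ?thesis using that(3) tile_facts(5)[OF that(2)] by blast
  qed
  have A: "a \<bullet> x \<le> c" if "x \<in> ?A" for x using closed_side[OF a(2) T(1) that] .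
  have B: "a \<bullet> x \<ge> c" if "x \<in> ?B" for x using closed_side[of z T' "- a" "- c", OF _ T(2) that] a(3) by simp
  have "e \<noteq> {}" using aff_dim_face[OF e] by auto
  then obtain y where y: "y \<in> e" by blast
  define b where "b = ?n \<bullet> y"
  have nz: "?n \<noteq> 0" using norm_mnormal[OF e] by auto
  have "\<forall>x\<in>e. ?n \<bullet> (x - y) = 0" using mesh e y by (auto simp: periodic_mesh_def)
  then have nb: "e \<subseteq> {x. ?n \<bullet> x = b}" by (auto simp: b_def inner_diff_right)
  have ac: "e \<subseteq> {x. a \<bullet> x = c}" using A B eq by force
  have hull: "affine hull e = {x. v \<bullet> x = k}" if "v \<noteq> 0" "e \<subseteq> {x. v \<bullet> x = k}" for v k
  proof (rule affine_dim_equal)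
    show "affine hull e \<noteq> {}" using y hull_inc by fastforce
    show "affine hull e \<subseteq> {x. v \<bullet> x = k}" using that by (intro hull_minimal affine_hyperplane)
  qed (use that aff_dim_face[OF e] in \<open>auto simp: affine_hyperplane aff_dim_affine_hull\<close>)
  have same: "?n \<bullet> x = b \<longleftrightarrow> a \<bullet> x = c" for x
    using hull[OF nz nb] hull[OF a(1) ac] by blast
  define \<kappa> where "\<kappa> = a \<bullet> ?n"
  have nn: "?n \<bullet> ?n = 1" using norm_mnormal[OF e] by (simp add: dot_square_norm)
  \<comment> \<open>The vector \<open>a - \<kappa> *\<^sub>R ?n\<close> is the part of
    \<open>a\<close> along the hyperplane; being orthogonal to both \<open>a\<close> and
    \<open>?n\<close>, it is orthogonal to itself.\<close>
  have "?n \<bullet> (y + (a - \<kappa> *\<^sub>R ?n)) = b"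
    using nn by (simp add: b_def inner_add_right inner_diff_right \<kappa>_def inner_commute)
  then have "a \<bullet> (y + (a - \<kappa> *\<^sub>R ?n)) = c" using same by blast
  moreover have "a \<bullet> y = c" using ac y by auto
  ultimately have "a \<bullet> (a - \<kappa> *\<^sub>R ?n) = 0" by (simp add: inner_add_right)
  moreover have "?n \<bullet> (a - \<kappa> *\<^sub>R ?n) = 0" using nn by (simp add: inner_diff_right \<kappa>_def inner_commute)
  ultimately have "(a - \<kappa> *\<^sub>R ?n) \<bullet> (a - \<kappa> *\<^sub>R ?n) = 0" by (simp only: inner_diff_left inner_scaleR_left)
  then have a\<kappa>: "a = \<kappa> *\<^sub>R ?n" by simp
  then have \<kappa>0: "\<kappa> \<noteq> 0" using a(1) by auto
  have c\<kappa>: "c = \<kappa> * b" using \<open>a \<bullet> y = c\<close> a\<kappa> by (metis b_def inner_scaleR_left)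
  have ax: "a \<bullet> x = \<kappa> * (?n \<bullet> x)" for x by (subst a\<kappa>) simp
  show thesis
  proof (cases "\<kappa> > 0")
    case True
    then have "\<forall>x\<in>?A. ?n \<bullet> x \<le> b" "\<forall>x\<in>?B. ?n \<bullet> x \<ge> b"
      using A B unfolding ax c\<kappa> by (auto simp del: image_add_0)
    then show thesis using that[of 0 T z T' b] T z zero_periods ne eq unfolding sides_def by blast
  next
    case False
    then have "\<kappa> < 0" using \<kappa>0 by simp
    then have "\<forall>x\<in>?A. ?n \<bullet> x \<ge> b" "\<forall>x\<in>?B. ?n \<bullet> x \<le> b"
      using A B unfolding ax c\<kappa> by (auto simp del: image_add_0)
    then show thesis using that[of z T' 0 T b] T z zero_periods ne eq unfolding sides_def by blast
  qed
qed

lemma sides_hyperplane: "sides e zm Tm zp Tp b \<Longrightarrow> e \<subseteq> {x. mnormal M e \<bullet> x = b}"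
proof
  fix x assume s: "sides e zm Tm zp Tp b" and "x \<in> e"
  then have "x \<in> tile zm Tm" "x \<in> tile zp Tp" by (simp_all add: sides_def)
  then have "mnormal M e \<bullet> x \<le> b" "mnormal M e \<bullet> x \<ge> b"
    using s unfolding sides_def by blast+
  then show "x \<in> {x. mnormal M e \<bullet> x = b}" by simp
qed

lemma face_facts:
  assumes "e \<in> mfaces M"
  shows "polytope e" "compact e" "convex e" "e \<noteq> {}"
proof -
  obtain zm Tm zp Tp b where "sides e zm Tm zp Tp b" using exists_sides[OF assms] .
  then show p: "polytope e" using tile_facts(1) by (auto simp: sides_def intro!: polytope_Int)
  then show "compact e" "convex e" by (auto simp: polytope_imp_compact polytope_imp_convex)
  show "e \<noteq> {}" using aff_dim_face[OF assms] by auto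
qed

lemma sides_interior_less:
  assumes e: "e \<in> mfaces M" and s: "sides e zm Tm zp Tp b"
  shows "x \<in> interior (tile zm Tm) \<Longrightarrow> mnormal M e \<bullet> x < b" "x \<in> interior (tile zp Tp) \<Longrightarrow> mnormal M e \<bullet> x > b"
proof -
  have n: "mnormal M e \<noteq> 0" using norm_mnormal[OF e] by auto
  have "interior (tile zm Tm) \<subseteq> interior {x. mnormal M e \<bullet> x \<le> b}"
    using s by (intro interior_mono) (auto simp: sides_def)
  then show "x \<in> interior (tile zm Tm) \<Longrightarrow> mnormal M e \<bullet> x < b" using n by (auto simp: interior_halfspace_le)
  have "interior (tile zp Tp) \<subseteq> interior {x. mnormal M e \<bullet> x \<ge> b}"
    using s by (intro interior_mono) (auto simp: sides_def)
  then show "x \<in> interior (tile zp Tp) \<Longrightarrow> mnormal M e \<bullet> x > b" using n by (auto simp: interior_halfspace_ge)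
qed

lemma eventually_sides:
  assumes e: "e \<in> mfaces M" and s: "sides e zm Tm zp Tp b" and y: "y \<in> rel_interior e"
  shows "\<forall>\<^sub>F w in nhds y. mnormal M e \<bullet> w < b \<longrightarrow> w \<in> interior (tile zm Tm)"
    and "\<forall>\<^sub>F w in nhds y. mnormal M e \<bullet> w > b \<longrightarrow> w \<in> interior (tile zp Tp)"
proof -
  have n: "mnormal M e \<noteq> 0" using norm_mnormal[OF e] by auto
  have T: "Tm \<in> melems M" "Tp \<in> melems M" and es: "e \<subseteq> tile zm Tm" "e \<subseteq> tile zp Tp"
    using s unfolding sides_def by blast+
  have h: "e \<subseteq> {x. mnormal M e \<bullet> x = b}" using sides_hyperplane[OF s] .
  obtain w where w: "w \<in> interior (tile zm Tm)" using tile_facts(4)[OF T(1)] by blast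
  show "\<forall>\<^sub>F w in nhds y. mnormal M e \<bullet> w < b \<longrightarrow> w \<in> interior (tile zm Tm)"
    using tile_facts(2)[OF T(1)] es(1) h aff_dim_face[OF e] n w sides_interior_less(1)[OF e s w] y
    by (intro eventually_interior_beside_flat_face[where e = e]) auto
  obtain w where w: "w \<in> interior (tile zp Tp)" using tile_facts(4)[OF T(2)] by blast
  have "\<forall>\<^sub>F w in nhds y. (- mnormal M e) \<bullet> w < - b \<longrightarrow> w \<in> interior (tile zp Tp)"
    using tile_facts(2)[OF T(2)] es(2) h aff_dim_face[OF e] n w sides_interior_less(2)[OF e s w] y
    by (intro eventually_interior_beside_flat_face[where e = e]) auto
  then show "\<forall>\<^sub>F w in nhds y. mnormal M e \<bullet> w > b \<longrightarrow> w \<in> interior (tile zp Tp)" by simp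
qed

text \<open>A tile through \<open>y\<close> has interior points arbitrarily close to
  \<open>y\<close> and off the hyperplane of the face, and these belong to one of the two adjacent
  tiles. So a third tile can touch a face only on its relative boundary.\<close>

lemma tile_at_face:
  assumes e: "e \<in> mfaces M" and s: "sides e zm Tm zp Tp b" and y: "y \<in> rel_interior e"
    and z: "z \<in> periods M" and T: "T \<in> melems M" and "y \<in> tile z T"
  shows "(z, T) = (zm, Tm) \<or> (z, T) = (zp, Tp)"
proof -
  have n: "mnormal M e \<noteq> 0" using norm_mnormal[OF e] by auto
  from eventually_conj[OF eventually_sides[OF e s y]]
  obtain S where S: "open S" "y \<in> S"
    "\<And>w. w \<in> S \<Longrightarrow> (mnormal M e \<bullet> w < b \<longrightarrow> w \<in> interior (tile zm Tm)) \<and> (mnormal M e \<bullet> w > b \<longrightarrow> w \<in> interior (tile zp Tp))"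
    unfolding eventually_nhds by auto
  have "y \<in> closure (interior (tile z T))" using tile_facts(5)[OF T] \<open>y \<in> tile z T\<close> by blast
  then have "S \<inter> interior (tile z T) \<noteq> {}" using S open_Int_closure_eq_empty by blast
  moreover have "open (S \<inter> interior (tile z T))" using S by auto
  moreover have "interior {x. mnormal M e \<bullet> x = b} = {}" using n by simp
  ultimately have "\<not> S \<inter> interior (tile z T) \<subseteq> {x. mnormal M e \<bullet> x = b}"
    using interior_maximal[of "S \<inter> interior (tile z T)" "{x. mnormal M e \<bullet> x = b}"] by blast
  then obtain w where w: "w \<in> S" "w \<in> interior (tile z T)" "mnormal M e \<bullet> w \<noteq> b" by blast
  then consider "w \<in> interior (tile zm Tm)" | "w \<in> interior (tile zp Tp)"
    using S(3)[OF w(1)] by linarith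
  then show ?thesis
    using tile_eqI[OF z _ T _ w(2)] s unfolding sides_def by cases blast+
qed

section \<open>Traces at relative interior points of a face\<close>

lemma Lim_wrap:
  fixes G g :: "real ^ 'd \<Rightarrow> 'b::real_normed_vector"
  assumes "z \<in> periods M" "T \<in> melems M" and G: "\<And>w. w \<in> interior T \<Longrightarrow> G w = g w" "continuous_on UNIV g"
    and ev: "\<forall>\<^sub>F \<epsilon> in at_right 0. y + \<epsilon> *\<^sub>R d \<in> interior (tile z T)"
  shows "Lim (at_right 0) (\<lambda>\<epsilon>. G (wrap M (y + \<epsilon> *\<^sub>R d))) = g (y - z)"
proof -
  have "\<forall>\<^sub>F \<epsilon> in at_right 0. g (y + \<epsilon> *\<^sub>R d - z) = G (wrap M (y + \<epsilon> *\<^sub>R d))"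
    using ev
  proof eventually_elim
    case (elim \<epsilon>)
    then obtain x where x: "x \<in> interior T" "y + \<epsilon> *\<^sub>R d = z + x" by (auto simp: interior_translation)
    then show ?case using wrap_interior[OF assms(2) x(1) assms(1)] G by simp
  qed
  moreover have "((\<lambda>\<epsilon>. g (y + \<epsilon> *\<^sub>R d - z)) \<longlongrightarrow> g (y + 0 *\<^sub>R d - z)) (at_right 0)"
    by (intro continuous_on_tendsto_compose[OF G(2)] tendsto_intros) auto
  ultimately have "((\<lambda>\<epsilon>. G (wrap M (y + \<epsilon> *\<^sub>R d))) \<longlongrightarrow> g (y - z)) (at_right 0)"
    using Lim_transform_eventually by fastforce
  then show ?thesis by (intro tendsto_Lim) auto
qed

lemma eventually_beside:
  fixes y d :: "real ^ 'd"
  assumes "\<forall>\<^sub>F w in nhds y. P w"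
  shows "\<forall>\<^sub>F \<epsilon> in at_right (0::real). P (y + \<epsilon> *\<^sub>R d) \<and> 0 < \<epsilon>"
proof (rule eventually_conj[OF _ eventually_at_right_less])
  have "((\<lambda>\<epsilon>. y + \<epsilon> *\<^sub>R d) \<longlongrightarrow> y + 0 *\<^sub>R d) (at_right 0)" by (intro tendsto_intros)
  then show "\<forall>\<^sub>F \<epsilon> in at_right 0. P (y + \<epsilon> *\<^sub>R d)"
    using eventually_compose_filterlim[OF assms] by simp
qed

text \<open>Near \<open>y\<close> the normal ray stays in one tile, and \<open>wrap\<close> carries
  this tile back to its element; hence the arguments \<open>y - zm\<close> and
  \<open>y - zp\<close>.\<close>

lemma traces_eq:
  fixes G gm gp :: "real ^ 'd \<Rightarrow> 'b::real_normed_vector"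
  assumes e: "e \<in> mfaces M" and s: "sides e zm Tm zp Tp b" and y: "y \<in> rel_interior e"
  shows "(\<And>w. w \<in> interior Tm \<Longrightarrow> G w = gm w) \<Longrightarrow> continuous_on UNIV gm \<Longrightarrow> trace_minus M e G y = gm (y - zm)"
    and "(\<And>w. w \<in> interior Tp \<Longrightarrow> G w = gp w) \<Longrightarrow> continuous_on UNIV gp \<Longrightarrow> trace_plus M e G y = gp (y - zp)"
proof -
  let ?n = "mnormal M e"
  have nn: "?n \<bullet> ?n = 1" using norm_mnormal[OF e] by (simp add: dot_square_norm)
  have yb: "?n \<bullet> y = b" using sides_hyperplane[OF s] y rel_interior_subset by blast
  have S: "zm \<in> periods M" "zp \<in> periods M" "Tm \<in> melems M" "Tp \<in> melems M"
    using s unfolding sides_def by simp_all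
  have m: "\<forall>\<^sub>F \<epsilon> in at_right 0. y + \<epsilon> *\<^sub>R (- ?n) \<in> interior (tile zm Tm)"
    using eventually_beside[OF eventually_sides(1)[OF e s y], of "- ?n"]
    by eventually_elim (simp add: yb nn inner_diff_right)
  have p: "\<forall>\<^sub>F \<epsilon> in at_right 0. y + \<epsilon> *\<^sub>R ?n \<in> interior (tile zp Tp)"
    using eventually_beside[OF eventually_sides(2)[OF e s y], of ?n]
    by eventually_elim (simp add: yb nn inner_add_right)
  show "trace_minus M e G y = gm (y - zm)"
    if "\<And>w. w \<in> interior Tm \<Longrightarrow> G w = gm w" "continuous_on UNIV gm"
    using Lim_wrap[OF S(1,3) that m] unfolding trace_minus_def by simp
  show "trace_plus M e G y = gp (y - zp)"
    if "\<And>w. w \<in> interior Tp \<Longrightarrow> G w = gp w" "continuous_on UNIV gp"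
    using Lim_wrap[OF S(2,4) that p] unfolding trace_plus_def .
qed

end

section \<open>Surface integrals and the faces of one element\<close>

text \<open>The relative boundary of a polytope is the finite union of its facets, which have
  codimension at least two here.\<close>

lemma negligible_shadow_rel_frontier:
  fixes F :: "'a::euclidean_space set"
  assumes "polytope F" "aff_dim F \<le> int DIM('a) - 1"
  shows "negligible (shadow a (F - rel_interior F))"
proof -
  have "F - rel_interior F = (\<Union>G\<in>{G. G facet_of F}. G)"
    using rel_boundary_of_polyhedron[OF polytope_imp_polyhedron[OF assms(1)]] by simp
  moreover have "negligible (shadow a G)" if "G facet_of F" for G
    using that assms(2) by (intro negligible_shadow_codim2) (auto simp: facet_of_def)
  then have "negligible (\<Union>G\<in>{G. G facet_of F}. shadow a G)"
    using finite_polytope_facets[OF assms(1)] by (intro negligible_Union) auto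
  ultimately show ?thesis by (simp only: shadow_UN)
qed

text \<open>At a maximiser of \<open>w \<bullet> x\<close> over \<open>e\<close> the translation
  would raise the value by \<open>w \<bullet> w\<close>.\<close>

lemma translate_compact_eq_self:
  fixes e :: "'a::euclidean_space set"
  assumes "compact e" "e \<noteq> {}" "(+) w ` e = e"
  shows "w = 0"
proof -
  obtain x where x: "x \<in> e" "\<And>y. y \<in> e \<Longrightarrow> w \<bullet> y \<le> w \<bullet> x"
    using continuous_attains_sup[OF assms(1,2), of "\<lambda>x. w \<bullet> x"]
      continuous_on_inner[OF continuous_on_const continuous_on_id] by blast
  have "w + x \<in> e" using assms(3) x(1) by blast
  then have "w \<bullet> (w + x) \<le> w \<bullet> x" by (rule x(2))
  then have "w \<bullet> w \<le> 0" by (simp add: inner_add_right)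
  then show ?thesis by (metis inner_gt_zero_iff not_le)
qed

text \<open>The upright prism on the other side of the hyperplane is the oblique prism with edge
  \<open>- n\<close>, whose factor is 1.\<close>

lemma plane_integral_uminus:
  fixes h :: "'a::euclidean_space \<Rightarrow> real"
  assumes "norm n = 1" "compact e" "continuous_on UNIV h"
  shows "plane_integral (- n) (- b) e h = plane_integral n b e h"
proof -
  have "e \<in> sets borel" using assms(2) by (simp add: borel_compact)
  then have G: "(\<lambda>z. indicator e z * h z) \<in> borel_measurable borel"
    using assms(3) by (intro borel_measurable_times borel_measurable_indicator borel_measurable_continuous_onI) auto
  have nn: "n \<bullet> n = 1" using assms(1) by (simp add: dot_square_norm)
  have "n \<bullet> (- n) \<noteq> 0" using nn by simp
  from integral_oblique_prism[OF assms(1) this G, of b] show ?thesis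
    unfolding plane_integral_def by (simp add: nn minus_diff_commute)
qed

lemma plane_integral_translate:
  fixes h :: "'a::euclidean_space \<Rightarrow> real"
  assumes "compact e" "continuous_on UNIV h"
  shows "plane_integral n (b - n \<bullet> c) ((+) (- c) ` e) h = plane_integral n b e (\<lambda>y. h (y - c))"
proof -
  let ?f = "\<lambda>z. indicator {0..1} (n \<bullet> z - b) *
     (indicator e (z - (n \<bullet> z - b) *\<^sub>R n) * h (z - (n \<bullet> z - b) *\<^sub>R n - c))"
  have [measurable]: "e \<in> sets borel" using assms(1) by (simp add: borel_compact)
  have [measurable]: "h \<in> borel_measurable borel" using assms(2) by (rule borel_measurable_continuous_onI)
  have "plane_integral n b e (\<lambda>y. h (y - c)) = (LINT z|lborel. ?f (c + z))"
    unfolding plane_integral_def by (rule integral_lborel_translate[symmetric]) measurable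
  also have "\<dots> = plane_integral n (b - n \<bullet> c) ((+) (- c) ` e) h"
    unfolding plane_integral_def
  proof (rule Bochner_Integration.integral_cong)
    fix z
    have "n \<bullet> (c + z) - b = n \<bullet> z - (b - n \<bullet> c)" by (simp add: inner_add_right)
    moreover have "indicator e (c + z - t *\<^sub>R n) = (indicator ((+) (- c) ` e) (z - t *\<^sub>R n) :: real)" for t
    proof -
      have "c + z - t *\<^sub>R n \<in> e \<longleftrightarrow> z - t *\<^sub>R n \<in> (+) (- c) ` e"
      proof
        assume "c + z - t *\<^sub>R n \<in> e"
        then show "z - t *\<^sub>R n \<in> (+) (- c) ` e" by (intro image_eqI[of _ _ "c + z - t *\<^sub>R n"]) auto
      next
        assume "z - t *\<^sub>R n \<in> (+) (- c) ` e"
        then obtain y where "y \<in> e" "z - t *\<^sub>R n = - c + y" by auto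
        then show "c + z - t *\<^sub>R n \<in> e" by (simp add: algebra_simps)
      qed
      then show ?thesis by (simp add: indicator_def)
    qed
    moreover have "c + z - t *\<^sub>R n - c = z - t *\<^sub>R n" for t by simp
    ultimately show "?f (c + z) = indicator {0..1} (n \<bullet> z - (b - n \<bullet> c)) *
        (indicator ((+) (- c) ` e) (z - (n \<bullet> z - (b - n \<bullet> c)) *\<^sub>R n) * h (z - (n \<bullet> z - (b - n \<bullet> c)) *\<^sub>R n))"
      by (simp only:)
  qed simp
  finally show ?thesis by simp
qed

text \<open>Values of \<open>h\<close> off the relative interior are seen only above the relative
  boundary, whose shadow along \<open>n\<close> is null. Traces, which are controlled on the
  relative interior only, may thus be integrated as if they were continuous.\<close>

lemma flat_integral_eq:
  fixes e :: "(real ^ 'd::finite) set"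
  assumes n: "norm n = 1" and e: "polytope e" "e \<noteq> {}" "e \<subseteq> {x. n \<bullet> x = b}" "aff_dim e \<le> int CARD('d) - 1"
    and h: "continuous_on UNIV h0" "\<And>y. y \<in> rel_interior e \<Longrightarrow> h y = h0 y"
  shows "set_integrable lebesgue {y + t *\<^sub>R n | y t. y \<in> e \<and> 0 \<le> t \<and> t \<le> 1}
      (\<lambda>z. h (z - ((z - (SOME y. y \<in> e)) \<bullet> n) *\<^sub>R n))"
    and "flat_integral n e h = plane_integral n b e h0"
proof -
  let ?y = "SOME y. y \<in> e" and ?P = "{y + t *\<^sub>R n | y t. y \<in> e \<and> 0 \<le> t \<and> t \<le> 1}"
  have nn: "n \<bullet> n = 1" using n by (simp add: dot_square_norm)
  have "?y \<in> e" using e(2) by (simp add: some_in_eq)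
  then have yb: "n \<bullet> ?y = b" using e(3) by blast
  \<comment> \<open>Since \<open>e\<close> lies in one hyperplane, the height above the chosen point
    is the height above that hyperplane.\<close>
  have t: "(z - ?y) \<bullet> n = n \<bullet> z - b" for z
    using yb by (simp add: inner_commute[of _ n] inner_diff_right)
  have P: "z \<in> ?P \<longleftrightarrow> n \<bullet> z - b \<in> {0..1} \<and> z - (n \<bullet> z - b) *\<^sub>R n \<in> e" for z
  proof
    assume "z \<in> ?P"
    then obtain y t where y: "y \<in> e" "0 \<le> t" "t \<le> 1" "z = y + t *\<^sub>R n" by blast
    have "n \<bullet> y = b" using y e by auto
    then have "n \<bullet> z - b = t" using y nn by (simp add: inner_add_right)
    then show "n \<bullet> z - b \<in> {0..1} \<and> z - (n \<bullet> z - b) *\<^sub>R n \<in> e" using y by simp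
  next
    assume "n \<bullet> z - b \<in> {0..1} \<and> z - (n \<bullet> z - b) *\<^sub>R n \<in> e"
    moreover have "z = (z - (n \<bullet> z - b) *\<^sub>R n) + (n \<bullet> z - b) *\<^sub>R n" by simp
    ultimately show "z \<in> ?P" unfolding atLeastAtMost_iff by blast
  qed
  have "?P = (\<lambda>(y, t). y + t *\<^sub>R n) ` (e \<times> {0..1})" by auto blast
  moreover have "compact \<dots>"
    using polytope_imp_compact[OF e(1)]
    by (intro compact_continuous_image compact_Times) (auto simp: case_prod_unfold intro!: continuous_intros)
  ultimately have cP: "compact ?P" by simp
  have c0: "continuous_on UNIV (\<lambda>z. h0 (z - (n \<bullet> z - b) *\<^sub>R n))"
    by (intro continuous_on_compose2[OF h(1)] continuous_intros) auto
  have int0: "integrable lborel (\<lambda>z. indicator ?P z *\<^sub>R h0 (z - (n \<bullet> z - b) *\<^sub>R n))"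
    using cP continuous_on_subset[OF c0] by (intro borel_integrable_compact) auto
  then have s0: "set_integrable lebesgue ?P (\<lambda>z. h0 (z - (n \<bullet> z - b) *\<^sub>R n))"
    unfolding set_integrable_def using integrable_completion borel_measurable_integrable by blast
  have neg: "negligible (shadow n (e - rel_interior e))"
    using e by (intro negligible_shadow_rel_frontier) auto
  have eq: "h (z - ((z - ?y) \<bullet> n) *\<^sub>R n) = h0 (z - (n \<bullet> z - b) *\<^sub>R n)"
    if "z \<in> ?P - shadow n (e - rel_interior e)" for z
  proof -
    have "z - (n \<bullet> z - b) *\<^sub>R n \<in> e" using that P by blast
    moreover have "z - (n \<bullet> z - b) *\<^sub>R n \<notin> e - rel_interior e" using that shadowI by blast
    ultimately show ?thesis unfolding t using h(2) by blast
  qed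
  show "set_integrable lebesgue ?P (\<lambda>z. h (z - ((z - ?y) \<bullet> n) *\<^sub>R n))"
    using set_integral_spike(1)[OF s0 neg eq] .
  have "flat_integral n e h = (LINT z:?P|lebesgue. h0 (z - (n \<bullet> z - b) *\<^sub>R n))"
    unfolding flat_integral_def using set_integral_spike(2)[OF s0 neg eq] .
  also have "\<dots> = (LINT z|lborel. indicator ?P z *\<^sub>R h0 (z - (n \<bullet> z - b) *\<^sub>R n))"
    unfolding set_lebesgue_integral_def using int0 by (intro integral_completion borel_measurable_integrable)
  also have "\<dots> = plane_integral n b e h0"
    unfolding plane_integral_def
    by (intro Bochner_Integration.integral_cong) (auto simp: indicator_def P simp del: mem_Collect_eq)
  finally show "flat_integral n e h = plane_integral n b e h0" .
qed

context pmesh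
begin

text \<open>In \<open>shift e s\<close> and \<open>elem e s\<close> the side \<open>s = True\<close> is the one that the normal points away from.\<close>

definition shift :: "(real ^ 'd) set \<Rightarrow> bool \<Rightarrow> real ^ 'd" where
  "shift e s = (case SOME (zm, Tm, zp, Tp, b). sides e zm Tm zp Tp b of (zm, Tm, zp, Tp, b) \<Rightarrow> if s then zm else zp)"

definition elem :: "(real ^ 'd) set \<Rightarrow> bool \<Rightarrow> (real ^ 'd) set" where
  "elem e s = (case SOME (zm, Tm, zp, Tp, b). sides e zm Tm zp Tp b of (zm, Tm, zp, Tp, b) \<Rightarrow> if s then Tm else Tp)"

definition offset :: "(real ^ 'd) set \<Rightarrow> real" where
  "offset e = (case SOME (zm, Tm, zp, Tp, b). sides e zm Tm zp Tp b of (zm, Tm, zp, Tp, b) \<Rightarrow> b)"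

lemma sides_shift_elem:
  assumes "e \<in> mfaces M"
  shows "sides e (shift e True) (elem e True) (shift e False) (elem e False) (offset e)"
proof -
  let ?P = "\<lambda>(zm, Tm, zp, Tp, b). sides e zm Tm zp Tp b"
  obtain zm Tm zp Tp b where "sides e zm Tm zp Tp b" using exists_sides[OF assms] .
  then have "?P (zm, Tm, zp, Tp, b)" by simp
  then have "?P (SOME p. ?P p)" by (rule someI)
  then show ?thesis
    by (cases "SOME p. ?P p") (simp add: shift_def elem_def offset_def)
qed

lemma shift_elem:
  assumes "e \<in> mfaces M"
  shows "shift e s \<in> periods M" "elem e s \<in> melems M"
    "(shift e s, elem e s) \<noteq> (shift e (\<not> s), elem e (\<not> s))"
    "e = tile (shift e s) (elem e s) \<inter> tile (shift e (\<not> s)) (elem e (\<not> s))"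
proof -
  note S = sides_shift_elem[OF assms, unfolded sides_def]
  show "shift e s \<in> periods M" "elem e s \<in> melems M"
    using S by (cases s; simp)+
  show "(shift e s, elem e s) \<noteq> (shift e (\<not> s), elem e (\<not> s))"
    using S by (cases s) auto
  have "e = tile (shift e True) (elem e True) \<inter> tile (shift e False) (elem e False)"
    using S by (elim conjE)
  then show "e = tile (shift e s) (elem e s) \<inter> tile (shift e (\<not> s)) (elem e (\<not> s))"
    by (cases s) (simp_all only: simp_thms, blast+)
qed

lemma tile_at_face_shift_elem:
  assumes "e \<in> mfaces M" "y \<in> rel_interior e" "z \<in> periods M" "T \<in> melems M" "y \<in> tile z T"
  obtains s where "z = shift e s" "T = elem e s"
proof -
  have "(z, T) = (shift e True, elem e True) \<or> (z, T) = (shift e False, elem e False)"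
    by (rule tile_at_face[OF assms(1) sides_shift_elem[OF assms(1)] assms(2-)])
  then show thesis using that[of True] that[of False] by (elim disjE) simp_all
qed

section \<open>The boundary of one element as a union of translated faces\<close>

lemma face_unique:
  assumes "e \<in> mfaces M" "e' \<in> mfaces M" "w \<in> periods M" "e' = tile w e"
  shows "e = e'"
proof -
  have "\<exists>!e'. e' \<in> mfaces M \<and> (\<exists>z\<in>periods M. e' = tile z e)"
    using mesh face_interface[OF assms(1)] by (simp add: periodic_mesh_def)
  moreover have "e = tile 0 e" by simp
  ultimately show ?thesis using assms zero_periods by blast
qed

lemma representative_face:
  assumes "interface M F"
  obtains e w where "e \<in> mfaces M" "w \<in> periods M" "e = tile w F"
proof -
  have "\<exists>!e'. e' \<in> mfaces M \<and> (\<exists>z\<in>periods M. e' = tile z F)"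
    using mesh assms by (simp add: periodic_mesh_def)
  then show thesis using that by blast
qed

text \<open>A face \<open>e\<close> touches a translate of \<open>elem e s\<close>; moving it back
  puts it on the boundary of the element itself. A sum over the elements and their boundary pieces
  then becomes a sum over pairs of a face and a side.\<close>

definition cut :: "(real ^ 'd) set \<times> bool \<Rightarrow> (real ^ 'd) set" where
  "cut p = tile (- shift (fst p) (snd p)) (fst p)"

text \<open>The sign makes the normal outward for the element on the given side.\<close>

definition cut_normal :: "(real ^ 'd) set \<times> bool \<Rightarrow> real ^ 'd" where
  "cut_normal p = (if snd p then mnormal M (fst p) else - mnormal M (fst p))"

definition cut_offset :: "(real ^ 'd) set \<times> bool \<Rightarrow> real" where
  "cut_offset p = (let b = offset (fst p) - mnormal M (fst p) \<bullet> shift (fst p) (snd p) in if snd p then b else - b)"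

definition sides_of :: "(real ^ 'd) set \<Rightarrow> ((real ^ 'd) set \<times> bool) set" where
  "sides_of T = {p \<in> mfaces M \<times> UNIV. elem (fst p) (snd p) = T}"

lemma mem_tile: "x \<in> tile z A \<longleftrightarrow> x - z \<in> A"
proof
  assume "x - z \<in> A"
  then show "x \<in> tile z A" by (intro image_eqI[of _ _ "x - z"]) auto
qed auto

lemma mem_rel_interior_cut: "x \<in> rel_interior (cut (e, s)) \<longleftrightarrow> x + shift e s \<in> rel_interior e"
  unfolding cut_def fst_conv snd_conv rel_interior_translation mem_tile by simp

lemma mem_cut: "x \<in> cut (e, s) \<longleftrightarrow> x + shift e s \<in> e"
  unfolding cut_def fst_conv snd_conv mem_tile by simp

text \<open>If two cuts of an element overlapped, the tiles beyond them would be the same, so the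
  faces would be translates of each other and equal by uniqueness of the representative. The case
  \<open>e = e'\<close> with opposite sides is real, as an element may be its own neighbour across a
  period; there compactness makes the relative shift zero, and the two tiles at the face would
  coincide.\<close>

lemma cut_disjoint:
  assumes e: "e \<in> mfaces M" "e' \<in> mfaces M" and el: "elem e s = elem e' s'" and ne: "(e, s) \<noteq> (e', s')"
  shows "rel_interior (cut (e, s)) \<inter> cut (e', s') = {}"
proof (rule ccontr)
  assume "\<not> ?thesis"
  then obtain x where x: "x + shift e s \<in> rel_interior e" "x + shift e' s' \<in> e'"
    by (auto simp: mem_rel_interior_cut mem_cut)
  \<comment> \<open>The position of the far tile of \<open>e'\<close> after its near tile has been
    moved onto that of \<open>e\<close>.\<close>
  let ?z = "shift e s + shift e' (\<not> s') - shift e' s'"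
  have "x + shift e' s' \<in> tile (shift e' (\<not> s')) (elem e' (\<not> s'))"
    using x(2) shift_elem(4)[OF e(2), of s'] by blast
  then have "x + shift e s \<in> tile ?z (elem e' (\<not> s'))"
    by (simp only: mem_tile) (simp add: algebra_simps)
  moreover have "?z \<in> periods M" using shift_elem(1) e by (intro periods_diff periods_add) auto
  ultimately obtain s'' where s'': "?z = shift e s''" "elem e' (\<not> s') = elem e s''"
    using tile_at_face_shift_elem[OF e(1) x(1)] shift_elem(2)[OF e(2)] by metis
  \<comment> \<open>Otherwise the far tile of \<open>e'\<close> would be its near tile.\<close>
  have "s'' \<noteq> s"
  proof
    assume "s'' = s"
    then have "shift e' (\<not> s') = shift e' s'" "elem e' (\<not> s') = elem e' s'" using s'' el by auto
    then show False using shift_elem(3)[OF e(2), of s'] by simp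
  qed
  then have "s'' = (\<not> s)" by simp
  note s'' = s''[unfolded this]
  have "e' = tile (shift e' s' - shift e s) e"
  proof (rule set_eqI)
    fix y
    have "y \<in> e' \<longleftrightarrow> y - shift e' s' \<in> elem e' s' \<and> y - shift e' (\<not> s') \<in> elem e' (\<not> s')"
      by (subst shift_elem(4)[OF e(2), of s']) (simp only: Int_iff mem_tile)
    also have "\<dots> \<longleftrightarrow> (y - (shift e' s' - shift e s)) - shift e s \<in> elem e s \<and>
        (y - (shift e' s' - shift e s)) - shift e (\<not> s) \<in> elem e (\<not> s)"
      unfolding s''(1)[symmetric] s''(2)[symmetric] el by (simp add: algebra_simps)
    also have "\<dots> \<longleftrightarrow> y - (shift e' s' - shift e s) \<in> e"
      by (subst (3) shift_elem(4)[OF e(1), of s]) (simp only: Int_iff mem_tile)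
    also have "\<dots> \<longleftrightarrow> y \<in> tile (shift e' s' - shift e s) e" by (simp only: mem_tile)
    finally show "y \<in> e' \<longleftrightarrow> y \<in> tile (shift e' s' - shift e s) e" .
  qed
  moreover from this have ee: "e = e'"
    using e shift_elem(1) by (intro face_unique[of e e' "shift e' s' - shift e s"] periods_diff) auto
  ultimately have "shift e' s' - shift e s = 0"
    using face_facts[OF e(1)] by (intro translate_compact_eq_self[of e]) auto
  moreover have "s' = (\<not> s)" using ne ee by auto
  ultimately show False using shift_elem(3)[OF e(1), of s] ee el by auto
qed

text \<open>A boundary point of \<open>T\<close> lies in a further tile, and only finitely many
  tiles come into question. Their intersections with \<open>T\<close> that have codimension one are
  interfaces, whose relative interiors are those of cuts of \<open>T\<close>; all other boundary
  points lie in sets of codimension two.\<close>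

lemma frontier_cover:
  assumes T: "T \<in> melems M"
  shows "negligible (shadow a (frontier T - (\<Union>p\<in>sides_of T. rel_interior (cut p))))"
proof -
  define Z where "Z = {z \<in> periods M. \<forall>i. \<bar>z $ i\<bar> \<le> 2 * len i}"
  define K where "K = {(z, T'). z \<in> Z \<and> T' \<in> melems M \<and> (z, T') \<noteq> (0, T)}"
  have "K \<subseteq> Z \<times> melems M" by (auto simp: K_def)
  then have finK: "finite K"
    by (rule finite_subset) (use finite_periods_bounded finite_melems in \<open>auto simp: Z_def\<close>)
  define F where "F k = T \<inter> tile (fst k) (snd k)" for k
  have Fk: "polytope (F k)" "aff_dim (F k) \<le> int CARD('d) - 1" if "k \<in> K" for k
  proof -
    obtain z T' where kz: "k = (z, T')" by fastforce
    with that have k: "k = (z, T')" "z \<in> periods M" "T' \<in> melems M" "(z, T') \<noteq> (0, T)"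
      by (simp_all add: K_def Z_def)
    show "polytope (F k)" unfolding F_def using k T melems(1) tile_facts(1) by (auto intro!: polytope_Int)
    have "aff_dim (tile 0 T \<inter> tile z T') \<le> int CARD('d) - 1"
      using k T zero_periods by (intro aff_dim_tiles_le) auto
    then show "aff_dim (F k) \<le> int CARD('d) - 1" by (simp add: F_def k)
  qed
  \<comment> \<open>What an intersection may leave uncovered: its relative boundary if it is an
    interface, all of it if its dimension is lower.\<close>
  define N where "N k = (if aff_dim (F k) = int CARD('d) - 1 then F k - rel_interior (F k) else F k)" for k
  have "negligible (shadow a (N k))" if "k \<in> K" for k
  proof (cases "aff_dim (F k) = int CARD('d) - 1")
    case True
    then show ?thesis using Fk[OF that] by (auto simp: N_def intro!: negligible_shadow_rel_frontier)
  next
    case False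
    then show ?thesis using Fk[OF that] by (auto simp: N_def intro!: negligible_shadow_codim2)
  qed
  then have "negligible (shadow a (\<Union>k\<in>K. N k))"
    using finK by (auto simp: shadow_UN intro!: negligible_Union)
  moreover have "frontier T - (\<Union>p\<in>sides_of T. rel_interior (cut p)) \<subseteq> (\<Union>k\<in>K. N k)"
  proof
    fix x
    assume x: "x \<in> frontier T - (\<Union>p\<in>sides_of T. rel_interior (cut p))"
    then have xT: "x \<in> T" using melems(5)[OF T] frontier_subset_closed by blast
    then have xM: "x \<in> mdom M" using melems(6)[OF T] by blast
    have "\<exists>k\<in>K. x \<in> tile (fst k) (snd k)"
    proof (rule ccontr)
      assume no: "\<not> ?thesis"
      let ?O = "- (\<Union>k\<in>K. tile (fst k) (snd k))"
      have "closed (\<Union>k\<in>K. tile (fst k) (snd k))"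
        using finK by (intro closed_UN) (auto simp: K_def tile_facts(3))
      then have "open ?O" by (rule open_Compl)
      moreover have "x \<in> ?O" using no by blast
      ultimately obtain r where r: "r > 0" "ball x r \<subseteq> ?O" by (rule openE)
      \<comment> \<open>Bounding \<open>q\<close> by all period lengths keeps the tile of the nearby
        point \<open>y\<close> within the finite set \<open>Z\<close>.\<close>
      define q where "q = min r (Min (range len))"
      have q: "q > 0" using r len_pos by (auto simp: q_def)
      have "q \<le> len i" for i by (auto simp: q_def min.coboundedI2)
      obtain y where y: "y \<in> ball x q" "y \<notin> T"
        using x q frontier_straddle[of x T] by auto
      obtain z T' where z: "z \<in> periods M" "T' \<in> melems M" "y \<in> tile z T'" using tiles_cover .
      have "\<bar>(y - x) $ i\<bar> \<le> len i" for i
      proof -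
        have "\<bar>(y - x) $ i\<bar> \<le> norm (y - x)" by (rule component_le_norm_cart)
        also have "\<dots> \<le> q" using y by (simp add: dist_norm norm_minus_commute)
        finally show ?thesis using \<open>q \<le> len i\<close> by simp
      qed
      then have "\<bar>z $ i\<bar> \<le> 2 * len i" for i
        using z xM by (intro period_bound_of_meet[of x "y - x" z T']) auto
      then have "z \<in> Z" using z by (simp add: Z_def)
      moreover have "(z, T') \<noteq> (0, T)" using y z by auto
      ultimately have "(z, T') \<in> K" using z by (simp add: K_def)
      then have "y \<in> (\<Union>k\<in>K. tile (fst k) (snd k))" using z(3) by (intro UN_I[of "(z, T')"]) auto
      moreover have "y \<in> ball x r" using y by (simp add: q_def)
      ultimately show False using r(2) by blast
    qed
    then obtain k where k: "k \<in> K" "x \<in> F k" using xT by (auto simp: F_def)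
    show "x \<in> (\<Union>k\<in>K. N k)"
    proof (cases "aff_dim (F k) = int CARD('d) - 1 \<and> x \<in> rel_interior (F k)")
      case True
      obtain z T' where zT: "k = (z, T')" by fastforce
      with k have kz: "k = (z, T')" "z \<in> periods M" "T' \<in> melems M" by (simp_all add: K_def Z_def)
      then have "interface M (F k)" unfolding interface_def using True T by (auto simp: F_def)
      then obtain e w where e: "e \<in> mfaces M" "w \<in> periods M" "e = tile w (F k)" by (rule representative_face)
      \<comment> \<open>The intersection may differ from its representative \<open>e\<close> by a
        period \<open>w\<close>. Moved by \<open>w\<close>, the element \<open>T\<close> becomes one
        of the two tiles at \<open>e\<close>, so \<open>w\<close> is one of the shifts of
        \<open>e\<close>.\<close>
      have wx: "w + x \<in> rel_interior e" using True by (simp add: e rel_interior_translation)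
      moreover have "w + x \<in> tile w T" using xT by simp
      ultimately obtain s where s: "w = shift e s" "T = elem e s"
        using tile_at_face_shift_elem[OF e(1) _ e(2) T] by blast
      then have "x \<in> rel_interior (cut (e, s))"
        using wx by (simp add: mem_rel_interior_cut add.commute)
      then show ?thesis using x e(1) s by (auto simp: sides_of_def)
    next
      case False
      then show ?thesis using k by (auto simp: N_def)
    qed
  qed
  ultimately show ?thesis by (rule negligible_subset[OF _ shadow_mono])
qed

lemma flat_boundary_cut:
  assumes T: "T \<in> melems M"
  shows "flat_boundary T (sides_of T) cut cut_normal cut_offset a"
proof
  show "compact T" "convex T" "interior T \<noteq> {}" using melems[OF T] by auto
  show "finite (sides_of T)" using finite_mfaces by (simp add: sides_of_def)
  show "negligible (shadow a (frontier T - (\<Union>p\<in>sides_of T. rel_interior (cut p))))"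
    by (rule frontier_cover[OF T])
  fix p assume "p \<in> sides_of T"
  then obtain e s where p: "p = (e, s)" "e \<in> mfaces M" "elem e s = T" by (cases p) (auto simp: sides_of_def)
  show "compact (cut p)" unfolding cut_def p
    using face_facts(2)[OF p(2)] by (simp only: fst_conv compact_translation)
  show "cut p \<subseteq> T"
  proof
    fix x assume "x \<in> cut p"
    then have "x + shift e s \<in> e" unfolding p(1) mem_cut .
    then have "x + shift e s \<in> tile (shift e s) (elem e s)"
      by (rule IntD1[OF subsetD[OF equalityD1[OF shift_elem(4)[OF p(2)]]]])
    then show "x \<in> T" unfolding mem_tile p(3) by simp
  qed
  show "cut p \<subseteq> {x. cut_normal p \<bullet> x = cut_offset p}"
  proof
    fix x assume "x \<in> cut p"
    then have "mnormal M e \<bullet> (x + shift e s) = offset e"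
      using sides_hyperplane[OF sides_shift_elem[OF p(2)]] unfolding p mem_cut by blast
    then show "x \<in> {x. cut_normal p \<bullet> x = cut_offset p}"
      by (auto simp: p cut_normal_def cut_offset_def inner_add_right)
  qed
  show "aff_dim (cut p) = int DIM(real ^ 'd) - 1"
    unfolding cut_def p(1) fst_conv snd_conv aff_dim_translation_eq using aff_dim_face[OF p(2)] by simp
  show "norm (cut_normal p) = 1" using norm_mnormal[OF p(2)] by (simp add: cut_normal_def p)
  show "cut_normal p \<bullet> x \<le> cut_offset p" if "x \<in> T" for x
  proof -
    have t: "x + shift e s \<in> tile (shift e s) (elem e s)" unfolding mem_tile using that p by simp
    have le: "\<forall>y\<in>tile (shift e True) (elem e True). mnormal M e \<bullet> y \<le> offset e"
      using sides_shift_elem[OF p(2), unfolded sides_def] by (elim conjE)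
    have ge: "\<forall>y\<in>tile (shift e False) (elem e False). mnormal M e \<bullet> y \<ge> offset e"
      using sides_shift_elem[OF p(2), unfolded sides_def] by (elim conjE)
    show ?thesis
    proof (cases s)
      case True
      then have "s = True" by simp
      from bspec[OF le t[unfolded this]] show ?thesis
        by (simp add: p(1) \<open>s = True\<close> cut_normal_def cut_offset_def inner_add_right)
    next
      case False
      then have "s = False" by simp
      from bspec[OF ge t[unfolded this]] show ?thesis
        by (simp add: p(1) \<open>s = False\<close> cut_normal_def cut_offset_def inner_add_right)
    qed
  qed
  show "rel_interior (cut p) \<inter> cut p' = {}"
    if "p' \<in> sides_of T" "p \<noteq> p'" for p'
    using that p cut_disjoint[of e "fst p'" s "snd p'"] by (auto simp: sides_of_def)
qed

end

section \<open>Integration by parts for the discrete derivative\<close>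

lemma pdiff_eq: "(f has_derivative f') (at y) \<Longrightarrow> pdiff s f y = f' (axis s 1)"
  unfolding pdiff_def using frechet_derivative_at by metis

lemma pdiff_add:
  "f differentiable (at y) \<Longrightarrow> g differentiable (at y) \<Longrightarrow> pdiff s (\<lambda>y. f y + g y) y = pdiff s f y + pdiff s g y"
  unfolding frechet_derivative_works pdiff_def by (subst pdiff_eq[unfolded pdiff_def, OF has_derivative_add]) auto

lemma pdiff_mult:
  "f differentiable (at y) \<Longrightarrow> g differentiable (at y) \<Longrightarrow>
    pdiff s (\<lambda>y. f y * g y) y = pdiff s f y * g y + f y * pdiff s g y"
  unfolding frechet_derivative_works pdiff_def
  by (subst pdiff_eq[unfolded pdiff_def, OF has_derivative_mult]) auto

lemma pdiff_const: "pdiff s (\<lambda>y. c) y = 0"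
  by (rule pdiff_eq[of _ "\<lambda>_. 0"]) (rule has_derivative_const)

lemma pdiff_cong_open:
  assumes "open S" "y \<in> S" "\<And>x. x \<in> S \<Longrightarrow> f x = g x" "g differentiable (at y)"
  shows "pdiff s f y = pdiff s g y"
proof -
  have "(g has_derivative frechet_derivative g (at y)) (at y)"
    using assms(4) by (simp add: frechet_derivative_works)
  then have "(f has_derivative frechet_derivative g (at y)) (at y)"
    by (rule has_derivative_transform_within_open[OF _ assms(1,2)]) (simp add: assms(3))
  then show ?thesis by (subst pdiff_eq) (auto simp: pdiff_def)
qed

definition smooth1 :: "(real ^ 'd::finite \<Rightarrow> real) \<Rightarrow> bool" where
  "smooth1 g \<longleftrightarrow> (\<forall>y. g differentiable (at y)) \<and> (\<forall>s. continuous_on UNIV (pdiff s g))"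

lemma smooth1_continuous: "smooth1 g \<Longrightarrow> continuous_on UNIV g"
  unfolding smooth1_def by (intro continuous_at_imp_continuous_on) (auto intro: differentiable_imp_continuous_within)

lemma smooth1_const: "smooth1 (\<lambda>y. c)"
proof -
  have "pdiff s (\<lambda>y. c) = (\<lambda>_. 0)" for s :: 'a by (rule ext) (rule pdiff_const)
  then show ?thesis by (simp add: smooth1_def)
qed

lemma smooth1_add:
  assumes "smooth1 f" "smooth1 g" shows "smooth1 (\<lambda>y. f y + g y)"
proof -
  have "pdiff s (\<lambda>y. f y + g y) = (\<lambda>y. pdiff s f y + pdiff s g y)" for s
    using assms by (intro ext pdiff_add) (auto simp: smooth1_def)
  then show ?thesis using assms by (auto simp: smooth1_def intro!: continuous_intros)
qed

lemma smooth1_mult: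
  assumes "smooth1 f" "smooth1 g" shows "smooth1 (\<lambda>y. f y * g y)"
proof -
  have "pdiff s (\<lambda>y. f y * g y) = (\<lambda>y. pdiff s f y * g y + f y * pdiff s g y)" for s
    using assms by (intro ext pdiff_mult) (auto simp: smooth1_def)
  then show ?thesis using assms smooth1_continuous[OF assms(1)] smooth1_continuous[OF assms(2)]
    by (auto simp: smooth1_def intro!: continuous_intros)
qed

lemma smooth1_sum: "(\<And>i. i \<in> I \<Longrightarrow> smooth1 (f i)) \<Longrightarrow> smooth1 (\<lambda>y. \<Sum>i\<in>I. f i y)"
  by (induction I rule: infinite_finite_induct) (auto intro: smooth1_const smooth1_add)

lemma smooth1_prod: "(\<And>i. i \<in> I \<Longrightarrow> smooth1 (f i)) \<Longrightarrow> smooth1 (\<lambda>y. \<Prod>i\<in>I. f i y)"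
  by (induction I rule: infinite_finite_induct) (auto intro: smooth1_const smooth1_mult)

lemma smooth1_power: "smooth1 f \<Longrightarrow> smooth1 (\<lambda>y. f y ^ k)"
  by (induction k) (auto intro: smooth1_const smooth1_mult)

lemma smooth1_component: "smooth1 (\<lambda>y. y $ i)"
proof -
  have d: "((\<lambda>y::real^'a. y $ i) has_derivative (\<lambda>h. h $ i)) (at y)" for y
    by (rule bounded_linear_imp_has_derivative) (rule bounded_linear_vec_nth)
  have "pdiff s (\<lambda>y::real^'a. y $ i) = (\<lambda>_. axis s 1 $ i)" for s
    using pdiff_eq[OF d] by (intro ext) auto
  then show ?thesis using d by (auto simp: smooth1_def differentiable_def)
qed

lemma smooth1_exp:
  assumes "smooth1 f" shows "smooth1 (\<lambda>y. exp (f y))"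
proof -
  have d: "((\<lambda>y. exp (f y)) has_derivative (\<lambda>h. exp (f y) * frechet_derivative f (at y) h)) (at y)" for y
    using assms by (auto simp: smooth1_def frechet_derivative_works intro!: derivative_eq_intros)
  have "pdiff s (\<lambda>y. exp (f y)) = (\<lambda>y. exp (f y) * pdiff s f y)" for s
    using pdiff_eq[OF d] by (intro ext) (auto simp: pdiff_def)
  then show ?thesis using d assms smooth1_continuous[OF assms]
    by (auto simp: smooth1_def differentiable_def intro!: continuous_intros)
qed

lemma smooth1_weight: "smooth1 (weight :: real ^ 'd::finite \<Rightarrow> real)"
proof -
  have "weight = (\<lambda>v::real ^ 'd. exp ((- 1 / 2) * (\<Sum>i\<in>UNIV. v $ i ^ 2)))"
  proof
    fix v :: "real ^ 'd"
    have "(norm v)\<^sup>2 = (\<Sum>i\<in>UNIV. v $ i ^ 2)"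
      unfolding power2_norm_eq_inner inner_vec_def by (simp add: power2_eq_square)
    then show "weight v = exp ((- 1 / 2) * (\<Sum>i\<in>UNIV. v $ i ^ 2))" by (simp add: weight_def)
  qed
  then show ?thesis
    by (rule ssubst) (intro smooth1_exp smooth1_mult smooth1_const smooth1_sum smooth1_power smooth1_component)
qed

lemma smooth1_poly: "poly_deg_le k P \<Longrightarrow> smooth1 P"
  unfolding poly_deg_le_def
  by (auto intro!: smooth1_sum smooth1_mult smooth1_const smooth1_prod smooth1_power smooth1_component)

lemma smooth1_directional:
  assumes "smooth1 g"
  shows "((\<lambda>t. g (y + t *\<^sub>R axis s 1)) has_real_derivative pdiff s g (y + t *\<^sub>R axis s 1)) (at t)"
proof -
  let ?z = "y + t *\<^sub>R axis s 1"
  have g: "(g has_derivative frechet_derivative g (at ?z)) (at ?z)"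
    using assms by (auto simp: smooth1_def frechet_derivative_works)
  have "((\<lambda>t. y + t *\<^sub>R axis s (1::real)) has_derivative (\<lambda>h. h *\<^sub>R axis s 1)) (at t)"
    by (auto intro!: derivative_eq_intros)
  from has_derivative_compose[OF this g]
  have "((\<lambda>t. g (y + t *\<^sub>R axis s 1)) has_derivative (\<lambda>h. frechet_derivative g (at ?z) (h *\<^sub>R axis s 1))) (at t)" .
  also have "(\<lambda>h. frechet_derivative g (at ?z) (h *\<^sub>R axis s 1)) = (\<lambda>h. pdiff s g ?z * h)"
    using linear_scale[OF has_derivative_linear[OF g]] by (auto simp: pdiff_def)
  finally show ?thesis by (simp add: has_field_derivative_def)
qed

context pmesh
begin

text \<open>Piecewise continuous and piecewise \<open>C\<^sup>1\<close>, with pieces that extend to the whole space; nothing is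
  assumed on the element boundaries.\<close>

definition pwc :: "(real ^ 'd \<Rightarrow> real) \<Rightarrow> bool" where
  "pwc G \<longleftrightarrow> (\<forall>T\<in>melems M. \<exists>g. continuous_on UNIV g \<and> (\<forall>y\<in>interior T. G y = g y))"

definition pws :: "(real ^ 'd \<Rightarrow> real) \<Rightarrow> bool" where
  "pws G \<longleftrightarrow> (\<forall>T\<in>melems M. \<exists>g. smooth1 g \<and> (\<forall>y\<in>interior T. G y = g y))"

lemma pws_pwc: "pws G \<Longrightarrow> pwc G"
  unfolding pws_def pwc_def using smooth1_continuous by blast

lemma pws_smooth1: "smooth1 g \<Longrightarrow> pws g"
  unfolding pws_def by blast

lemma pwc_continuous: "continuous_on UNIV g \<Longrightarrow> pwc g"
  unfolding pwc_def by blast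

lemma pws_dg_space: "U \<in> dg_space M k \<Longrightarrow> pws U"
  unfolding pws_def dg_space_def using smooth1_poly by blast

lemma piecewise_binary:
  assumes "\<forall>T\<in>melems M. \<exists>f. P f \<and> (\<forall>y\<in>interior T. F y = f y)"
    and "\<forall>T\<in>melems M. \<exists>g. P g \<and> (\<forall>y\<in>interior T. G y = g y)"
    and "\<And>f g. P f \<Longrightarrow> P g \<Longrightarrow> P (\<lambda>y. h (f y) (g y))"
  shows "\<forall>T\<in>melems M. \<exists>k. P k \<and> (\<forall>y\<in>interior T. h (F y) (G y) = k y)"
proof
  fix T assume T: "T \<in> melems M"
  obtain f where f: "P f" "\<forall>y\<in>interior T. F y = f y" using assms(1) T by blast
  obtain g where g: "P g" "\<forall>y\<in>interior T. G y = g y" using assms(2) T by blast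
  show "\<exists>k. P k \<and> (\<forall>y\<in>interior T. h (F y) (G y) = k y)"
    using f g assms(3) by (intro exI[of _ "\<lambda>y. h (f y) (g y)"]) auto
qed

lemma pwc_add: "pwc F \<Longrightarrow> pwc G \<Longrightarrow> pwc (\<lambda>y. F y + G y)"
  unfolding pwc_def by (rule piecewise_binary[where h = "(+)"]) (auto intro: continuous_intros)

lemma pwc_mult: "pwc F \<Longrightarrow> pwc G \<Longrightarrow> pwc (\<lambda>y. F y * G y)"
  unfolding pwc_def by (rule piecewise_binary[where h = times]) (auto intro: continuous_intros)

lemma pws_add: "pws F \<Longrightarrow> pws G \<Longrightarrow> pws (\<lambda>y. F y + G y)"
  unfolding pws_def by (rule piecewise_binary[where h = "(+)"]) (auto intro: smooth1_add)

lemma pws_mult: "pws F \<Longrightarrow> pws G \<Longrightarrow> pws (\<lambda>y. F y * G y)"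
  unfolding pws_def by (rule piecewise_binary[where h = times]) (auto intro: smooth1_mult)

lemma pwc_const: "pwc (\<lambda>y. c)" and pws_const: "pws (\<lambda>y. c)"
  by (auto intro: pwc_continuous pws_smooth1 smooth1_const)

lemma pwc_sum: "(\<And>i. i \<in> I \<Longrightarrow> pwc (f i)) \<Longrightarrow> pwc (\<lambda>y. \<Sum>i\<in>I. f i y)"
  by (induction I rule: infinite_finite_induct) (auto intro: pwc_const pwc_add)

lemma pws_sum: "(\<And>i. i \<in> I \<Longrightarrow> pws (f i)) \<Longrightarrow> pws (\<lambda>y. \<Sum>i\<in>I. f i y)"
  by (induction I rule: infinite_finite_induct) (auto intro: pws_const pws_add)

lemma pws_cmult: "pws f \<Longrightarrow> pws (\<lambda>y. c * f y)"
  by (intro pws_mult pws_const)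

lemma pwc_cmult: "pwc f \<Longrightarrow> pwc (\<lambda>y. c * f y)"
  by (intro pwc_mult pwc_const)

lemma pws_pdiff_eq:
  assumes "smooth1 g" "\<forall>y\<in>interior T. G y = g y" "y \<in> interior T"
  shows "pdiff s G y = pdiff s g y"
  using assms by (intro pdiff_cong_open[of "interior T"]) (auto simp: smooth1_def)

lemma pwc_pdiff: "pws G \<Longrightarrow> pwc (pdiff s G)"
  unfolding pwc_def
proof
  fix T assume "pws G" and T: "T \<in> melems M"
  then obtain g where g: "smooth1 g" "\<forall>y\<in>interior T. G y = g y" unfolding pws_def by blast
  then show "\<exists>h. continuous_on UNIV h \<and> (\<forall>y\<in>interior T. pdiff s G y = h y)"
    using pws_pdiff_eq[OF g] by (intro exI[of _ "pdiff s g"]) (auto simp: smooth1_def)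
qed

lemma pws_differentiable: "pws G \<Longrightarrow> T \<in> melems M \<Longrightarrow> y \<in> interior T \<Longrightarrow> G differentiable (at y)"
proof -
  assume "pws G" and T: "T \<in> melems M" and y: "y \<in> interior T"
  then obtain g where g: "smooth1 g" "\<forall>y\<in>interior T. G y = g y" unfolding pws_def by blast
  then have "(g has_derivative frechet_derivative g (at y)) (at y)"
    by (simp add: smooth1_def frechet_derivative_works[symmetric])
  then have "(G has_derivative frechet_derivative g (at y)) (at y)"
    by (rule has_derivative_transform_within_open[OF _ open_interior y]) (simp add: g(2))
  then show ?thesis by (auto simp: differentiable_def)
qed

section \<open>Integrals of piecewise continuous functions over elements and over the box\<close>

lemma negligible_frontier_elem: "T \<in> melems M \<Longrightarrow> negligible (frontier T)"
  using melems(4) by (rule negligible_convex_frontier)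

lemma elem_minus_frontier: "T \<in> melems M \<Longrightarrow> y \<in> T - frontier T \<Longrightarrow> y \<in> interior T"
  using closure_subset by (auto simp: frontier_def)

lemma continuous_set_integrable:
  fixes g :: "real ^ 'd \<Rightarrow> real"
  assumes "T \<in> melems M" "continuous_on UNIV g"
  shows "set_integrable lebesgue T g" "(LINT y:T|lebesgue. g y) = (LINT y|lborel. indicator T y * g y)"
proof -
  have i: "integrable lborel (\<lambda>z. indicator T z *\<^sub>R g z)"
    by (rule borel_integrable_compact[OF melems(3)[OF assms(1)] continuous_on_subset[OF assms(2) subset_UNIV]])
  then show "set_integrable lebesgue T g"
    unfolding set_integrable_def using integrable_completion borel_measurable_integrable by blast
  show "(LINT y:T|lebesgue. g y) = (LINT y|lborel. indicator T y * g y)"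
    unfolding set_lebesgue_integral_def using integral_completion[OF borel_measurable_integrable[OF i]] by simp
qed

text \<open>Element boundaries are null sets, and by completeness of Lebesgue measure
  \<open>G\<close> inherits measurability and integrability from its continuous
  representative.\<close>

lemma set_integral_cong_interior:
  assumes "T \<in> melems M" "pwc F" "\<And>y. y \<in> interior T \<Longrightarrow> G y = F y"
  shows "set_integrable lebesgue T G" "(LINT y:T|lebesgue. G y) = (LINT y:T|lebesgue. F y)"
proof -
  obtain f where f: "continuous_on UNIV f" "\<forall>y\<in>interior T. F y = f y" using assms unfolding pwc_def by blast
  note i = continuous_set_integrable(1)[OF assms(1) f(1)]
  note F = set_integral_spike[OF i negligible_frontier_elem[OF assms(1)]]
  have "F y = f y" "G y = f y" if "y \<in> T - frontier T" for y
    using elem_minus_frontier[OF assms(1) that] f assms(3) by auto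
  with F[of F] F[of G] show "set_integrable lebesgue T G" "(LINT y:T|lebesgue. G y) = (LINT y:T|lebesgue. F y)"
    by auto
qed

lemma pwc_integrable: "T \<in> melems M \<Longrightarrow> pwc F \<Longrightarrow> set_integrable lebesgue T F"
  by (rule set_integral_cong_interior(1)) auto

lemma pwc_integrable_mdom: "pwc F \<Longrightarrow> set_integrable lebesgue (mdom M) F"
proof -
  assume F: "pwc F"
  have "set_integrable lebesgue (\<Union>T\<in>melems M. T) F"
    using finite_melems pwc_integrable[OF _ F] melems(5)
    by (intro set_integrable_UN) (auto simp: borel_closed)
  then show ?thesis by (simp add: Union_melems)
qed

lemma pwc_integral_mdom:
  assumes F: "pwc F"
  shows "(LINT y:mdom M|lebesgue. F y) = (\<Sum>T\<in>melems M. LINT y:T|lebesgue. F y)"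
proof -
  have "(F has_integral (\<Sum>T\<in>melems M. LINT y:T|lebesgue. F y)) (\<Union> (melems M))"
  proof (rule has_integral_Union[OF finite_melems])
    show "(F has_integral (LINT y:T|lebesgue. F y)) T" if "T \<in> melems M" for T
      by (rule has_integral_set_lebesgue[OF pwc_integrable[OF that F]])
    show "pairwise (\<lambda>S S'. negligible (S \<inter> S')) (melems M)"
    proof (rule pairwiseI)
      fix S S' assume S: "S \<in> melems M" "S' \<in> melems M" "S \<noteq> S'"
      then have "interior (S \<inter> S') = {}" using interior_melems_disjoint by (auto simp: interior_Int)
      then show "negligible (S \<inter> S')"
        using S melems(4) by (simp add: negligible_convex_interior convex_Int)
    qed
  qed
  then show ?thesis
    using set_lebesgue_integral_eq_integral(2)[OF pwc_integrable_mdom[OF F]] by (simp add: Union_melems integral_unique)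
qed

text \<open>Traces are controlled on the relative interior only, and face integrals do not see the
  rest of \<open>e\<close>. The extension to the whole space is what \<open>plane_integral\<close>
  is applied to.\<close>

definition fcont :: "(real ^ 'd) set \<Rightarrow> (real ^ 'd \<Rightarrow> real) \<Rightarrow> bool" where
  "fcont e h \<longleftrightarrow> (\<exists>h0. continuous_on UNIV h0 \<and> (\<forall>y\<in>rel_interior e. h y = h0 y))"

lemma fcont_continuous: "continuous_on UNIV h \<Longrightarrow> fcont e h"
  unfolding fcont_def by blast

lemma fcont_add: "fcont e f \<Longrightarrow> fcont e g \<Longrightarrow> fcont e (\<lambda>y. f y + g y)"
  unfolding fcont_def by (elim exE, rule_tac x = "\<lambda>y. h0 y + h0a y" in exI) (auto intro: continuous_intros)

lemma fcont_diff: "fcont e f \<Longrightarrow> fcont e g \<Longrightarrow> fcont e (\<lambda>y. f y - g y)"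
  unfolding fcont_def by (elim exE, rule_tac x = "\<lambda>y. h0 y - h0a y" in exI) (auto intro: continuous_intros)

lemma fcont_mult: "fcont e f \<Longrightarrow> fcont e g \<Longrightarrow> fcont e (\<lambda>y. f y * g y)"
  unfolding fcont_def by (elim exE, rule_tac x = "\<lambda>y. h0 y * h0a y" in exI) (auto intro: continuous_intros)

lemma fcont_const: "fcont e (\<lambda>y. c)"
  by (rule fcont_continuous) simp

lemma fcont_sum: "(\<And>i. i \<in> I \<Longrightarrow> fcont e (f i)) \<Longrightarrow> fcont e (\<lambda>y. \<Sum>i\<in>I. f i y)"
  by (induction I rule: infinite_finite_induct) (auto intro: fcont_const fcont_add)

lemma face_integral_eq:
  assumes e: "e \<in> mfaces M" and h: "continuous_on UNIV h0" "\<And>y. y \<in> rel_interior e \<Longrightarrow> h y = h0 y"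
  shows "face_integral M e h = plane_integral (mnormal M e) (offset e) e h0"
  unfolding face_integral_def
  using norm_mnormal[OF e] face_facts(1,4)[OF e] sides_hyperplane[OF sides_shift_elem[OF e]] aff_dim_face[OF e] h
  by (intro flat_integral_eq(2)) auto

lemma face_integral_cong:
  assumes "e \<in> mfaces M" "fcont e g" "\<And>y. y \<in> rel_interior e \<Longrightarrow> h y = g y"
  shows "face_integral M e h = face_integral M e g"
proof -
  obtain h0 where "continuous_on UNIV h0" "\<forall>y\<in>rel_interior e. g y = h0 y" using assms(2) unfolding fcont_def by blast
  then show ?thesis using face_integral_eq[OF assms(1), of h0] assms(3) by simp
qed

lemma face_set_integrable:
  assumes e: "e \<in> mfaces M" and h: "fcont e h"
  shows "set_integrable lebesgue {y + t *\<^sub>R mnormal M e | y t. y \<in> e \<and> 0 \<le> t \<and> t \<le> 1}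
      (\<lambda>z. h (z - ((z - (SOME y. y \<in> e)) \<bullet> mnormal M e) *\<^sub>R mnormal M e))"
proof -
  obtain h0 where "continuous_on UNIV h0" "\<forall>y\<in>rel_interior e. h y = h0 y" using h unfolding fcont_def by blast
  then show ?thesis
    using norm_mnormal[OF e] face_facts(1,4)[OF e] sides_hyperplane[OF sides_shift_elem[OF e]] aff_dim_face[OF e]
    by (intro flat_integral_eq(1)) auto
qed

lemma face_integral_add:
  assumes "e \<in> mfaces M" "fcont e f" "fcont e g"
  shows "face_integral M e (\<lambda>y. f y + g y) = face_integral M e f + face_integral M e g"
  unfolding face_integral_def flat_integral_def
  using assms by (intro set_integral_add face_set_integrable)

lemma face_integral_diff:
  assumes "e \<in> mfaces M" "fcont e f" "fcont e g"
  shows "face_integral M e (\<lambda>y. f y - g y) = face_integral M e f - face_integral M e g"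
  unfolding face_integral_def flat_integral_def
  using assms by (intro set_integral_diff face_set_integrable)

lemma face_integral_cmult: "face_integral M e (\<lambda>y. c * f y) = c * face_integral M e f"
  unfolding face_integral_def flat_integral_def by (rule set_integral_mult_right)

lemma face_integral_sum:
  assumes "e \<in> mfaces M" "\<And>i. i \<in> I \<Longrightarrow> fcont e (f i)"
  shows "face_integral M e (\<lambda>y. \<Sum>i\<in>I. f i y) = (\<Sum>i\<in>I. face_integral M e (f i))"
proof -
  have zero: "face_integral M e (\<lambda>y. 0) = 0" using face_integral_cmult[of e 0 "\<lambda>_. 0"] by simp
  show ?thesis using assms(2)
  proof (induction I rule: infinite_finite_induct)
    case (insert x F)
    then show ?case using assms(1) by (simp add: face_integral_add fcont_sum)
  qed (simp_all add: zero)
qed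

section \<open>Traces, jumps and averages of piecewise continuous functions\<close>

lemma pwc_traces:
  assumes G: "pwc G" and e: "e \<in> mfaces M"
  obtains gm gp where "continuous_on UNIV gm" "continuous_on UNIV gp"
    "\<forall>w\<in>interior (elem e True). G w = gm w" "\<forall>w\<in>interior (elem e False). G w = gp w"
  using G shift_elem(2)[OF e] unfolding pwc_def by metis

lemma trace_minus_shift:
  fixes G gm :: "real ^ 'd \<Rightarrow> 'b::real_normed_vector"
  shows "e \<in> mfaces M \<Longrightarrow> y \<in> rel_interior e \<Longrightarrow> (\<forall>w\<in>interior (elem e True). G w = gm w) \<Longrightarrow>
    continuous_on UNIV gm \<Longrightarrow> trace_minus M e G y = gm (y - shift e True)"
  using traces_eq(1) sides_shift_elem by blast

lemma trace_plus_shift: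
  fixes G gp :: "real ^ 'd \<Rightarrow> 'b::real_normed_vector"
  shows "e \<in> mfaces M \<Longrightarrow> y \<in> rel_interior e \<Longrightarrow> (\<forall>w\<in>interior (elem e False). G w = gp w) \<Longrightarrow>
    continuous_on UNIV gp \<Longrightarrow> trace_plus M e G y = gp (y - shift e False)"
  using traces_eq(2) sides_shift_elem by blast

lemma fcont_traces:
  assumes G: "pwc G" and e: "e \<in> mfaces M"
  shows "fcont e (trace_minus M e G)" "fcont e (trace_plus M e G)"
proof -
  obtain gm gp where g: "continuous_on UNIV gm" "continuous_on UNIV gp"
    "\<forall>w\<in>interior (elem e True). G w = gm w" "\<forall>w\<in>interior (elem e False). G w = gp w"
    using pwc_traces[OF G e] .
  have "continuous_on UNIV (\<lambda>y. gm (y - shift e True))" "continuous_on UNIV (\<lambda>y. gp (y - shift e False))"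
    using g by (auto intro!: continuous_on_compose2[of UNIV gm] continuous_on_compose2[of UNIV gp] continuous_intros)
  then show "fcont e (trace_minus M e G)" "fcont e (trace_plus M e G)"
    unfolding fcont_def using trace_minus_shift[OF e _ g(3,1)] trace_plus_shift[OF e _ g(4,2)] by blast+
qed

lemma fcont_jump: "pwc G \<Longrightarrow> e \<in> mfaces M \<Longrightarrow> fcont e (jump M e G)"
  unfolding jump_def by (intro fcont_diff fcont_traces)

lemma fcont_avg: "pwc G \<Longrightarrow> e \<in> mfaces M \<Longrightarrow> fcont e (avg M e G)"
  unfolding avg_def real_scaleR_def by (intro fcont_mult fcont_const fcont_add fcont_traces)

text \<open>Calculus rules for \<open>Lim\<close> presuppose that the limits exist; here the
  continuous extensions of the pieces provide them.\<close>

lemma traces_binary: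
  fixes h :: "real \<Rightarrow> real \<Rightarrow> real"
  assumes "pwc F" "pwc G" "e \<in> mfaces M" "y \<in> rel_interior e"
    and h: "\<And>f g :: real ^ 'd \<Rightarrow> real. continuous_on UNIV f \<Longrightarrow> continuous_on UNIV g \<Longrightarrow> continuous_on UNIV (\<lambda>y. h (f y) (g y))"
  shows "trace_minus M e (\<lambda>y. h (F y) (G y)) y = h (trace_minus M e F y) (trace_minus M e G y)"
    "trace_plus M e (\<lambda>y. h (F y) (G y)) y = h (trace_plus M e F y) (trace_plus M e G y)"
proof -
  obtain fm fp where f: "continuous_on UNIV fm" "continuous_on UNIV fp"
    "\<forall>w\<in>interior (elem e True). F w = fm w" "\<forall>w\<in>interior (elem e False). F w = fp w"
    using pwc_traces[OF assms(1,3)] .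
  obtain gm gp where g: "continuous_on UNIV gm" "continuous_on UNIV gp"
    "\<forall>w\<in>interior (elem e True). G w = gm w" "\<forall>w\<in>interior (elem e False). G w = gp w"
    using pwc_traces[OF assms(2,3)] .
  note minus = trace_minus_shift[OF assms(3,4)] and plus = trace_plus_shift[OF assms(3,4)]
  show "trace_minus M e (\<lambda>y. h (F y) (G y)) y = h (trace_minus M e F y) (trace_minus M e G y)"
    unfolding minus[OF f(3,1)] minus[OF g(3,1)] by (rule minus[OF _ h[OF f(1) g(1)]]) (simp add: f g)
  show "trace_plus M e (\<lambda>y. h (F y) (G y)) y = h (trace_plus M e F y) (trace_plus M e G y)"
    unfolding plus[OF f(4,2)] plus[OF g(4,2)] by (rule plus[OF _ h[OF f(2) g(2)]]) (simp add: f g)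
qed

lemmas traces_add = traces_binary[where h = "(+)", OF _ _ _ _ continuous_on_add]
  and traces_mult = traces_binary[where h = times, OF _ _ _ _ continuous_on_mult]

lemma traces_const:
  fixes c :: real
  assumes "\<And>T y. T \<in> melems M \<Longrightarrow> y \<in> interior T \<Longrightarrow> G y = c" "e \<in> mfaces M" "y \<in> rel_interior e"
  shows "trace_minus M e G y = c" "trace_plus M e G y = c"
  using trace_minus_shift[OF assms(2,3), of G "\<lambda>_. c"] trace_plus_shift[OF assms(2,3), of G "\<lambda>_. c"]
    assms(1)[OF shift_elem(2)[OF assms(2)]] by auto

lemma jump_const: "e \<in> mfaces M \<Longrightarrow> y \<in> rel_interior e \<Longrightarrow> jump M e (\<lambda>y. c::real) y = 0"
  unfolding jump_def by (simp add: traces_const)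

text \<open>The product rule for jumps is exact because \<open>avg\<close> is the arithmetic mean of
  the two traces; this is where central averages matter.\<close>

lemma
  assumes "pwc F" "pwc G" "e \<in> mfaces M" "y \<in> rel_interior e"
  shows jump_add: "jump M e (\<lambda>y. F y + G y) y = jump M e F y + jump M e G y"
    and avg_add: "avg M e (\<lambda>y. F y + G y) y = avg M e F y + avg M e G y"
    and jump_mult: "jump M e (\<lambda>y. F y * G y) y = jump M e F y * avg M e G y + avg M e F y * jump M e G y"
  unfolding jump_def avg_def using assms by (simp_all add: traces_add traces_mult algebra_simps)

lemma
  assumes "pwc G" "e \<in> mfaces M" "y \<in> rel_interior e"
  shows jump_cmult: "jump M e (\<lambda>y. c * G y) y = c * jump M e G y"
    and avg_cmult: "avg M e (\<lambda>y. c * G y) y = c * avg M e G y"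
  unfolding jump_def avg_def using assms by (simp_all add: traces_mult[OF pwc_const] traces_const algebra_simps)

section \<open>The divergence theorem on the mesh and the discrete derivative\<close>

theorem sum_integral_pdiff:
  assumes "pws G"
  shows "(\<Sum>T\<in>melems M. LINT y:T|lebesgue. pdiff s G y)
    = (\<Sum>e\<in>mfaces M. face_integral M e (\<lambda>y. mnormal M e $ s * jump M e G y))"
proof -
  obtain g where g: "\<And>T. T \<in> melems M \<Longrightarrow> smooth1 (g T)" "\<And>T. T \<in> melems M \<Longrightarrow> \<forall>y\<in>interior T. G y = g T y"
    using assms unfolding pws_def by metis
  define HI where "HI p = plane_integral (cut_normal p) (cut_offset p) (cut p) (g (elem (fst p) (snd p)))" for p
  define h where "h p = (cut_normal p \<bullet> axis s 1) * HI p" for p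
  have elem: "(LINT y:T|lebesgue. pdiff s G y) = (\<Sum>p\<in>sides_of T. h p)"
    if T: "T \<in> melems M" for T
  proof -
    interpret fb: flat_boundary T "sides_of T" cut cut_normal cut_offset "axis s 1"
      by (rule flat_boundary_cut[OF T])
    have c: "continuous_on UNIV (pdiff s (g T))" using g(1)[OF T] by (simp add: smooth1_def)
    have "(LINT y:T|lebesgue. pdiff s G y) = (LINT y:T|lebesgue. pdiff s (g T) y)"
      using pws_pdiff_eq[OF g[OF T]] by (intro set_integral_cong_interior(2)[OF T pwc_continuous[OF c]])
    also have "\<dots> = (LINT y|lborel. indicator T y * pdiff s (g T) y)"
      by (rule continuous_set_integrable(2)[OF T c])
    also have "\<dots> = (\<Sum>p\<in>sides_of T. (cut_normal p \<bullet> axis s 1) *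
        plane_integral (cut_normal p) (cut_offset p) (cut p) (g T))"
      by (rule fb.integral_directional_derivative[OF smooth1_continuous[OF g(1)[OF T]] c smooth1_directional[OF g(1)[OF T]]])
    also have "\<dots> = (\<Sum>p\<in>sides_of T. h p)"
      by (intro sum.cong) (auto simp: h_def HI_def sides_of_def)
    finally show ?thesis .
  qed
  have face: "(\<Sum>\<sigma>\<in>UNIV. h (e, \<sigma>)) = face_integral M e (\<lambda>y. mnormal M e $ s * jump M e G y)"
    if e: "e \<in> mfaces M" for e
  proof -
    let ?g = "\<lambda>\<sigma> y. g (elem e \<sigma>) (y - shift e \<sigma>)"
    have cg: "continuous_on UNIV (g (elem e \<sigma>))" for \<sigma>
      using g(1)[OF shift_elem(2)[OF e]] by (rule smooth1_continuous)
    have cs: "continuous_on UNIV (?g \<sigma>)" for \<sigma>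
      by (intro continuous_on_compose2[OF cg] continuous_intros) auto
    have fi: "face_integral M e (?g \<sigma>) = plane_integral (mnormal M e) (offset e) e (?g \<sigma>)" for \<sigma>
      by (rule face_integral_eq[OF e cs]) simp
    have n: "norm (mnormal M e) = 1" and ce: "compact e" "compact (tile (- c) e)" for c
      using norm_mnormal[OF e] face_facts(2)[OF e] by (auto simp only: compact_translation)
    \<comment> \<open>Moving the cut back to \<open>e\<close> shifts the argument of the piece by
      \<open>shift e \<sigma>\<close>. On the plus side the normal is reversed as well, which leaves
      the prism integral unchanged.\<close>
    have HI: "HI (e, \<sigma>) = face_integral M e (?g \<sigma>)" for \<sigma>
      using plane_integral_uminus[OF n ce(2) cg, of "offset e - mnormal M e \<bullet> shift e \<sigma>"]
        plane_integral_translate[OF ce(1) cg]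
      unfolding HI_def fi by (cases \<sigma>) (simp_all only: cut_def cut_normal_def cut_offset_def fst_conv snd_conv Let_def if_True if_False)
    \<comment> \<open>The outward normals of the two sides are opposite, so the sum becomes a
      difference, which is the jump.\<close>
    have "(\<Sum>\<sigma>\<in>UNIV. h (e, \<sigma>)) = mnormal M e $ s * (face_integral M e (?g True) - face_integral M e (?g False))"
      by (simp add: UNIV_bool h_def HI cut_normal_def inner_axis algebra_simps)
    also have "\<dots> = face_integral M e (\<lambda>y. mnormal M e $ s * (?g True y - ?g False y))"
      using e cs by (simp only: face_integral_cmult face_integral_diff fcont_continuous)
    also have "\<dots> = face_integral M e (\<lambda>y. mnormal M e $ s * jump M e G y)"
    proof (rule face_integral_cong[OF e, symmetric])
      show "fcont e (\<lambda>y. mnormal M e $ s * (?g True y - ?g False y))"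
        using cs by (intro fcont_mult fcont_const fcont_diff fcont_continuous)
      fix y assume y: "y \<in> rel_interior e"
      show "mnormal M e $ s * jump M e G y = mnormal M e $ s * (?g True y - ?g False y)"
        unfolding jump_def trace_minus_shift[OF e y g(2)[OF shift_elem(2)[OF e]] cg]
          trace_plus_shift[OF e y g(2)[OF shift_elem(2)[OF e]] cg] ..
    qed
    finally show ?thesis .
  qed
  have "(\<Sum>T\<in>melems M. LINT y:T|lebesgue. pdiff s G y)
      = (\<Sum>T\<in>melems M. \<Sum>p\<in>sides_of T. h p)"
    by (intro sum.cong elem) simp
  \<comment> \<open>Every pair of a face and a side belongs to the boundary of exactly one
    element.\<close>
  also have "\<dots> = (\<Sum>p\<in>mfaces M \<times> UNIV. h p)"
    unfolding sides_of_def using finite_mfaces finite_melems shift_elem(2) by (intro sum.group) auto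
  also have "\<dots> = (\<Sum>e\<in>mfaces M. \<Sum>\<sigma>\<in>UNIV. h (e, \<sigma>))"
    by (simp add: sum.cartesian_product)
  also have "\<dots> = (\<Sum>e\<in>mfaces M. face_integral M e (\<lambda>y. mnormal M e $ s * jump M e G y))"
    by (intro sum.cong face) simp
  finally show ?thesis .
qed

abbreviation jump_avg :: "'d \<Rightarrow> (real ^ 'd) set \<Rightarrow> (real ^ 'd \<Rightarrow> real) \<Rightarrow> (real ^ 'd \<Rightarrow> real) \<Rightarrow> real ^ 'd \<Rightarrow> real" where
  "jump_avg s e U W y \<equiv> mnormal M e $ s * jump M e U y * avg M e W y"

abbreviation avg_jump :: "'d \<Rightarrow> (real ^ 'd) set \<Rightarrow> (real ^ 'd \<Rightarrow> real) \<Rightarrow> (real ^ 'd \<Rightarrow> real) \<Rightarrow> real ^ 'd \<Rightarrow> real" where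
  "avg_jump s e U W y \<equiv> mnormal M e $ s * avg M e U y * jump M e W y"

text \<open>This is the divergence theorem for the product of \<open>U\<close> and \<open>W\<close>,
  with the ordinary product rule inside the elements and the one for jumps on the faces.\<close>

theorem dhat_by_parts:
  assumes U: "pws U" and W: "pws W"
  shows "dhat M s U W = - (\<Sum>T\<in>melems M. LINT y:T|lebesgue. U y * pdiff s W y)
    + (\<Sum>e\<in>mfaces M. face_integral M e (avg_jump s e U W))"
proof -
  note c = pws_pwc[OF U] pws_pwc[OF W] pwc_pdiff[OF U, of s] pwc_pdiff[OF W, of s]
  have "(LINT y:T|lebesgue. pdiff s (\<lambda>y. U y * W y) y)
      = (LINT y:T|lebesgue. pdiff s U y * W y) + (LINT y:T|lebesgue. U y * pdiff s W y)" if T: "T \<in> melems M" for T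
  proof -
    have "(LINT y:T|lebesgue. pdiff s (\<lambda>y. U y * W y) y) = (LINT y:T|lebesgue. pdiff s U y * W y + U y * pdiff s W y)"
      using T c U W by (intro set_integral_cong_interior(2) pwc_add pwc_mult pdiff_mult) (auto intro: pws_differentiable)
    then show ?thesis using T c by (simp add: set_integral_add(2) pwc_integrable pwc_mult)
  qed
  then have 1: "(\<Sum>T\<in>melems M. LINT y:T|lebesgue. pdiff s (\<lambda>y. U y * W y) y)
      = (\<Sum>T\<in>melems M. LINT y:T|lebesgue. pdiff s U y * W y) + (\<Sum>T\<in>melems M. LINT y:T|lebesgue. U y * pdiff s W y)"
    by (simp add: sum.distrib)
  have "face_integral M e (\<lambda>y. mnormal M e $ s * jump M e (\<lambda>y. U y * W y) y)
      = face_integral M e (jump_avg s e U W)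
        + face_integral M e (avg_jump s e U W)" if e: "e \<in> mfaces M" for e
  proof -
    have f: "fcont e (jump_avg s e U W)"
        "fcont e (avg_jump s e U W)"
      using e c by (auto intro!: fcont_mult fcont_const fcont_jump fcont_avg)
    have "face_integral M e (\<lambda>y. mnormal M e $ s * jump M e (\<lambda>y. U y * W y) y)
        = face_integral M e (\<lambda>y. jump_avg s e U W y + avg_jump s e U W y)"
      using e c f by (intro face_integral_cong fcont_add) (auto simp: jump_mult algebra_simps)
    then show ?thesis using face_integral_add[OF e f] by simp
  qed
  then have 2: "(\<Sum>e\<in>mfaces M. face_integral M e (\<lambda>y. mnormal M e $ s * jump M e (\<lambda>y. U y * W y) y))
      = (\<Sum>e\<in>mfaces M. face_integral M e (jump_avg s e U W))
        + (\<Sum>e\<in>mfaces M. face_integral M e (avg_jump s e U W))"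
    by (simp add: sum.distrib)
  show ?thesis
    using sum_integral_pdiff[OF pws_mult[OF U W], of s] unfolding 1 2 dhat_def by linarith
qed

text \<open>Against the constant 1 only the elementwise derivatives and the jumps of
  \<open>U\<close> remain, and these balance by the divergence theorem. As a representative of 1,
  \<open>W\<close> is controlled in element interiors only.\<close>

lemma dhat_unit:
  assumes U: "pws U" and W: "pws W" "\<And>T y. T \<in> melems M \<Longrightarrow> y \<in> interior T \<Longrightarrow> W y = 1"
  shows "dhat M s U W = 0"
proof -
  note c = pws_pwc[OF U] pwc_pdiff[OF U, of s]
  have "(\<Sum>T\<in>melems M. LINT y:T|lebesgue. pdiff s U y * W y) = (\<Sum>T\<in>melems M. LINT y:T|lebesgue. pdiff s U y)"
    using c W(2) by (intro sum.cong set_integral_cong_interior(2)) auto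
  moreover have "(\<Sum>e\<in>mfaces M. face_integral M e (jump_avg s e U W))
      = (\<Sum>e\<in>mfaces M. face_integral M e (\<lambda>y. mnormal M e $ s * jump M e U y))"
    using c traces_const[of W, OF W(2)]
    by (intro sum.cong face_integral_cong fcont_mult fcont_const fcont_jump) (auto simp: avg_def)
  ultimately show ?thesis unfolding dhat_def using sum_integral_pdiff[OF U] by simp
qed

text \<open>Scaling and addition in one rule serve as the induction step for finite sums.\<close>

lemma dhat_axpy_left:
  assumes "pws U" "pws V" "pwc W"
  shows "dhat M s (\<lambda>y. c * U y + V y) W = c * dhat M s U W + dhat M s V W"
proof -
  note p = pws_pwc[OF assms(1)] pws_pwc[OF assms(2)] pwc_pdiff[OF assms(1), of s] pwc_pdiff[OF assms(2), of s] assms(3)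
  have "(LINT y:T|lebesgue. pdiff s (\<lambda>y. c * U y + V y) y * W y)
      = c * (LINT y:T|lebesgue. pdiff s U y * W y) + (LINT y:T|lebesgue. pdiff s V y * W y)" if T: "T \<in> melems M" for T
  proof -
    have "(LINT y:T|lebesgue. pdiff s (\<lambda>y. c * U y + V y) y * W y)
        = (LINT y:T|lebesgue. c * (pdiff s U y * W y) + pdiff s V y * W y)"
      using T p assms by (intro set_integral_cong_interior(2) pwc_add pwc_mult pwc_cmult)
        (auto simp: pdiff_add pdiff_mult pdiff_const pws_differentiable algebra_simps)
    then show ?thesis using T p by (simp add: set_integral_add(2) pwc_integrable pwc_mult pwc_cmult)
  qed
  moreover have "face_integral M e (jump_avg s e (\<lambda>y. c * U y + V y) W)
      = c * face_integral M e (jump_avg s e U W)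
        + face_integral M e (jump_avg s e V W)" if e: "e \<in> mfaces M" for e
  proof -
    have f: "fcont e (\<lambda>y. c * (jump_avg s e U W y))"
        "fcont e (jump_avg s e V W)"
      using e p by (auto intro!: fcont_mult fcont_const fcont_jump fcont_avg)
    have "face_integral M e (jump_avg s e (\<lambda>y. c * U y + V y) W) = face_integral M e
        (\<lambda>y. c * (jump_avg s e U W y) + jump_avg s e V W y)"
      using e p f by (intro face_integral_cong fcont_add) (auto simp: jump_add jump_cmult pwc_cmult algebra_simps)
    then show ?thesis using face_integral_add[OF e f] by (simp add: face_integral_cmult)
  qed
  ultimately show ?thesis by (simp add: dhat_def sum.distrib sum_distrib_left algebra_simps)
qed

lemma dhat_axpy_right:
  assumes "pws U" "pwc V" "pwc W"
  shows "dhat M s U (\<lambda>y. c * V y + W y) = c * dhat M s U V + dhat M s U W"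
proof -
  note p = pws_pwc[OF assms(1)] pwc_pdiff[OF assms(1), of s] assms(2,3)
  have "(LINT y:T|lebesgue. pdiff s U y * (c * V y + W y))
      = c * (LINT y:T|lebesgue. pdiff s U y * V y) + (LINT y:T|lebesgue. pdiff s U y * W y)" if T: "T \<in> melems M" for T
    using T p by (simp add: distrib_left mult.left_commute[of _ c] set_integral_add(2) pwc_integrable pwc_mult pwc_cmult)
  moreover have "face_integral M e (jump_avg s e U (\<lambda>y. c * V y + W y))
      = c * face_integral M e (jump_avg s e U V)
        + face_integral M e (jump_avg s e U W)" if e: "e \<in> mfaces M" for e
  proof -
    have f: "fcont e (\<lambda>y. c * (jump_avg s e U V y))"
        "fcont e (jump_avg s e U W)"
      using e p by (auto intro!: fcont_mult fcont_const fcont_jump fcont_avg)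
    have "face_integral M e (jump_avg s e U (\<lambda>y. c * V y + W y)) = face_integral M e
        (\<lambda>y. c * (jump_avg s e U V y) + jump_avg s e U W y)"
      using e p f by (intro face_integral_cong fcont_add) (auto simp: avg_add avg_cmult pwc_cmult algebra_simps)
    then show ?thesis using face_integral_add[OF e f] by (simp add: face_integral_cmult)
  qed
  ultimately show ?thesis by (simp add: dhat_def sum.distrib sum_distrib_left algebra_simps)
qed

lemma dhat_sum_left:
  assumes "\<And>i. i \<in> I \<Longrightarrow> pws (U i)" "pws W"
  shows "dhat M s (\<lambda>y. \<Sum>i\<in>I. c i * U i y) W = (\<Sum>i\<in>I. c i * dhat M s (U i) W)"
proof -
  have zero: "dhat M s (\<lambda>y. 0) W = 0"
    using dhat_axpy_left[OF pws_const[of 0] pws_const[of 0] pws_pwc[OF assms(2)], of s 1] by simp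
  show ?thesis using assms(1)
    by (induction I rule: infinite_finite_induct)
      (simp_all add: zero dhat_axpy_left pws_sum pws_cmult pws_pwc[OF assms(2)])
qed

lemma dhat_sum_right:
  assumes "pws U" "\<And>i. i \<in> I \<Longrightarrow> pws (W i)"
  shows "dhat M s U (\<lambda>y. \<Sum>i\<in>I. c i * W i y) = (\<Sum>i\<in>I. c i * dhat M s U (W i))"
proof -
  have zero: "dhat M s U (\<lambda>y. 0) = 0"
    using dhat_axpy_right[OF assms(1) pwc_const[of 0] pwc_const[of 0], of s 1] by simp
  show ?thesis using assms(2)
    by (induction I rule: infinite_finite_induct)
      (simp_all add: zero dhat_axpy_right[OF assms(1)] pwc_sum pwc_cmult pws_pwc)
qed

end

section \<open>Inner products, spans and expansions\<close>

context pmesh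
begin

lemma pwc_set_integral_sum:
  assumes "T \<in> melems M" "\<And>i. i \<in> I \<Longrightarrow> pwc (f i)"
  shows "(LINT y:T|lebesgue. \<Sum>i\<in>I. c i * f i y) = (\<Sum>i\<in>I. c i * (LINT y:T|lebesgue. f i y))"
  using assms(2)
proof (induction I rule: infinite_finite_induct)
  case (insert x F)
  then have "(LINT y:T|lebesgue. c x * f x y + (\<Sum>i\<in>F. c i * f i y))
      = (LINT y:T|lebesgue. c x * f x y) + (LINT y:T|lebesgue. \<Sum>i\<in>F. c i * f i y)"
    using assms(1) by (intro set_integral_add pwc_integrable pwc_cmult pwc_sum) auto
  then show ?case using insert by simp
qed simp_all

lemma integral_mdom_cong:
  assumes "pwc F" "pwc G" "\<And>T y. T \<in> melems M \<Longrightarrow> y \<in> interior T \<Longrightarrow> F y = G y"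
  shows "(LINT y:mdom M|lebesgue. F y) = (LINT y:mdom M|lebesgue. G y)"
  unfolding pwc_integral_mdom[OF assms(1)] pwc_integral_mdom[OF assms(2)]
  using assms by (intro sum.cong set_integral_cong_interior(2)) auto

lemma integral_mdom_sum:
  assumes "\<And>i. i \<in> I \<Longrightarrow> pwc (f i)"
  shows "(LINT y:mdom M|lebesgue. \<Sum>i\<in>I. c i * f i y) = (\<Sum>i\<in>I. c i * (LINT y:mdom M|lebesgue. f i y))"
proof -
  have "(LINT y:mdom M|lebesgue. \<Sum>i\<in>I. c i * f i y) = (\<Sum>T\<in>melems M. \<Sum>i\<in>I. c i * (LINT y:T|lebesgue. f i y))"
    using assms by (simp add: pwc_integral_mdom pwc_sum pwc_cmult pwc_set_integral_sum)
  also have "\<dots> = (\<Sum>i\<in>I. c i * (\<Sum>T\<in>melems M. LINT y:T|lebesgue. f i y))"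
    by (subst sum.swap) (simp add: sum_distrib_left)
  also have "\<dots> = (\<Sum>i\<in>I. c i * (LINT y:mdom M|lebesgue. f i y))"
    using assms by (intro sum.cong) (simp_all add: pwc_integral_mdom)
  finally show ?thesis .
qed

lemma ip_commute: "ip M f g = ip M g f"
  unfolding ip_def by (simp add: mult.commute)

lemma ipw_commute: "ipw M f g = ipw M g f"
  unfolding ipw_def by (simp add: mult.commute)

lemma ip_cong:
  assumes "pwc f" "pwc g" "pwc g'" "\<And>T y. T \<in> melems M \<Longrightarrow> y \<in> interior T \<Longrightarrow> g y = g' y"
  shows "ip M f g = ip M f g'"
  unfolding ip_def using assms by (intro integral_mdom_cong pwc_mult) auto

lemma ip_sum:
  assumes "pwc f" "\<And>i. i \<in> I \<Longrightarrow> pwc (g i)"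
  shows "ip M f (\<lambda>y. \<Sum>i\<in>I. c i * g i y) = (\<Sum>i\<in>I. c i * ip M f (g i))"
proof -
  have "ip M f (\<lambda>y. \<Sum>i\<in>I. c i * g i y) = (LINT y:mdom M|lebesgue. \<Sum>i\<in>I. c i * (f y * g i y))"
    unfolding ip_def by (simp add: sum_distrib_left mult_ac)
  also have "\<dots> = (\<Sum>i\<in>I. c i * ip M f (g i))"
    unfolding ip_def using assms by (intro integral_mdom_sum pwc_mult) auto
  finally show ?thesis .
qed

lemma ipw_eq_ip: "ipw M f g = ip M f (\<lambda>v. g v * weight v)"
  unfolding ipw_def ip_def by (simp add: mult.assoc)

lemma pws_weight: "pws weight"
  by (intro pws_smooth1 smooth1_weight)

lemma ipw_sum:
  assumes "pwc f" "\<And>i. i \<in> I \<Longrightarrow> pwc (g i)"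
  shows "ipw M f (\<lambda>y. \<Sum>i\<in>I. c i * g i y) = (\<Sum>i\<in>I. c i * ipw M f (g i))"
proof -
  have "ipw M f (\<lambda>y. \<Sum>i\<in>I. c i * g i y) = ip M f (\<lambda>y. \<Sum>i\<in>I. c i * (g i y * weight y))"
    unfolding ipw_eq_ip by (simp add: sum_distrib_left sum_distrib_right mult_ac)
  also have "\<dots> = (\<Sum>i\<in>I. c i * ip M f (\<lambda>y. g i y * weight y))"
    using assms pws_pwc[OF pws_weight] by (intro ip_sum pwc_mult) auto
  finally show ?thesis unfolding ipw_eq_ip .
qed

lemma ipw_cong:
  assumes "pwc f" "pwc g" "pwc g'" "\<And>T y. T \<in> melems M \<Longrightarrow> y \<in> interior T \<Longrightarrow> g y = g' y"
  shows "ipw M f g = ipw M f g'"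
  unfolding ipw_eq_ip using assms pws_pwc[OF pws_weight] by (intro ip_cong pwc_mult) auto

text \<open>The points of an element interior where the continuous pieces differ form an open set,
  which has positive measure unless it is empty. Statements about almost every point thus become
  statements about every interior point.\<close>

lemma AE_eq_interior:
  assumes "pwc F" "pwc G" and ae: "AE y in lebesgue_on (mdom M). F y = G y"
    and T: "T \<in> melems M" and y: "y \<in> interior T"
  shows "F y = G y"
proof (rule ccontr)
  assume ne: "F y \<noteq> G y"
  obtain f where f: "continuous_on UNIV f" "\<forall>y\<in>interior T. F y = f y" using assms(1) T unfolding pwc_def by blast
  obtain g where g: "continuous_on UNIV g" "\<forall>y\<in>interior T. G y = g y" using assms(2) T unfolding pwc_def by blast
  define W where "W = interior T \<inter> {y. f y \<noteq> g y}"
  have "open W"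
    unfolding W_def using f g by (intro open_Int open_interior open_Collect_neq)
  moreover have "W \<noteq> {}" using y ne f g by (auto simp: W_def)
  ultimately have "\<not> negligible W" using open_not_negligible by blast
  moreover have "mdom M \<in> sets lebesgue" by (simp add: mdom_def)
  then have "AE y in lebesgue. y \<in> mdom M \<longrightarrow> F y = G y"
    using ae by (simp add: AE_restrict_space_iff)
  then have "AE y in lebesgue. y \<notin> W"
  proof eventually_elim
    case (elim z)
    have "z \<in> W \<Longrightarrow> z \<in> mdom M" using melems(6)[OF T] interior_subset by (auto simp: W_def)
    then show ?case using elim f g by (auto simp: W_def)
  qed
  then have "W \<in> null_sets lebesgue"
    using \<open>open W\<close> by (subst AE_iff_null_sets) auto
  ultimately show False by (simp add: negligible_iff_null_sets)
qed

text \<open>In \<open>in_span\<close> the sum runs over a set of functions; injectivity of the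
  family turns it into a sum over indices.\<close>

lemma in_span_interior:
  assumes "in_span (mdom M) (B ` I) g" "inj_on B I" "\<And>k. k \<in> I \<Longrightarrow> pwc (B k)" "pwc g"
  obtains c where "\<And>T y. T \<in> melems M \<Longrightarrow> y \<in> interior T \<Longrightarrow> g y = (\<Sum>k\<in>I. c k * B k y)"
proof -
  obtain c where c: "AE y in lebesgue_on (mdom M). g y = (\<Sum>b\<in>B ` I. c b * b y)"
    using assms(1) unfolding in_span_def by blast
  have eq: "(\<lambda>y. \<Sum>b\<in>B ` I. c b * b y) = (\<lambda>y. \<Sum>k\<in>I. c (B k) * B k y)"
    using assms(2) by (simp add: sum.reindex)
  have "pwc (\<lambda>y. \<Sum>k\<in>I. c (B k) * B k y)" using assms(3) by (intro pwc_sum pwc_cmult) auto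
  moreover have "AE y in lebesgue_on (mdom M). g y = (\<Sum>k\<in>I. c (B k) * B k y)"
    using c unfolding fun_cong[OF eq] .
  ultimately show thesis by (intro that[of "\<lambda>k. c (B k)"] AE_eq_interior[OF assms(4)])
qed

lemma orthonormal_x_inj: "orthonormal_x M I B \<Longrightarrow> inj_on B I"
proof (rule inj_onI, rule ccontr)
  fix i j assume o: "orthonormal_x M I B" and ij: "i \<in> I" "j \<in> I" "B i = B j" "i \<noteq> j"
  have "ip M (B i) (B i) = 1" "ip M (B i) (B j) = 0" using o ij(1,2,4) by (simp_all add: orthonormal_x_def)
  then show False using ij(3) by simp
qed

lemma orthonormal_v_inj: "orthonormal_v M I B \<Longrightarrow> inj_on B I"
proof (rule inj_onI, rule ccontr)
  fix i j assume o: "orthonormal_v M I B" and ij: "i \<in> I" "j \<in> I" "B i = B j" "i \<noteq> j"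
  have "ipw M (B i) (B i) = 1" "ipw M (B i) (B j) = 0" using o ij(1,2,4) by (simp_all add: orthonormal_v_def)
  then show False using ij(3) by simp
qed

lemma orthonormal_expansion:
  assumes o: "orthonormal_x M I B" and "finite I" and B: "\<And>k. k \<in> I \<Longrightarrow> pwc (B k)" and g: "pwc g"
    and "in_span (mdom M) (B ` I) g" and T: "T \<in> melems M" "y \<in> interior T"
  shows "g y = (\<Sum>k\<in>I. ip M (B k) g * B k y)"
proof -
  obtain c where c: "\<And>T y. T \<in> melems M \<Longrightarrow> y \<in> interior T \<Longrightarrow> g y = (\<Sum>k\<in>I. c k * B k y)"
    using in_span_interior[OF assms(5) orthonormal_x_inj[OF o] B g] by blast
  have "ip M (B k) g = c k" if k: "k \<in> I" for k
  proof -
    have "ip M (B k) g = ip M (B k) (\<lambda>y. \<Sum>l\<in>I. c l * B l y)"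
      using c B g k by (intro ip_cong pwc_sum pwc_cmult) auto
    also have "\<dots> = (\<Sum>l\<in>I. c l * ip M (B k) (B l))" using B k by (intro ip_sum) auto
    also have "\<dots> = (\<Sum>l\<in>I. if l = k then c l else 0)"
      using o k by (intro sum.cong) (auto simp: orthonormal_x_def)
    also have "\<dots> = c k" using \<open>finite I\<close> k by simp
    finally show ?thesis .
  qed
  then show ?thesis using c[OF T] by simp
qed

lemma one_dg_space: "(\<lambda>y. 1) \<in> dg_space M k"
proof -
  \<comment> \<open>A sum over an infinite set is 0 by convention, so the set of exponents must be
    finite for the constant term to survive.\<close>
  have fin: "finite {\<alpha>::'d \<Rightarrow> nat. (\<Sum>i\<in>UNIV. \<alpha> i) \<le> k}"
  proof (rule finite_subset)
    show "{\<alpha>::'d \<Rightarrow> nat. (\<Sum>i\<in>UNIV. \<alpha> i) \<le> k} \<subseteq> PiE UNIV (\<lambda>_. {..k})"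
    proof
      fix \<alpha> :: "'d \<Rightarrow> nat" assume "\<alpha> \<in> {\<alpha>. (\<Sum>i\<in>UNIV. \<alpha> i) \<le> k}"
      then have "\<alpha> i \<le> k" for i using member_le_sum[of i UNIV \<alpha>] by simp
      then show "\<alpha> \<in> PiE UNIV (\<lambda>_. {..k})" by auto
    qed
  qed (auto intro!: finite_PiE)
  have "(\<lambda>y::real^'d. 1::real) = (\<lambda>y. \<Sum>\<alpha> | (\<Sum>i\<in>UNIV. \<alpha> i) \<le> k. (if \<alpha> = (\<lambda>_. 0) then 1 else 0) * (\<Prod>i\<in>UNIV. y $ i ^ \<alpha> i))"
    (is "_ = (\<lambda>y. sum (?f y) _)")
  proof
    fix y :: "real^'d"
    have "sum (?f y) {\<alpha>. (\<Sum>i\<in>UNIV. \<alpha> i) \<le> k} = (\<Sum>\<alpha> | (\<Sum>i\<in>UNIV. (\<alpha> :: 'd \<Rightarrow> nat) i) \<le> k. if \<alpha> = (\<lambda>_. 0) then 1 else 0)"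
      by (intro sum.cong) auto
    then show "1 = sum (?f y) {\<alpha>. (\<Sum>i\<in>UNIV. \<alpha> i) \<le> k}" using fin by simp
  qed
  then have "poly_deg_le k (\<lambda>y::real^'d. 1)"
    unfolding poly_deg_le_def by (intro exI[of _ "\<lambda>\<alpha>. if \<alpha> = (\<lambda>_. 0) then 1 else 0"])
  then show ?thesis unfolding dg_space_def by blast
qed

lemma zero_dg_space: "(\<lambda>y. 0) \<in> dg_space M k"
proof -
  have "poly_deg_le k (\<lambda>y::real^'d. 0)"
    unfolding poly_deg_le_def by (intro exI[of _ "\<lambda>\<alpha>. 0"]) simp
  then show ?thesis unfolding dg_space_def by blast
qed

end

text \<open>Lebesgue measure on the product space is a completion and not a product measure, so
  Fubini is applied to the Borel measures and the result is completed again on each factor.\<close>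

lemma AE_lebesgue_on_product:
  fixes A B :: "(real ^ 'd::finite) set"
  assumes "AE (x, v) in lebesgue_on (A \<times> B). P x v" and A: "A \<in> sets borel" and B: "B \<in> sets borel"
  shows "AE x in lebesgue_on A. AE v in lebesgue_on B. P x v"
proof -
  have AB: "A \<times> B \<in> sets lebesgue" using A B by (intro sets_completionI_sets) (simp add: borel_prod[symmetric])
  have "AE z in lebesgue. z \<in> A \<times> B \<longrightarrow> (case z of (x, v) \<Rightarrow> P x v)"
    using assms(1) AB by (simp add: AE_restrict_space_iff)
  then have "AE z in lborel \<Otimes>\<^sub>M lborel. z \<in> A \<times> B \<longrightarrow> (case z of (x, v) \<Rightarrow> P x v)"
    unfolding lborel_prod by (simp only: AE_completion_iff)
  from lborel_pair.AE_pair[OF this]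
  have "AE x in lborel. AE v in lborel. (x, v) \<in> A \<times> B \<longrightarrow> P x v" by simp
  then have "AE x in lborel. x \<in> A \<longrightarrow> (AE v in lebesgue_on B. P x v)"
  proof eventually_elim
    case (elim x)
    have "AE v in lebesgue. v \<in> B \<longrightarrow> P x v" if "x \<in> A"
      using elim that by (simp add: AE_completion_iff)
    then show ?case using B by (simp add: AE_restrict_space_iff)
  qed
  then have "AE x in lebesgue. x \<in> A \<longrightarrow> (AE v in lebesgue_on B. P x v)" by (rule AE_completion)
  then show ?thesis using A by (simp add: AE_restrict_space_iff)
qed

section \<open>One step of the integrator\<close>

text \<open>\<open>Lim\<close> of a vector-valued function is not componentwise by definition; it
  becomes so here because all components extend continuously from either side.\<close>

lemma (in pmesh) avg_component:
  fixes C :: "real ^ 'd \<Rightarrow> real ^ 'k"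
  assumes C: "\<And>s. pwc (\<lambda>x. C x $ s)" and e: "e \<in> mfaces M" and y: "y \<in> rel_interior e"
  shows "avg M e C y $ s = avg M e (\<lambda>x. C x $ s) y"
proof -
  have "\<forall>s. \<exists>g. continuous_on UNIV (fst g) \<and> continuous_on UNIV (snd g) \<and>
      (\<forall>w\<in>interior (elem e True). C w $ s = fst g w) \<and> (\<forall>w\<in>interior (elem e False). C w $ s = snd g w)"
  proof
    fix s
    obtain gm gp where "continuous_on UNIV gm" "continuous_on UNIV gp"
      "\<forall>w\<in>interior (elem e True). C w $ s = gm w" "\<forall>w\<in>interior (elem e False). C w $ s = gp w"
      using pwc_traces[OF C e] .
    then show "\<exists>g. continuous_on UNIV (fst g) \<and> continuous_on UNIV (snd g) \<and>
      (\<forall>w\<in>interior (elem e True). C w $ s = fst g w) \<and> (\<forall>w\<in>interior (elem e False). C w $ s = snd g w)"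
      by (intro exI[of _ "(gm, gp)"]) simp
  qed
  then obtain g where g: "\<And>s. continuous_on UNIV (fst (g s))" "\<And>s. continuous_on UNIV (snd (g s))"
      "\<And>s. \<forall>w\<in>interior (elem e True). C w $ s = fst (g s) w" "\<And>s. \<forall>w\<in>interior (elem e False). C w $ s = snd (g s) w"
    by metis
  have "trace_minus M e C y = (\<chi> s. fst (g s) (y - shift e True))"
    using g by (intro trace_minus_shift[OF e y, of C "\<lambda>w. \<chi> s. fst (g s) w"] continuous_on_vec_lambda) (auto simp: vec_eq_iff)
  moreover have "trace_plus M e C y = (\<chi> s. snd (g s) (y - shift e False))"
    using g by (intro trace_plus_shift[OF e y, of C "\<lambda>w. \<chi> s. snd (g s) w"] continuous_on_vec_lambda) (auto simp: vec_eq_iff)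
  ultimately show ?thesis
    unfolding avg_def trace_minus_shift[OF e y g(3,1)] trace_plus_shift[OF e y g(4,2)] by simp
qed

text \<open>The coefficients \<open>u\<close> of the constant 1 are a parameter because they must be
  the same for the states before and after a step.\<close>

locale dg_state = X: pmesh Mx + V: pmesh Mv for Mx Mv :: "'d::finite mesh" +
  fixes p q m :: nat and U :: "nat \<Rightarrow> real ^ 'd \<Rightarrow> real" and u :: "nat \<Rightarrow> real" and st :: "'d lr_state"
  assumes state: "is_state Mx Mv p q m U st"
    and unit: "\<And>T v. T \<in> melems Mv \<Longrightarrow> v \<in> interior T \<Longrightarrow> (\<Sum>a=1..m. u a * U a v) = 1"
begin

abbreviation "r \<equiv> srank st"
abbreviation "K \<equiv> Kfun st"

section \<open>Charge and current of a low-rank state\<close>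

lemma m_le: "m \<le> r"
  using state by (simp add: is_state_def)

lemma sX_dg: "i \<in> {1..r} \<Longrightarrow> sX st i \<in> dg_space Mx p" and sV_dg: "i \<in> {1..r} \<Longrightarrow> sV st i \<in> dg_space Mv q"
  using state by (simp_all add: is_state_def)

lemma sX_pws: "i \<in> {1..r} \<Longrightarrow> X.pws (sX st i)" and sV_pws: "i \<in> {1..r} \<Longrightarrow> V.pws (sV st i)"
  using sX_dg sV_dg X.pws_dg_space V.pws_dg_space by blast+

lemmas sX_pwc = X.pws_pwc[OF sX_pws] and sV_pwc = V.pws_pwc[OF sV_pws]

lemma K_pws: "X.pws (K j)"
proof -
  have "K j = (\<lambda>x. \<Sum>i=1..r. scoef st i j * sX st i x)" by (auto simp: Kfun_def mult.commute)
  then show ?thesis using sX_pws by (auto intro!: X.pws_sum X.pws_cmult)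
qed

lemmas K_pwc = X.pws_pwc[OF K_pws]

lemma sV_U: "a \<in> {1..m} \<Longrightarrow> sV st a = U a"
  using state by (simp add: is_state_def)

lemma U_pws: "a \<in> {1..m} \<Longrightarrow> V.pws (U a)"
  using sV_pws[of a] sV_U[of a] m_le by simp

lemmas U_pwc = V.pws_pwc[OF U_pws]

lemma ipw_sV_U: "a \<in> {1..m} \<Longrightarrow> j \<in> {1..r} \<Longrightarrow> ipw Mv (sV st j) (U a) = (if j = a then 1 else 0)"
proof -
  assume a: "a \<in> {1..m}" and j: "j \<in> {1..r}"
  have "orthonormal_v Mv {1..r} (sV st)" using state by (simp add: is_state_def)
  moreover have "a \<in> {1..r}" using a m_le by auto
  ultimately have "ipw Mv (sV st j) (sV st a) = (if j = a then 1 else 0)" using j unfolding orthonormal_v_def by blast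
  then show ?thesis by (simp only: sV_U[OF a])
qed

text \<open>Multiplying by 1, written through the \<open>U a\<close>, turns a moment into weighted
  inner products with the fixed velocity functions.\<close>

lemma integral_weight:
  assumes W: "V.pwc W"
  shows "(LINT v:mdom Mv|lebesgue. W v * weight v) = (\<Sum>a=1..m. u a * ipw Mv W (U a))"
proof -
  note w = V.pws_pwc[OF V.pws_weight]
  have "(LINT v:mdom Mv|lebesgue. W v * weight v) = (LINT v:mdom Mv|lebesgue. W v * (\<Sum>a=1..m. u a * U a v) * weight v)"
    using W w U_pwc unit by (intro V.integral_mdom_cong V.pwc_mult V.pwc_sum V.pwc_cmult) auto
  also have "\<dots> = ipw Mv W (\<lambda>v. \<Sum>a=1..m. u a * U a v)" by (simp add: ipw_def)
  also have "\<dots> = (\<Sum>a=1..m. u a * ipw Mv W (U a))" using W U_pwc by (intro V.ipw_sum) auto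
  finally show ?thesis .
qed

lemma lr_fun_K: "lr_fun st (x, v) = (\<Sum>j=1..r. K j x * (sV st j v * weight v))"
  unfolding lr_fun_def Kfun_def
  by (simp, subst sum.swap) (simp add: sum_distrib_left sum_distrib_right mult_ac)

text \<open>By orthonormality only the first \<open>m\<close> columns carry charge.\<close>

lemma charge_eq: "charge Mv (lr_fun st) x = (\<Sum>a=1..m. u a * K a x)"
proof -
  note w = V.pws_pwc[OF V.pws_weight]
  have "charge Mv (lr_fun st) x = (\<Sum>j=1..r. K j x * (LINT v:mdom Mv|lebesgue. sV st j v * weight v))"
    unfolding charge_def lr_fun_K using sV_pwc w by (intro V.integral_mdom_sum V.pwc_mult) auto
  also have "\<dots> = (\<Sum>j=1..r. \<Sum>a=1..m. if j = a then u a * K a x else 0)"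
  proof (intro sum.cong refl)
    fix j assume j: "j \<in> {1..r}"
    have "K j x * (LINT v:mdom Mv|lebesgue. sV st j v * weight v) = (\<Sum>a=1..m. K j x * (u a * ipw Mv (sV st j) (U a)))"
      by (simp add: integral_weight[OF sV_pwc[OF j]] sum_distrib_left)
    also have "\<dots> = (\<Sum>a=1..m. if j = a then u a * K a x else 0)"
      using ipw_sV_U[OF _ j] by (intro sum.cong) auto
    finally show "K j x * (LINT v:mdom Mv|lebesgue. sV st j v * weight v) = (\<Sum>a=1..m. if j = a then u a * K a x else 0)" .
  qed
  also have "\<dots> = (\<Sum>a=1..m. \<Sum>j=1..r. if j = a then u a * K a x else 0)" by (rule sum.swap)
  also have "\<dots> = (\<Sum>a=1..m. u a * K a x)" using m_le by (intro sum.cong) auto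
  finally show ?thesis .
qed

lemma charge_pws: "X.pws (charge Mv (lr_fun st))"
proof -
  have "charge Mv (lr_fun st) = (\<lambda>x. \<Sum>a=1..m. u a * K a x)" by (intro ext charge_eq)
  then show ?thesis using K_pws by (auto intro!: X.pws_sum X.pws_cmult)
qed

text \<open>The coefficients of the current in the functions \<open>K j\<close>. All columns can
  contribute, since multiplication by \<open>v $ s\<close> may lead out of the span of the
  \<open>U a\<close>.\<close>

definition \<beta> :: "'d \<Rightarrow> nat \<Rightarrow> real" where
  "\<beta> s j = (\<Sum>a=1..m. u a * matAx Mv (sV st) s a j)"

lemma current_eq: "current Mv (lr_fun st) x $ s = (\<Sum>j=1..r. \<beta> s j * K j x)"
proof -
  note w = V.pws_pwc[OF V.pws_weight] and c = V.pws_pwc[OF V.pws_smooth1[OF smooth1_component[of s]]]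
  have "current Mv (lr_fun st) x $ s = (LINT v:mdom Mv|lebesgue. \<Sum>j=1..r. K j x * (v $ s * sV st j v * weight v))"
    unfolding current_def lr_fun_K by (simp add: sum_distrib_left mult_ac)
  also have "\<dots> = (\<Sum>j=1..r. K j x * (LINT v:mdom Mv|lebesgue. v $ s * sV st j v * weight v))"
    using sV_pwc w c by (intro V.integral_mdom_sum V.pwc_mult) auto
  also have "\<dots> = (\<Sum>j=1..r. \<beta> s j * K j x)"
  proof (intro sum.cong refl)
    fix j assume j: "j \<in> {1..r}"
    have "(LINT v:mdom Mv|lebesgue. v $ s * sV st j v * weight v) = (\<Sum>a=1..m. u a * ipw Mv (\<lambda>v. v $ s * sV st j v) (U a))"
      using sV_pwc[OF j] c by (intro integral_weight V.pwc_mult)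
    also have "\<dots> = \<beta> s j" unfolding \<beta>_def matAx_def using sV_U by (intro sum.cong) auto
    finally show "K j x * (LINT v:mdom Mv|lebesgue. v $ s * sV st j v * weight v) = \<beta> s j * K j x" by simp
  qed
  finally show ?thesis .
qed

lemma sum_matBx:
  assumes j: "j \<in> {1..r}"
  shows "(\<Sum>a=1..m. u a * matBx Mv (sV st) s a j) = 0"
proof -
  have G: "V.pws (\<lambda>v. weight v * sV st j v)" using sV_pws[OF j] V.pws_weight by (intro V.pws_mult)
  have "(\<Sum>a=1..m. u a * matBx Mv (sV st) s a j) = (\<Sum>a=1..m. u a * dhat Mv s (\<lambda>v. weight v * sV st j v) (U a))"
    unfolding matBx_def using sV_U by (intro sum.cong) auto
  also have "\<dots> = dhat Mv s (\<lambda>v. weight v * sV st j v) (\<lambda>v. \<Sum>a=1..m. u a * U a v)"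
    using G U_pws by (intro V.dhat_sum_right[symmetric]) auto
  also have "\<dots> = 0"
    using G U_pws unit by (intro V.dhat_unit V.pws_sum V.pws_cmult) auto
  finally show ?thesis .
qed

text \<open>The spatial operator of the K-equation with number \<open>a\<close> in strong form,
  where \<open>dhat\<close> combines volume and face terms. K-step and S-step are both reduced to
  it.\<close>

definition K_form :: "(real ^ 'd \<Rightarrow> real ^ 'd) \<Rightarrow> nat \<Rightarrow> (real ^ 'd \<Rightarrow> real) \<Rightarrow> real" where
  "K_form E a \<psi> = (\<Sum>s\<in>UNIV. \<Sum>j=1..r. matAx Mv (sV st) s a j * dhat Mx s (K j) \<psi>
    - matBx Mv (sV st) s a j * ip Mx (\<lambda>x. E x $ s * K j x) \<psi>)"

text \<open>With the central flux, the transport and face terms of the K-step are exactly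
  \<open>dhat\<close> after integration by parts.\<close>

lemma K_step_component:
  assumes KS: "K_step Mx Mv p \<tau> 1 E st K'" and E: "continuous_on UNIV E"
    and a: "a \<in> {1..r}" and \<psi>: "\<psi> \<in> dg_space Mx p"
  shows "1 / \<tau> * (ip Mx (K' a) \<psi> - ip Mx (K a) \<psi>) + K_form E a \<psi> = 0"
proof -
  let ?A = "matAx Mv (sV st)" and ?B = "matBx Mv (sV st)"
  \<comment> \<open>The test vector vanishes in all components but \<open>a\<close>, which isolates
    one equation of the system.\<close>
  define \<Psi> where "\<Psi> i = (if i = a then \<psi> else (\<lambda>_. 0))" for i
  let ?int = "\<lambda>s x. \<Sum>i=1..r. - (\<Sum>j=1..r. ?A s i j * K j x) * pdiff s (\<Psi> i) x - E x $ s * (\<Sum>j=1..r. ?B s i j * K j x) * \<Psi> i x"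
    and ?ia = "\<lambda>s x. - (\<Sum>j=1..r. ?A s a j * K j x) * pdiff s \<psi> x - E x $ s * (\<Sum>j=1..r. ?B s a j * K j x) * \<psi> x"
    and ?vol = "\<lambda>T s j. LINT x:T|lebesgue. K j x * pdiff s \<psi> x"
    and ?field = "\<lambda>T s j. LINT x:T|lebesgue. E x $ s * K j x * \<psi> x"
    and ?fl = "\<lambda>e s j x. mnormal Mx e $ s * avg Mx e (K j) x * jump Mx e \<psi> x"
    and ?num = "\<lambda>e x. \<Sum>i=1..r. num_flux 1 Mx {1..r} ?A K e i x * jump Mx e (\<Psi> i) x"
  let ?srf = "\<lambda>e s j. face_integral Mx e (?fl e s j)"
  have K': "X.pwc (K' i)" if "i \<in> {1..r}" for i
  proof -
    have "\<forall>i\<in>{1..r}. K' i \<in> dg_space Mx p" using KS unfolding K_step_def Let_def by blast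
    then show ?thesis using that X.pws_pwc[OF X.pws_dg_space] by blast
  qed
  have \<psi>p: "X.pws \<psi>" using \<psi> by (rule X.pws_dg_space)
  note \<psi>c = X.pws_pwc[OF \<psi>p] X.pwc_pdiff[OF \<psi>p]
  have Es: "X.pwc (\<lambda>x. E x $ s)" for s using E by (intro X.pwc_continuous continuous_intros)
  have "\<Psi> i \<in> dg_space Mx p" for i using \<psi> X.zero_dg_space by (simp add: \<Psi>_def)
  with KS have eq: "1 / \<tau> * (\<Sum>i=1..r. ip Mx (\<lambda>x. K' i x - K i x) (\<Psi> i)) +
        (\<Sum>T\<in>melems Mx. \<Sum>s\<in>UNIV. LINT x:T|lebesgue.
           ?int s x) +
        (\<Sum>e\<in>mfaces Mx. face_integral Mx e
           (\<lambda>x. ?num e x)) = 0"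
    unfolding K_step_def Let_def by blast
  have "ip Mx (\<lambda>x. K' i x - K i x) (\<Psi> i) = (if i = a then ip Mx (K' a) \<psi> - ip Mx (K a) \<psi> else 0)" if "i \<in> {1..r}" for i
  proof (cases "i = a")
    case True
    have "(LINT y:mdom Mx|lebesgue. K' a y * \<psi> y - K a y * \<psi> y)
        = (LINT y:mdom Mx|lebesgue. K' a y * \<psi> y) - (LINT y:mdom Mx|lebesgue. K a y * \<psi> y)"
      using K'[OF a] K_pwc \<psi>c by (intro set_integral_diff X.pwc_integrable_mdom X.pwc_mult) auto
    then show ?thesis using True by (simp add: \<Psi>_def ip_def left_diff_distrib)
  qed (simp add: \<Psi>_def ip_def)
  then have 1: "(\<Sum>i=1..r. ip Mx (\<lambda>x. K' i x - K i x) (\<Psi> i)) = ip Mx (K' a) \<psi> - ip Mx (K a) \<psi>"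
    using a by simp
  have vol: "(LINT x:T|lebesgue. ?int s x)
      = (\<Sum>j=1..r. - ?A s a j * ?vol T s j
          - ?B s a j * ?field T s j)"
    if T: "T \<in> melems Mx" for T s
  proof -
    have "?int s x
        = (\<Sum>j=1..r. - ?A s a j * (K j x * pdiff s \<psi> x)) + (\<Sum>j=1..r. - ?B s a j * (E x $ s * K j x * \<psi> x))" for x
    proof -
      have "?int s x
          = (\<Sum>i=1..r. if i = a then ?ia s x else 0)"
        by (intro sum.cong) (auto simp: \<Psi>_def pdiff_const)
      also have "\<dots> = ?ia s x"
        using a by simp
      finally show ?thesis by (simp add: sum_distrib_left sum_distrib_right sum_negf mult_ac)
    qed
    then have "(LINT x:T|lebesgue. ?int s x)
        = (LINT x:T|lebesgue. (\<Sum>j=1..r. - ?A s a j * (K j x * pdiff s \<psi> x)) + (\<Sum>j=1..r. - ?B s a j * (E x $ s * K j x * \<psi> x)))"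
      by (simp only:)
    also have "\<dots> = (LINT x:T|lebesgue. \<Sum>j=1..r. - ?A s a j * (K j x * pdiff s \<psi> x))
        + (LINT x:T|lebesgue. \<Sum>j=1..r. - ?B s a j * (E x $ s * K j x * \<psi> x))"
      using K_pwc \<psi>c Es by (intro set_integral_add X.pwc_integrable[OF T] X.pwc_sum X.pwc_cmult X.pwc_mult) auto
    also have "(LINT x:T|lebesgue. \<Sum>j=1..r. - ?A s a j * (K j x * pdiff s \<psi> x))
        = (\<Sum>j=1..r. - ?A s a j * ?vol T s j)"
      using K_pwc \<psi>c by (intro X.pwc_set_integral_sum[OF T] X.pwc_mult) auto
    also have "(LINT x:T|lebesgue. \<Sum>j=1..r. - ?B s a j * (E x $ s * K j x * \<psi> x))
        = (\<Sum>j=1..r. - ?B s a j * ?field T s j)"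
      using K_pwc \<psi>c Es by (intro X.pwc_set_integral_sum[OF T] X.pwc_mult) auto
    finally show ?thesis by (simp add: sum.distrib[symmetric])
  qed
  have 2: "(\<Sum>T\<in>melems Mx. \<Sum>s\<in>UNIV. LINT x:T|lebesgue.
           ?int s x)
      = (\<Sum>s\<in>UNIV. \<Sum>j=1..r. ?A s a j * (- (\<Sum>T\<in>melems Mx. ?vol T s j))
          - ?B s a j * ip Mx (\<lambda>x. E x $ s * K j x) \<psi>)" (is "?L = ?R")
  proof -
    have "?L = (\<Sum>T\<in>melems Mx. \<Sum>s\<in>UNIV. \<Sum>j=1..r. - ?A s a j * ?vol T s j
          - ?B s a j * ?field T s j)"
      by (intro sum.cong vol) auto
    also have "\<dots> = (\<Sum>s\<in>UNIV. \<Sum>j=1..r. \<Sum>T\<in>melems Mx. - ?A s a j * ?vol T s j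
          - ?B s a j * ?field T s j)"
      by (subst sum.swap, intro sum.cong refl, rule sum.swap)
    also have "\<dots> = ?R"
    proof (intro sum.cong refl)
      fix s j
      have "ip Mx (\<lambda>x. E x $ s * K j x) \<psi> = (\<Sum>T\<in>melems Mx. ?field T s j)"
        unfolding ip_def using K_pwc \<psi>c Es by (intro X.pwc_integral_mdom X.pwc_mult) auto
      then show "(\<Sum>T\<in>melems Mx. - ?A s a j * ?vol T s j
          - ?B s a j * ?field T s j)
        = ?A s a j * (- (\<Sum>T\<in>melems Mx. ?vol T s j)) - ?B s a j * ip Mx (\<lambda>x. E x $ s * K j x) \<psi>"
        by (simp add: sum_subtractf sum_distrib_left sum_negf)
    qed
    finally show ?thesis .
  qed
  have face: "face_integral Mx e (\<lambda>x. ?num e x)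
      = (\<Sum>s\<in>UNIV. \<Sum>j=1..r. ?A s a j * ?srf e s j)"
    if e: "e \<in> mfaces Mx" for e
  proof -
    have f: "X.fcont e (\<lambda>x. mnormal Mx e $ s * avg Mx e (K j) x * jump Mx e \<psi> x)" for s j
      using e K_pwc \<psi>c by (intro X.fcont_mult X.fcont_const X.fcont_avg X.fcont_jump)
    have "face_integral Mx e (\<lambda>x. ?num e x)
        = face_integral Mx e (\<lambda>x. \<Sum>s\<in>UNIV. \<Sum>j=1..r. ?A s a j * ?fl e s j x)"
    proof (rule X.face_integral_cong[OF e])
      show "X.fcont e (\<lambda>x. \<Sum>s\<in>UNIV. \<Sum>j=1..r. ?A s a j * ?fl e s j x)"
        using f by (intro X.fcont_sum X.fcont_mult[OF X.fcont_const])
      fix y assume y: "y \<in> rel_interior e"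
      \<comment> \<open>For \<open>\<alpha> = 1\<close> the term with \<open>mat_abs\<close> has
        factor 0, and the zero components of the test vector have no jump.\<close>
      have "?num e y
          = (\<Sum>i=1..r. if i = a then (\<Sum>j=1..r. face_mat Mx e ?A a j * avg Mx e (K j) y) * jump Mx e \<psi> y else 0)"
        using X.jump_const[OF e y] by (intro sum.cong) (auto simp: \<Psi>_def num_flux_def)
      also have "\<dots> = (\<Sum>j=1..r. face_mat Mx e ?A a j * avg Mx e (K j) y) * jump Mx e \<psi> y"
        using a by simp
      also have "\<dots> = (\<Sum>j=1..r. \<Sum>s\<in>UNIV. ?A s a j * ?fl e s j y)"
        by (simp add: face_mat_def sum_distrib_left sum_distrib_right mult_ac)
      also have "\<dots> = (\<Sum>s\<in>UNIV. \<Sum>j=1..r. ?A s a j * ?fl e s j y)"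
        by (rule sum.swap)
      finally show "?num e y = \<dots>" .
    qed
    then show ?thesis
      using f by (simp add: X.face_integral_sum[OF e] X.fcont_sum X.fcont_mult[OF X.fcont_const] X.face_integral_cmult)
  qed
  have 3: "(\<Sum>e\<in>mfaces Mx. face_integral Mx e (\<lambda>x. ?num e x))
      = (\<Sum>s\<in>UNIV. \<Sum>j=1..r. ?A s a j * (\<Sum>e\<in>mfaces Mx. ?srf e s j))"
    (is "?L = ?R")
  proof -
    have "?L = (\<Sum>e\<in>mfaces Mx. \<Sum>s\<in>UNIV. \<Sum>j=1..r. ?A s a j * ?srf e s j)"
      by (intro sum.cong face) auto
    also have "\<dots> = (\<Sum>s\<in>UNIV. \<Sum>j=1..r. \<Sum>e\<in>mfaces Mx. ?A s a j * ?srf e s j)"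
      by (subst sum.swap, intro sum.cong refl, rule sum.swap)
    also have "\<dots> = ?R" by (simp add: sum_distrib_left)
    finally show ?thesis .
  qed
  have "(\<Sum>s\<in>UNIV. \<Sum>j=1..r. ?A s a j * (- (\<Sum>T\<in>melems Mx. ?vol T s j))
          - ?B s a j * ip Mx (\<lambda>x. E x $ s * K j x) \<psi>)
      + (\<Sum>s\<in>UNIV. \<Sum>j=1..r. ?A s a j * (\<Sum>e\<in>mfaces Mx. ?srf e s j))
      = (\<Sum>s\<in>UNIV. \<Sum>j=1..r. ?A s a j * dhat Mx s (K j) \<psi> - ?B s a j * ip Mx (\<lambda>x. E x $ s * K j x) \<psi>)"
    unfolding sum.distrib[symmetric] X.dhat_by_parts[OF K_pws \<psi>p] by (intro sum.cong refl) (simp add: algebra_simps)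
  then show ?thesis using eq unfolding 1 2 3 K_form_def by (simp only: add.assoc)
qed


section \<open>The S-step, the truncation and the new charge\<close>

lemma K_step_dg: "K_step Mx Mv p \<tau> \<alpha> E st K' \<Longrightarrow> i \<in> {1..r} \<Longrightarrow> K' i \<in> dg_space Mx p"
  by (simp add: K_step_def Let_def)

text \<open>Both steps apply the same operator to the same old state: the S-step tests it with
  \<open>Xt k\<close> times \<open>U a\<close>, the K-step with \<open>Xt k\<close> in component
  \<open>a\<close>.\<close>

lemma S_step_eq_ip:
  assumes KS: "K_step Mx Mv p \<tau> 1 E st K'" and E: "continuous_on UNIV E" and \<tau>: "\<tau> \<noteq> 0"
    and a: "a \<in> {1..m}" and Vt: "Vt a = U a" and Xt: "Xt k \<in> dg_space Mx p"
  shows "S_step Mx Mv \<tau> E st Xt Vt k a = ip Mx (Xt k) (K' a)"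
proof -
  let ?A = "matAx Mv (sV st)" and ?B = "matBx Mv (sV st)" and ?S = "scoef st"
  let ?t = "\<lambda>i j s. ?A s a j * (?S i j * dhat Mx s (sX st i) (Xt k))
      - ?B s a j * (?S i j * ip Mx (Xt k) (\<lambda>x. E x $ s * sX st i x))"
  have ar: "a \<in> {1..r}" using a m_le by auto
  have Xp: "X.pws (Xt k)" using Xt by (rule X.pws_dg_space)
  note Xc = X.pws_pwc[OF Xp]
  have Es: "X.pwc (\<lambda>x. E x $ s)" for s using E by (intro X.pwc_continuous continuous_intros)
  have K: "K j = (\<lambda>x. \<Sum>i=1..r. ?S i j * sX st i x)" for j by (auto simp: Kfun_def mult.commute)
  \<comment> \<open>Orthonormality of the old velocity basis against \<open>U a\<close> leaves only
    column \<open>a\<close>.\<close>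
  have "S_aug Mx Mv st Xt Vt k a = (\<Sum>i=1..r. \<Sum>j=1..r. if j = a then ip Mx (Xt k) (sX st i) * ?S i a else 0)"
    unfolding S_aug_def Vt
    using ipw_sV_U[OF a] V.ipw_commute[of "U a"] by (intro sum.cong refl) auto
  also have "\<dots> = (\<Sum>i=1..r. ?S i a * ip Mx (Xt k) (sX st i))"
    using ar by (intro sum.cong refl) (simp add: mult.commute)
  also have "\<dots> = ip Mx (Xt k) (K a)"
    unfolding K using Xc sX_pwc by (intro X.ip_sum[symmetric]) auto
  finally have aug: "S_aug Mx Mv st Xt Vt k a = ip Mx (Xt k) (K a)" .
  have neg: "ip Mx (Xt k) (\<lambda>x. - (E x $ s) * sX st i x) = - ip Mx (Xt k) (\<lambda>x. E x $ s * sX st i x)" for s i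
  proof -
    have "ip Mx (Xt k) (\<lambda>x. - (E x $ s) * sX st i x) = (LINT x:mdom Mx|lebesgue. (- 1) * (Xt k x * (E x $ s * sX st i x)))"
      unfolding ip_def by simp
    also have "\<dots> = (- 1) * (LINT x:mdom Mx|lebesgue. Xt k x * (E x $ s * sX st i x))"
      by (rule set_integral_mult_right)
    finally show ?thesis by (simp add: ip_def)
  qed
  have "(\<Sum>i=1..r. \<Sum>j=1..r. \<Sum>s\<in>UNIV.
        dhat Mx s (sX st i) (Xt k) * ?S i j * ipw Mv (Vt a) (\<lambda>v. v $ s * sV st j v) +
        ip Mx (Xt k) (\<lambda>x. - (E x $ s) * sX st i x) * ?S i j *
          dhat Mv s (\<lambda>v. weight v * sV st j v) (Vt a))
      = (\<Sum>i=1..r. \<Sum>j=1..r. \<Sum>s\<in>UNIV. ?t i j s)"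
    unfolding neg Vt matAx_def matBx_def sV_U[OF a] V.ipw_commute[of "U a"]
    by (intro sum.cong refl) (simp add: mult_ac)
  also have "\<dots> = (\<Sum>j=1..r. \<Sum>s\<in>UNIV. \<Sum>i=1..r. ?t i j s)"
    by (subst sum.swap, intro sum.cong refl, rule sum.swap)
  also have "\<dots> = (\<Sum>s\<in>UNIV. \<Sum>j=1..r. \<Sum>i=1..r. ?t i j s)"
    by (rule sum.swap)
  also have "\<dots> = K_form E a (Xt k)"
    unfolding K_form_def
  proof (intro sum.cong refl)
    fix s j
    have "dhat Mx s (K j) (Xt k) = (\<Sum>i=1..r. ?S i j * dhat Mx s (sX st i) (Xt k))"
      unfolding K using Xp sX_pws by (intro X.dhat_sum_left) auto
    moreover have "ip Mx (\<lambda>x. E x $ s * K j x) (Xt k) = (\<Sum>i=1..r. ?S i j * ip Mx (Xt k) (\<lambda>x. E x $ s * sX st i x))"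
    proof -
      have "ip Mx (\<lambda>x. E x $ s * K j x) (Xt k) = ip Mx (Xt k) (\<lambda>x. \<Sum>i=1..r. ?S i j * (E x $ s * sX st i x))"
        unfolding K by (subst X.ip_commute) (simp add: sum_distrib_left mult_ac)
      also have "\<dots> = (\<Sum>i=1..r. ?S i j * ip Mx (Xt k) (\<lambda>x. E x $ s * sX st i x))"
        using Xc sX_pwc Es by (intro X.ip_sum X.pwc_mult) auto
      finally show ?thesis .
    qed
    ultimately show "(\<Sum>i=1..r. ?t i j s)
        = ?A s a j * dhat Mx s (K j) (Xt k) - ?B s a j * ip Mx (\<lambda>x. E x $ s * K j x) (Xt k)"
      by (simp add: sum_subtractf sum_distrib_left)
  qed
  finally have inc: "S_step Mx Mv \<tau> E st Xt Vt k a = ip Mx (Xt k) (K a) -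
      \<tau> * K_form E a (Xt k)"
    unfolding S_step_def aug by (simp only:)
  have "ip Mx (K' a) (Xt k) - ip Mx (K a) (Xt k)
      + \<tau> * K_form E a (Xt k) = 0"
    using K_step_component[OF KS E ar Xt] \<tau> by (simp add: field_simps)
  then show ?thesis unfolding inc X.ip_commute[of "Xt k"] by linarith
qed

text \<open>Since \<open>K' a\<close> lies in the augmented space, its expansion with the S-step
  coefficients is exact. All remaining terms have velocity functions orthogonal to every
  \<open>U a\<close>, hence to 1, and carry no charge however many of them are kept.\<close>

lemma next_charge:
  assumes KS: "K_step Mx Mv p \<tau> 1 E st K'" and E: "continuous_on UNIV E" and \<tau>: "\<tau> \<noteq> 0"
    and aug: "augmentation Mx Mv p q m U st K' L' r1 Xt r2 Vt"
    and tr: "truncation Mx Mv p q m U r1 Xt r2 Vt (S_step Mx Mv \<tau> E st Xt Vt) (lr_fun st')"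
    and st': "is_state Mx Mv p q m U st'" and T: "T \<in> melems Mx" "x \<in> interior T"
  shows "charge Mv (lr_fun st') x = (\<Sum>a=1..m. u a * K' a x)"
proof -
  interpret N: dg_state Mx Mv p q m U u st' using st' unit by unfold_locales
  define Kt where "Kt l x = (\<Sum>k=1..r1. S_step Mx Mv \<tau> E st Xt Vt k l * Xt k x)" for l x
  have Xt: "Xt k \<in> dg_space Mx p" if "k \<in> {1..r1}" for k using aug that unfolding augmentation_def Let_def by blast
  have Vt: "Vt l \<in> dg_space Mv q" if "l \<in> {1..r2}" for l using aug that unfolding augmentation_def Let_def by blast
  have oX: "orthonormal_x Mx {1..r1} Xt" and oV: "orthonormal_v Mv {1..r2} Vt" and r2: "m \<le> r2"
    and VtU: "\<And>a. a \<in> {1..m} \<Longrightarrow> Vt a = U a"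
    using aug unfolding augmentation_def Let_def by blast+
  have span: "in_span (mdom Mx) (Xt ` {1..r1}) (K' a)" if "a \<in> {1..r}" for a
    using aug that unfolding augmentation_def Let_def by blast
  have Xtp: "X.pwc (Xt k)" if "k \<in> {1..r1}" for k using X.pws_pwc[OF X.pws_dg_space[OF Xt[OF that]]] .
  have Vtp: "V.pwc (Vt l)" if "l \<in> {1..r2}" for l using V.pws_pwc[OF V.pws_dg_space[OF Vt[OF that]]] .
  have Ktp: "X.pwc (Kt l)" for l unfolding Kt_def using Xtp by (intro X.pwc_sum X.pwc_cmult) auto
  have KtK: "Kt a x = K' a x" if a: "a \<in> {1..m}" and T: "T \<in> melems Mx" "x \<in> interior T" for a T x
  proof -
    have ar: "a \<in> {1..r}" using a m_le by auto
    have "K' a x = (\<Sum>k=1..r1. ip Mx (Xt k) (K' a) * Xt k x)"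
      using oX Xtp X.pws_pwc[OF X.pws_dg_space[OF K_step_dg[OF KS ar]]] span[OF ar] T
      by (intro X.orthonormal_expansion) auto
    also have "\<dots> = Kt a x"
      unfolding Kt_def using S_step_eq_ip[where Vt = Vt and Xt = Xt, OF KS E \<tau> a VtU[OF a] Xt] by (intro sum.cong) auto
    finally show ?thesis by simp
  qed
  obtain R R' :: nat and \<sigma> Y W where R: "R' \<le> R" and
    YW: "\<forall>k\<in>{1..R}. 0 \<le> \<sigma> k \<and> Y k \<in> dg_space Mx p \<and> W k \<in> dg_space Mv q \<and>
        in_span (mdom Mv) (Vt ` {m+1..r2}) (W k)" and
    ae': "AE (x, v) in lebesgue_on (mdom Mx \<times> mdom Mv). lr_fun st' (x, v) =
        weight v * (\<Sum>a=1..m. (\<Sum>k=1..r1. S_step Mx Mv \<tau> E st Xt Vt k a * Xt k x) * U a v) +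
        weight v * (\<Sum>k=1..R'. \<sigma> k * Y k x * W k v)"
    using tr unfolding truncation_def Let_def
    by (elim exE conjE) (rule that, assumption+)
  note ae = ae'[folded Kt_def]
  have W: "W k \<in> dg_space Mv q \<and> in_span (mdom Mv) (Vt ` {m+1..r2}) (W k)" if "k \<in> {1..R}" for k
    using YW that by blast
  note w = V.pws_pwc[OF V.pws_weight]
  have Wp: "V.pwc (W k)" if "k \<in> {1..R'}" for k
  proof -
    have "k \<in> {1..R}" using that R by auto
    from V.pws_pwc[OF V.pws_dg_space[OF conjunct1[OF W[OF this]]]] show ?thesis .
  qed
  have intU: "(LINT v:mdom Mv|lebesgue. U a v * weight v) = u a" if a: "a \<in> {1..m}" for a
  proof -
    have "(LINT v:mdom Mv|lebesgue. U a v * weight v) = (\<Sum>b=1..m. u b * ipw Mv (sV st a) (U b))"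
      using integral_weight[OF U_pwc[OF a]] sV_U[OF a] by simp
    also have "\<dots> = (\<Sum>b=1..m. if a = b then u b else 0)"
      using ipw_sV_U a m_le by (intro sum.cong) auto
    finally show ?thesis using a by simp
  qed
  \<comment> \<open>By the expansion of 1 this integral is a combination of inner products with the
    \<open>U b\<close>, all of which vanish on the span of the \<open>Vt l\<close> with
    \<open>l > m\<close>.\<close>
  have intW: "(LINT v:mdom Mv|lebesgue. W k v * weight v) = 0" if k: "k \<in> {1..R'}" for k
  proof -
    have kR: "k \<in> {1..R}" using k R by auto
    have "inj_on Vt {m+1..r2}" using V.orthonormal_v_inj[OF oV] by (rule inj_on_subset) auto
    then obtain c where c: "\<And>T v. T \<in> melems Mv \<Longrightarrow> v \<in> interior T \<Longrightarrow> W k v = (\<Sum>l\<in>{m+1..r2}. c l * Vt l v)"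
      using V.in_span_interior[of Vt "{m+1..r2}" "W k"] W[OF kR] Vtp Wp[OF k] by auto
    have "ipw Mv (W k) (U b) = 0" if b: "b \<in> {1..m}" for b
    proof -
      have "ipw Mv (U b) (W k) = ipw Mv (U b) (\<lambda>v. \<Sum>l\<in>{m+1..r2}. c l * Vt l v)"
        using c Wp[OF k] Vtp U_pwc[OF b] by (intro V.ipw_cong V.pwc_sum V.pwc_cmult) auto
      also have "\<dots> = (\<Sum>l\<in>{m+1..r2}. c l * ipw Mv (U b) (Vt l))"
        using Vtp U_pwc[OF b] by (intro V.ipw_sum) auto
      also have "\<dots> = 0"
      proof (intro sum.neutral ballI)
        fix l assume l: "l \<in> {m+1..r2}"
        have "ipw Mv (Vt b) (Vt l) = 0" using oV b l r2 by (auto simp: orthonormal_v_def)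
        then show "c l * ipw Mv (U b) (Vt l) = 0" using VtU[OF b] by simp
      qed
      finally show ?thesis by (subst V.ipw_commute)
    qed
    then show ?thesis using integral_weight[OF Wp[OF k]] by simp
  qed
  \<comment> \<open>The new state is prescribed only almost everywhere in phase space; slicing
    determines its charge for almost every \<open>x\<close>.\<close>
  have "AE x in lebesgue_on (mdom Mx). AE v in lebesgue_on (mdom Mv). lr_fun st' (x, v) =
        weight v * (\<Sum>a=1..m. Kt a x * U a v) + weight v * (\<Sum>k=1..R'. \<sigma> k * Y k x * W k v)"
    using ae by (rule AE_lebesgue_on_product) (simp_all add: mdom_def)
  then have "AE x in lebesgue_on (mdom Mx). charge Mv (lr_fun st') x = (\<Sum>a=1..m. u a * Kt a x)"
  proof eventually_elim
    case (elim x)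
    let ?F = "\<lambda>v. (\<Sum>a=1..m. Kt a x * (U a v * weight v)) + (\<Sum>k=1..R'. (\<sigma> k * Y k x) * (W k v * weight v))"
    have F: "V.pwc (\<lambda>v. \<Sum>a=1..m. Kt a x * (U a v * weight v))" "V.pwc (\<lambda>v. \<Sum>k=1..R'. (\<sigma> k * Y k x) * (W k v * weight v))"
      using U_pwc Wp w by (auto intro!: V.pwc_sum V.pwc_cmult V.pwc_mult)
    have l: "V.pwc (\<lambda>v. lr_fun st' (x, v))"
      unfolding N.lr_fun_K using N.sV_pwc w by (intro V.pwc_sum V.pwc_cmult V.pwc_mult) auto
    have "AE v in lebesgue_on (mdom Mv). lr_fun st' (x, v) = ?F v"
      using elim by eventually_elim (simp add: sum_distrib_left mult_ac)
    then have "lr_fun st' (x, v) = ?F v" if "T \<in> melems Mv" "v \<in> interior T" for T v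
      using V.AE_eq_interior[OF l V.pwc_add[OF F]] that by blast
    then have "charge Mv (lr_fun st') x = (LINT v:mdom Mv|lebesgue. ?F v)"
      unfolding charge_def using l F by (intro V.integral_mdom_cong V.pwc_add) auto
    also have "\<dots> = (LINT v:mdom Mv|lebesgue. \<Sum>a=1..m. Kt a x * (U a v * weight v))
        + (LINT v:mdom Mv|lebesgue. \<Sum>k=1..R'. (\<sigma> k * Y k x) * (W k v * weight v))"
      using F by (intro set_integral_add V.pwc_integrable_mdom)
    also have "(LINT v:mdom Mv|lebesgue. \<Sum>a=1..m. Kt a x * (U a v * weight v)) = (\<Sum>a=1..m. Kt a x * u a)"
      using U_pwc w intU by (subst V.integral_mdom_sum) (auto intro!: V.pwc_mult)
    also have "(LINT v:mdom Mv|lebesgue. \<Sum>k=1..R'. (\<sigma> k * Y k x) * (W k v * weight v)) = 0"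
      using Wp w intW by (subst V.integral_mdom_sum) (auto intro!: V.pwc_mult)
    finally show ?case by (simp add: mult.commute)
  qed
  \<comment> \<open>Both sides are piecewise continuous, so the identity extends to all points
    inside the elements.\<close>
  then have "charge Mv (lr_fun st') x = (\<Sum>a=1..m. u a * Kt a x)"
    using X.pws_pwc[OF N.charge_pws] Ktp
    by (intro X.AE_eq_interior[OF _ _ _ T] X.pwc_sum X.pwc_cmult)
  then show ?thesis using KtK T by simp
qed

section \<open>The discrete continuity equation and the mass balance\<close>

lemma sum_dhat_current:
  assumes \<psi>: "X.pws \<psi>"
  defines "C \<equiv> current Mv (lr_fun st)"
  shows "(\<Sum>s\<in>UNIV. \<Sum>j=1..r. \<beta> s j * dhat Mx s (K j) \<psi>)
    = - (\<Sum>T\<in>melems Mx. LINT x:T|lebesgue. C x \<bullet> grad \<psi> x)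
      + (\<Sum>e\<in>mfaces Mx. face_integral Mx e (\<lambda>x. (mnormal Mx e \<bullet> avg Mx e C x) * jump Mx e \<psi> x))"
proof -
  let ?f = "\<lambda>e s x. mnormal Mx e $ s * avg Mx e (\<lambda>x. C x $ s) x * jump Mx e \<psi> x"
  have C: "(\<lambda>x. C x $ s) = (\<lambda>x. \<Sum>j=1..r. \<beta> s j * K j x)" for s
    unfolding C_def by (intro ext current_eq)
  have Cp: "X.pws (\<lambda>x. C x $ s)" for s unfolding C using K_pws by (intro X.pws_sum X.pws_cmult)
  note Cc = X.pws_pwc[OF Cp] and \<psi>c = X.pws_pwc[OF \<psi>] X.pwc_pdiff[OF \<psi>]
  have "(\<Sum>s\<in>UNIV. \<Sum>j=1..r. \<beta> s j * dhat Mx s (K j) \<psi>) = (\<Sum>s\<in>UNIV. dhat Mx s (\<lambda>x. C x $ s) \<psi>)"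
    unfolding C using K_pws \<psi> by (intro sum.cong refl X.dhat_sum_left[symmetric])
  also have "\<dots> = - (\<Sum>s\<in>UNIV. \<Sum>T\<in>melems Mx. LINT x:T|lebesgue. C x $ s * pdiff s \<psi> x)
      + (\<Sum>s\<in>UNIV. \<Sum>e\<in>mfaces Mx. face_integral Mx e (?f e s))"
    unfolding X.dhat_by_parts[OF Cp \<psi>] by (simp add: sum.distrib sum_negf sum_subtractf)
  also have "(\<Sum>s\<in>UNIV. \<Sum>T\<in>melems Mx. LINT x:T|lebesgue. C x $ s * pdiff s \<psi> x)
      = (\<Sum>T\<in>melems Mx. LINT x:T|lebesgue. C x \<bullet> grad \<psi> x)"
  proof (subst sum.swap, intro sum.cong refl)
    fix T assume T: "T \<in> melems Mx"
    have "(LINT x:T|lebesgue. \<Sum>s\<in>UNIV. 1 * (C x $ s * pdiff s \<psi> x)) = (\<Sum>s\<in>UNIV. 1 * (LINT x:T|lebesgue. C x $ s * pdiff s \<psi> x))"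
      using Cc \<psi>c by (intro X.pwc_set_integral_sum[OF T] X.pwc_mult)
    then show "(\<Sum>s\<in>UNIV. LINT x:T|lebesgue. C x $ s * pdiff s \<psi> x) = (LINT x:T|lebesgue. C x \<bullet> grad \<psi> x)"
      by (simp add: inner_vec_def grad_def)
  qed
  also have "(\<Sum>s\<in>UNIV. \<Sum>e\<in>mfaces Mx. face_integral Mx e (?f e s))
      = (\<Sum>e\<in>mfaces Mx. face_integral Mx e (\<lambda>x. (mnormal Mx e \<bullet> avg Mx e C x) * jump Mx e \<psi> x))"
  proof (subst sum.swap, intro sum.cong refl)
    fix e assume e: "e \<in> mfaces Mx"
    have f: "X.fcont e (?f e s)" for s
      using e Cc \<psi>c by (intro X.fcont_mult X.fcont_const X.fcont_avg X.fcont_jump)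
    have "face_integral Mx e (\<lambda>x. (mnormal Mx e \<bullet> avg Mx e C x) * jump Mx e \<psi> x)
        = face_integral Mx e (\<lambda>x. \<Sum>s\<in>UNIV. ?f e s x)"
      using f X.avg_component[OF Cc e]
      by (intro X.face_integral_cong[OF e] X.fcont_sum) (auto simp: inner_vec_def sum_distrib_right)
    then show "(\<Sum>s\<in>UNIV. face_integral Mx e (?f e s))
        = face_integral Mx e (\<lambda>x. (mnormal Mx e \<bullet> avg Mx e C x) * jump Mx e \<psi> x)"
      using f by (simp add: X.face_integral_sum[OF e])
  qed
  finally show ?thesis .
qed

lemma continuity_step:
  assumes step: "time_step Mx Mv p q m U \<tau> 1 E st st'" and E: "continuous_on UNIV E" and \<tau>: "\<tau> \<noteq> 0"
    and st': "is_state Mx Mv p q m U st'" and \<psi>: "\<psi> \<in> dg_space Mx p"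
  defines "C \<equiv> current Mv (lr_fun st)"
  shows "1 / \<tau> * (LINT x:mdom Mx|lebesgue. (charge Mv (lr_fun st') x - charge Mv (lr_fun st) x) * \<psi> x)
    - (\<Sum>T\<in>melems Mx. LINT x:T|lebesgue. C x \<bullet> grad \<psi> x)
    + (\<Sum>e\<in>mfaces Mx. face_integral Mx e (\<lambda>x. (mnormal Mx e \<bullet> avg Mx e C x) * jump Mx e \<psi> x)) = 0"
proof -
  let ?A = "matAx Mv (sV st)" and ?B = "matBx Mv (sV st)"
  let ?t = "\<lambda>a s j. u a * ?A s a j * dhat Mx s (K j) \<psi> - u a * ?B s a j * ip Mx (\<lambda>x. E x $ s * K j x) \<psi>"
  obtain K' L' r1 Xt r2 Vt where KS: "K_step Mx Mv p \<tau> 1 E st K'"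
    and aug: "augmentation Mx Mv p q m U st K' L' r1 Xt r2 Vt"
    and tr: "truncation Mx Mv p q m U r1 Xt r2 Vt (S_step Mx Mv \<tau> E st Xt Vt) (lr_fun st')"
    using step unfolding time_step_def by blast
  interpret N: dg_state Mx Mv p q m U u st' using st' unit by unfold_locales
  have \<psi>p: "X.pws \<psi>" using \<psi> by (rule X.pws_dg_space)
  note \<psi>c = X.pws_pwc[OF \<psi>p]
  have ar: "a \<in> {1..r}" if "a \<in> {1..m}" for a using that m_le by auto
  have K'p: "X.pwc (K' a)" if "a \<in> {1..m}" for a
    using X.pws_pwc[OF X.pws_dg_space[OF K_step_dg[OF KS ar[OF that]]]] .
  have "(LINT x:mdom Mx|lebesgue. (charge Mv (lr_fun st') x - charge Mv (lr_fun st) x) * \<psi> x)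
      = (LINT x:mdom Mx|lebesgue. charge Mv (lr_fun st') x * \<psi> x) - (LINT x:mdom Mx|lebesgue. charge Mv (lr_fun st) x * \<psi> x)"
    unfolding left_diff_distrib
    using X.pws_pwc[OF charge_pws] X.pws_pwc[OF N.charge_pws] \<psi>c
    by (intro set_integral_diff X.pwc_integrable_mdom X.pwc_mult)
  also have "(LINT x:mdom Mx|lebesgue. charge Mv (lr_fun st) x * \<psi> x) = (LINT x:mdom Mx|lebesgue. \<Sum>a=1..m. u a * (K a x * \<psi> x))"
    unfolding charge_eq by (simp add: sum_distrib_left sum_distrib_right mult_ac)
  also have "\<dots> = (\<Sum>a=1..m. u a * ip Mx (K a) \<psi>)"
    unfolding ip_def using K_pwc \<psi>c by (intro X.integral_mdom_sum X.pwc_mult) auto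
  also have "(LINT x:mdom Mx|lebesgue. charge Mv (lr_fun st') x * \<psi> x) = (LINT x:mdom Mx|lebesgue. \<Sum>a=1..m. u a * (K' a x * \<psi> x))"
    using next_charge[OF KS E \<tau> aug tr st'] X.pws_pwc[OF N.charge_pws] K'p \<psi>c
    by (intro X.integral_mdom_cong X.pwc_mult X.pwc_sum X.pwc_const) (auto simp: sum_distrib_left sum_distrib_right mult_ac)
  also have "\<dots> = (\<Sum>a=1..m. u a * ip Mx (K' a) \<psi>)"
    unfolding ip_def using K'p \<psi>c by (intro X.integral_mdom_sum X.pwc_mult) auto
  finally have charge: "(LINT x:mdom Mx|lebesgue. (charge Mv (lr_fun st') x - charge Mv (lr_fun st) x) * \<psi> x)
      = (\<Sum>a=1..m. u a * (ip Mx (K' a) \<psi> - ip Mx (K a) \<psi>))"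
    by (simp add: right_diff_distrib sum_subtractf)
  have "(\<Sum>a=1..m. u a * K_form E a \<psi>)
      = (\<Sum>a=1..m. \<Sum>s\<in>UNIV. \<Sum>j=1..r. ?t a s j)"
    by (simp add: K_form_def sum_distrib_left right_diff_distrib mult_ac)
  also have "\<dots> = (\<Sum>s\<in>UNIV. \<Sum>j=1..r. \<Sum>a=1..m. ?t a s j)"
    by (subst sum.swap, rule sum.cong, rule refl, rule sum.swap)
  also have "\<dots> = (\<Sum>s\<in>UNIV. \<Sum>j=1..r. \<beta> s j * dhat Mx s (K j) \<psi>)"
  proof (intro sum.cong refl)
    fix s j assume j: "j \<in> {1..r}"
    have "(\<Sum>a=1..m. ?t a s j)
        = \<beta> s j * dhat Mx s (K j) \<psi> - (\<Sum>a=1..m. u a * ?B s a j) * ip Mx (\<lambda>x. E x $ s * K j x) \<psi>"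
      by (simp add: \<beta>_def sum_subtractf sum_distrib_right)
    then show "(\<Sum>a=1..m. ?t a s j)
        = \<beta> s j * dhat Mx s (K j) \<psi>"
      using sum_matBx[OF j, of s] by simp
  qed
  finally have flux: "(\<Sum>a=1..m. u a * K_form E a \<psi>)
      = (\<Sum>s\<in>UNIV. \<Sum>j=1..r. \<beta> s j * dhat Mx s (K j) \<psi>)" .
  have "(\<Sum>a=1..m. u a * (1 / \<tau> * (ip Mx (K' a) \<psi> - ip Mx (K a) \<psi>)
      + K_form E a \<psi>)) = 0"
    using K_step_component[OF KS E ar \<psi>] by (intro sum.neutral) auto
  then have "(\<Sum>a=1..m. u a * (1 / \<tau> * (ip Mx (K' a) \<psi> - ip Mx (K a) \<psi>)))
      + (\<Sum>s\<in>UNIV. \<Sum>j=1..r. \<beta> s j * dhat Mx s (K j) \<psi>) = 0"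
    unfolding distrib_left sum.distrib flux .
  moreover have "(\<Sum>a=1..m. u a * (1 / \<tau> * (ip Mx (K' a) \<psi> - ip Mx (K a) \<psi>)))
      = 1 / \<tau> * (\<Sum>a=1..m. u a * (ip Mx (K' a) \<psi> - ip Mx (K a) \<psi>))"
    unfolding sum_distrib_left by (intro sum.cong refl mult.left_commute)
  ultimately have "1 / \<tau> * (\<Sum>a=1..m. u a * (ip Mx (K' a) \<psi> - ip Mx (K a) \<psi>))
      + (\<Sum>s\<in>UNIV. \<Sum>j=1..r. \<beta> s j * dhat Mx s (K j) \<psi>) = 0" by (simp only:)
  then show ?thesis
    unfolding charge C_def sum_dhat_current[OF \<psi>p] by (simp add: algebra_simps)
qed

text \<open>The constant 1 is an admissible test function without gradient and without jumps, and by
  periodicity there is no boundary flux left.\<close>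

lemma mass_step:
  assumes step: "time_step Mx Mv p q m U \<tau> 1 E st st'" and E: "continuous_on UNIV E" and \<tau>: "\<tau> \<noteq> 0"
    and st': "is_state Mx Mv p q m U st'"
  shows "(LINT x:mdom Mx|lebesgue. charge Mv (lr_fun st') x) = (LINT x:mdom Mx|lebesgue. charge Mv (lr_fun st) x)"
proof -
  interpret N: dg_state Mx Mv p q m U u st' using st' unit by unfold_locales
  let ?C = "current Mv (lr_fun st)"
  have "grad (\<lambda>_. 1) x = 0" for x :: "real ^ 'd" by (simp add: grad_def pdiff_const vec_eq_iff)
  moreover have "face_integral Mx e (\<lambda>x. (mnormal Mx e \<bullet> avg Mx e ?C x) * jump Mx e (\<lambda>_. 1) x) = 0"
    if e: "e \<in> mfaces Mx" for e
  proof -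
    have "face_integral Mx e (\<lambda>x. (mnormal Mx e \<bullet> avg Mx e ?C x) * jump Mx e (\<lambda>_. 1) x) = face_integral Mx e (\<lambda>_. 0)"
      using X.jump_const[OF e] by (intro X.face_integral_cong[OF e] X.fcont_const) simp
    then show ?thesis using X.face_integral_cmult[of e 0 "\<lambda>_. 0"] by simp
  qed
  ultimately have "(LINT x:mdom Mx|lebesgue. charge Mv (lr_fun st') x - charge Mv (lr_fun st) x) = 0"
    using continuity_step[OF step E \<tau> st' X.one_dg_space] \<tau> by simp
  then show ?thesis
    using set_integral_diff(2)[OF X.pwc_integrable_mdom[OF X.pws_pwc[OF N.charge_pws]] X.pwc_integrable_mdom[OF X.pws_pwc[OF charge_pws]]]
    by simp
qed

end

theorem theorem3p4:
  fixes Mx Mv :: "'d::finite mesh"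
    and p q m :: nat
    and U :: "nat \<Rightarrow> real ^ 'd \<Rightarrow> real"
    and \<tau> :: real
    and E :: "nat \<Rightarrow> real ^ 'd \<Rightarrow> real ^ 'd"
    and st :: "nat \<Rightarrow> 'd lr_state"
    and f :: "nat \<Rightarrow> (real ^ 'd) \<times> (real ^ 'd) \<Rightarrow> real"
    and \<rho> :: "nat \<Rightarrow> real ^ 'd \<Rightarrow> real"
    and j :: "nat \<Rightarrow> real ^ 'd \<Rightarrow> real ^ 'd"
  assumes "periodic_mesh Mx" and "periodic_mesh Mv"
    and "\<tau> > 0"
    and "m \<ge> 1"
    and "\<forall>a\<in>{1..m}. U a \<in> dg_space Mv q"
    and "in_span (mdom Mv) (U ` {1..m}) (\<lambda>v. 1)"
    and "dlra_run Mx Mv p q m U \<tau> 1 E st"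
    and "\<And>n. f n = lr_fun (st n)"
    and "\<And>n. \<rho> n = charge Mv (f n)"
    and "\<And>n. j n = current Mv (f n)"
    and "compatible Mx (\<rho> 0)"
  shows "(\<forall>n. \<forall>\<psi>\<in>dg_space Mx p.
            1 / \<tau> * (LINT x:mdom Mx|lebesgue. (\<rho> (Suc n) x - \<rho> n x) * \<psi> x)
            - (\<Sum>T\<in>melems Mx. LINT x:T|lebesgue. j n x \<bullet> grad \<psi> x)
            + (\<Sum>e\<in>mfaces Mx. face_integral Mx e
                 (\<lambda>x. (mnormal Mx e \<bullet> avg Mx e (j n) x) * jump Mx e \<psi> x)) = 0)
       \<and> (\<forall>n. (LINT x:mdom Mx|lebesgue. \<rho> (Suc n) x) = (LINT x:mdom Mx|lebesgue. \<rho> n x))"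
proof -
  interpret X: pmesh Mx using assms(1) by unfold_locales
  interpret V: pmesh Mv using assms(2) by unfold_locales
  have run: "is_state Mx Mv p q m U (st n)"
    "compatible Mx (\<rho> n) \<Longrightarrow> electric_field Mx (\<rho> n) (E n)"
    "time_step Mx Mv p q m U \<tau> 1 (E n) (st n) (st (Suc n))" for n
    using assms(7) unfolding dlra_run_def assms(8-9) by blast+
  \<comment> \<open>The \<open>U a\<close> belong to the velocity basis of the initial state;
    orthonormality makes the family injective, so that 1 has coefficients by index.\<close>
  have "orthonormal_v Mv {1..m} U"
    unfolding orthonormal_v_def
  proof (intro ballI)
    fix a b assume ab: "a \<in> {1..m}" "b \<in> {1..m}"
    have o: "orthonormal_v Mv {1..srank (st 0)} (sV (st 0))" and "m \<le> srank (st 0)"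
      and "sV (st 0) a = U a" "sV (st 0) b = U b"
      using run(1)[of 0] ab by (simp_all add: is_state_def)
    moreover from this ab have "a \<in> {1..srank (st 0)}" "b \<in> {1..srank (st 0)}" by auto
    ultimately show "ipw Mv (U a) (U b) = (if a = b then 1 else 0)"
      unfolding orthonormal_v_def by metis
  qed
  then have "inj_on U {1..m}" by (rule V.orthonormal_v_inj)
  moreover have "V.pwc (U a)" if "a \<in> {1..m}" for a
    using V.pws_pwc[OF V.pws_dg_space] assms(5) that by blast
  ultimately obtain u where u: "\<And>T v. T \<in> melems Mv \<Longrightarrow> v \<in> interior T \<Longrightarrow> 1 = (\<Sum>a=1..m. u a * U a v)"
    using V.in_span_interior[OF assms(6) _ _ V.pwc_const] by blast
  have st: "dg_state Mx Mv p q m U u (st n)" for n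
    using run(1) u by unfold_locales auto
  have E: "continuous_on UNIV (E n)" if "compatible Mx (\<rho> n)" for n
    using run(2)[OF that] by (auto simp: electric_field_def)
  \<comment> \<open>Only an implication at this stage, since the field \<open>E n\<close> is
    constrained only for compatible densities.\<close>
  have mass: "(LINT x:mdom Mx|lebesgue. \<rho> (Suc n) x) = (LINT x:mdom Mx|lebesgue. \<rho> n x)" if "compatible Mx (\<rho> n)" for n
    using dg_state.mass_step[OF st run(3) E[OF that] _ run(1)] assms(3) by (simp add: assms(8,9))
  \<comment> \<open>Compatibility prescribes the total mass, so it is inherited by the next density
    together with the mass.\<close>
  have comp: "compatible Mx (\<rho> n)" for n
  proof (induction n)
    case 0
    show ?case by (rule assms(11))
  next
    case (Suc n)
    then show ?case using mass[OF Suc] by (simp add: compatible_def)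
  qed
  have "1 / \<tau> * (LINT x:mdom Mx|lebesgue. (\<rho> (Suc n) x - \<rho> n x) * \<psi> x)
            - (\<Sum>T\<in>melems Mx. LINT x:T|lebesgue. j n x \<bullet> grad \<psi> x)
            + (\<Sum>e\<in>mfaces Mx. face_integral Mx e
                 (\<lambda>x. (mnormal Mx e \<bullet> avg Mx e (j n) x) * jump Mx e \<psi> x)) = 0"
    if "\<psi> \<in> dg_space Mx p" for n \<psi>
    using dg_state.continuity_step[OF st run(3) E[OF comp] _ run(1) that] assms(3) unfolding assms(8-10) by blast
  then show ?thesis using mass[OF comp] by blast
qed

end
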